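(* Let $\mathfrak g$ and $\mathfrak g'$ come from root data, and let $r,s,r',s'>0$ with $1\le rs$, $1\le r's'$. Suppose we have two morphisms of $k\llbracket\hslash\rrbracket$-algebras $\alpha,\alpha':U(\mathfrak g)^{\mathrm{an}}_{r,s}\llbracket\hslash\rrbracket\to U(\mathfrak g')^{\mathrm{an}}_{r',s'}\llbracket\hslash\rrbracket$ such that $\alpha\equiv\alpha'$ modulo $\hslash$. Suppose that $H_b^1(\mathfrak g_{r,s},U(\mathfrak g')^{\mathrm{an}}_{r',s'})=0$. Then there exists a convolution invertible generalised element $F:k\to U(\mathfrak g')^{\mathrm{an}}_{r',s'}\llbracket\hslash\rrbracket$ such that $\alpha'=F\ast\alpha\ast F^{-1}$.
   Context: $k$ is a field of characteristic $0$ complete for a non-Archimedean absolute value; Banach spaces have ultrametric norms; $\hat\otimes$ is the completed projective tensor product, extended to the Ind-completion $\mathrm{IndBan}_k$ of the category of Banach spaces and bounded maps; $\coprod_i^{\le1}V_i=\{(v_i):\lim\|v_i\|=0\}$ with sup norm. Root datum: a free $\mathbb Z$-module $\Phi$, a submodule $\Psi\subset\Phi$ with basis $\{\alpha_i\}_{i\in I}$, a symmetric bilinear form $(\cdot,\cdot):\Phi\times\Phi\to\mathbb Q$ with $(\alpha_i,\alpha_i)\in2\mathbb N$ (nonzero), $(\alpha_i,\alpha_j)\le0$ for $i\ne j$, and $\lambda_i\in\mathrm{Hom}(\Phi,\mathbb Z)$ with $\lambda_i(\alpha)=2(\alpha_i,\alpha)/(\alpha_i,\alpha_i)$. $\mathscr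 H_0=\coprod^{\le1}_{\underline n}k\,H^{\underline n}$, $\underline n$ finitely supported in $\mathbb N^I$ (Tate algebra in commuting primitive variables $H_i$ of norm 1). $V_0=\coprod_{i\in I}^{\le1}k\,v_i$, $T_r(V_0)=\coprod_{n\ge0}^{\le1}(V_0^{\hat\otimes n})_{r^n}$ (norm on degree $n$ scaled by $r^n$). $U^-(\mathfrak g)_r^{\mathrm{an}}=U^+(\mathfrak g)_r^{\mathrm{an}}$ is the quotient of $T_r(V_0)$ by the closed two-sided ideal generated by $\sum_{m=0}^{1-\lambda_i(\alpha_j)}(-1)^m\binom{1-\lambda_i(\alpha_j)}{m}v_i^{1-\lambda_i(\alpha_j)-m}v_jv_i^m$, $i\ne j$. For $1\le rs$, $U(\mathfrak g)^{\mathrm{an}}_{r,s}=U^-(\mathfrak g)_r^{\mathrm{an}}\hat\otimes\mathscr H_0\hat\otimes U^+(\mathfrak g)_s^{\mathrm{an}}$ is the Banach algebra in which the three factors are subalgebras, $y\otimes h\otimes x=yhx$, and with $F_i=v_i\otimes1\otimes1$, $E_i=1\otimes1\otimes v_i$: $[H_i,E_j]=\lambda_i(\alpha_j)E_j$, $[H_i,F_j]=-\lambda_i(\alpha_j)F_j$, $[E_i,F_j]=\delta_{ij}H_i$. $\mathfrak g_{r,s}$ is the closed Lie subalgebra of $U(\mathfrak g)^{\mathrm{an}}_{r,s}$ generated by all $F_i,H_i,E_i$. $k\llbracket\hslash\rrbracket=\prod_{n\ge0}k\,\hslash^n=\lim_nk[\hslash]/(\hslash^n)$ and $X\llbracket\hslash\rrbracket=\prod_{n\ge0}X\,\hslash^n$,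 products taken in $\mathrm{IndBan}_k$; $X\llbracket\hslash\rrbracket$ is an IndBanach algebra when $X$ is. Reducing modulo $\hslash$, $\alpha$ gives an algebra map $\alpha_0:U(\mathfrak g)^{\mathrm{an}}_{r,s}\to U(\mathfrak g')^{\mathrm{an}}_{r',s'}$ (equal to the reduction of $\alpha'$), and $\mathfrak g_{r,s}$ acts on $U(\mathfrak g')^{\mathrm{an}}_{r',s'}$ by $x\cdot u=[\alpha_0(x),u]$. For a Banach $\mathfrak g_{r,s}$-module $M$, $C_b^n(\mathfrak g_{r,s},M)$ is the space of bounded alternating $n$-linear maps $\mathfrak g_{r,s}^n\to M$ ($C_b^0=M$), $\delta_n(f)(x_1,\dots,x_{n+1})=\sum_{i<j}(-1)^{i+j}f([x_i,x_j],x_1,..,\hat x_i,..,\hat x_j,..,x_{n+1})+\sum_i(-1)^{i+1}x_if(x_1,..,\hat x_i,..,x_{n+1})$, and $H_b^n(\mathfrak g_{r,s},M)=\mathrm{Ker}(\delta_n)/\mathrm{Im}(\delta_{n-1})$. A generalised element of an IndBanach algebra $\mathcal A$ is a morphism $F:k\to\mathcal A$; convolution is $F\ast G:k\cong k\hat\otimes k\to\mathcal A\hat\otimes\mathcal A\to\mathcal A$, with unit the unit of $\mathcal A$; for $\alpha:X\to\mathcal A$, $F\ast\alpha\ast F^{-1}$ is $X\cong k\hat\otimes X\hat\otimes k\to\mathcal A^{\hat\otimes3}\to\mathcal A$. *)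

theory Defs
  imports Complex_Main "HOL-Algebra.Module" "HOL-Algebra.QuotRing" "HOL-Library.Multiset"
begin

section \<open>Banach spaces over a complete non-Archimedean field\<close>

class complete_nonarch_field = field_char_0 +
  fixes absv :: "'a \<Rightarrow> real"
  assumes absv_nonneg: "0 \<le> absv x"
    and absv_eq_0_iff: "absv x = 0 \<longleftrightarrow> x = 0"
    and absv_mult: "absv (x * y) = absv x * absv y"
    and absv_ultrametric: "absv (x + y) \<le> max (absv x) (absv y)"
    and absv_complete:
      "(\<forall>e>0. \<exists>N. \<forall>m\<ge>N. \<forall>n\<ge>N. absv (X m - X n) < e)
        \<Longrightarrow> \<exists>x. (\<lambda>n. absv (X n - x)) \<longlonglongrightarrow> 0"

text \<open>As for modules in HOL-Algebra, the fields \<open>mult\<close> and \<open>one\<close> of the record are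
  meaningful only when the space is regarded as an algebra.\<close>

record ('k, 'v) nspace = "('k, 'v) module" +
  nrm :: "'v \<Rightarrow> real"

definition kban :: "('k::complete_nonarch_field, 'k) nspace" where
  "kban = \<lparr>carrier = UNIV, monoid.mult = (*), one = 1, zero = 0, add = (+), smult = (*), nrm = absv\<rparr>"

definition banach_space :: "('k::complete_nonarch_field, 'v) nspace \<Rightarrow> bool" where
  "banach_space V \<longleftrightarrow>
    module (kban :: ('k, 'k) nspace) V \<and>
    (\<forall>x\<in>carrier V. 0 \<le> nrm V x \<and> (nrm V x = 0 \<longleftrightarrow> x = \<zero>\<^bsub>V\<^esub>)) \<and>
    (\<forall>c. \<forall>x\<in>carrier V. nrm V (c \<odot>\<^bsub>V\<^esub> x) = absv c * nrm V x) \<and>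
    (\<forall>x\<in>carrier V. \<forall>y\<in>carrier V. nrm V (x \<oplus>\<^bsub>V\<^esub> y) \<le> max (nrm V x) (nrm V y)) \<and>
    (\<forall>X. (\<forall>n::nat. X n \<in> carrier V) \<and>
         (\<forall>e>0. \<exists>N. \<forall>m\<ge>N. \<forall>n\<ge>N. nrm V (X m \<ominus>\<^bsub>V\<^esub> X n) < e)
       \<longrightarrow> (\<exists>x\<in>carrier V. (\<lambda>n. nrm V (X n \<ominus>\<^bsub>V\<^esub> x)) \<longlonglongrightarrow> 0))"

definition banach_algebra :: "('k::complete_nonarch_field, 'v) nspace \<Rightarrow> bool" where
  "banach_algebra A \<longleftrightarrow>
    banach_space A \<and> ring A \<and>
    (\<forall>c. \<forall>x\<in>carrier A. \<forall>y\<in>carrier A.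
       (c \<odot>\<^bsub>A\<^esub> x) \<otimes>\<^bsub>A\<^esub> y = c \<odot>\<^bsub>A\<^esub> (x \<otimes>\<^bsub>A\<^esub> y) \<and>
       x \<otimes>\<^bsub>A\<^esub> (c \<odot>\<^bsub>A\<^esub> y) = c \<odot>\<^bsub>A\<^esub> (x \<otimes>\<^bsub>A\<^esub> y)) \<and>
    (\<exists>C. \<forall>x\<in>carrier A. \<forall>y\<in>carrier A. nrm A (x \<otimes>\<^bsub>A\<^esub> y) \<le> C * nrm A x * nrm A y)"

definition bounded_lin ::
  "('k::complete_nonarch_field, 'v) nspace \<Rightarrow> ('k, 'w) nspace \<Rightarrow> ('v \<Rightarrow> 'w) \<Rightarrow> bool" where
  "bounded_lin V W f \<longleftrightarrow>
    f \<in> carrier V \<rightarrow> carrier W \<and>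
    (\<forall>x\<in>carrier V. \<forall>y\<in>carrier V. f (x \<oplus>\<^bsub>V\<^esub> y) = f x \<oplus>\<^bsub>W\<^esub> f y) \<and>
    (\<forall>c. \<forall>x\<in>carrier V. f (c \<odot>\<^bsub>V\<^esub> x) = c \<odot>\<^bsub>W\<^esub> f x) \<and>
    (\<exists>C. \<forall>x\<in>carrier V. nrm W (f x) \<le> C * nrm V x)"

definition closed_set :: "('k, 'v) nspace \<Rightarrow> 'v set \<Rightarrow> bool" where
  "closed_set V S \<longleftrightarrow> S \<subseteq> carrier V \<and>
    (\<forall>X x. (\<forall>n::nat. X n \<in> S) \<and> x \<in> carrier V \<and> (\<lambda>n. nrm V (X n \<ominus>\<^bsub>V\<^esub> x)) \<longlonglongrightarrow> 0
       \<longrightarrow> x \<in> S)"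

definition closed_span :: "('k::complete_nonarch_field, 'v) nspace \<Rightarrow> 'v set \<Rightarrow> 'v set" where
  "closed_span V G =
    \<Inter>{S. submodule S (kban :: ('k, 'k) nspace) V \<and> closed_set V S \<and> G \<subseteq> S}"

definition closed_ideal :: "('k, 'v) nspace \<Rightarrow> 'v set \<Rightarrow> 'v set" where
  "closed_ideal A G = \<Inter>{J. ideal J A \<and> closed_set A J \<and> G \<subseteq> J}"

text \<open>Quotient by a closed subspace (or closed two-sided ideal) with the quotient norm; the
  ring part is that of \<^const>\<open>FactRing\<close>.\<close>

definition quot :: "('k, 'v) nspace \<Rightarrow> 'v set \<Rightarrow> ('k, 'v set) nspace" where
  "quot V N = \<lparr>carrier = a_rcosets\<^bsub>V\<^esub> N, monoid.mult = rcoset_mult V N, one = N +>\<^bsub>V\<^esub> \<one>\<^bsub>V\<^esub>,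
     zero = N, add = set_add V, smult = (\<lambda>c X. \<Union>x\<in>X. N +>\<^bsub>V\<^esub> (c \<odot>\<^bsub>V\<^esub> x)),
     nrm = (\<lambda>X. Inf (nrm V ` X))\<rparr>"

text \<open>The contracting coproduct of the lines \<open>k\<close>, \<open>s \<in> S\<close>, the line at \<open>s\<close> having its norm
  scaled by \<open>wt s\<close>.\<close>

definition c0 :: "'s set \<Rightarrow> ('s \<Rightarrow> real) \<Rightarrow> ('k::complete_nonarch_field, 's \<Rightarrow> 'k) nspace" where
  "c0 S wt = \<lparr>carrier = {f. (\<forall>s. s \<notin> S \<longrightarrow> f s = 0) \<and>
                           (\<forall>e>0. finite {s\<in>S. e \<le> absv (f s) * wt s})},
     monoid.mult = undefined, one = undefined, zero = (\<lambda>_. 0), add = (\<lambda>f g s. f s + g s),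
     smult = (\<lambda>c f s. c * f s),
     nrm = (\<lambda>f. Sup (insert 0 ((\<lambda>s. absv (f s) * wt s) ` S)))\<rparr>"

definition single :: "'s \<Rightarrow> 's \<Rightarrow> 'k::zero_neq_one" where
  "single s = (\<lambda>t. if t = s then 1 else 0)"


section \<open>Completed projective tensor products\<close>

text \<open>The completed projective tensor product is presented as the quotient of the free Banach
  space on the symbols \<open>(v, w)\<close>, of norm \<open>\<parallel>v\<parallel> \<parallel>w\<parallel>\<close>, by the closed subspace of bilinear relations;
  its norm is the infimum of \<open>max\<^sub>i \<parallel>v\<^sub>i\<parallel> \<parallel>w\<^sub>i\<parallel>\<close> over the representations \<open>\<Sum> v\<^sub>i \<otimes> w\<^sub>i\<close>.
  Symbols with a zero entry would have norm \<open>0\<close>; they are left out and read as zero.\<close>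

definition tens_free ::
  "('k::complete_nonarch_field, 'v) nspace \<Rightarrow> ('k, 'w) nspace \<Rightarrow> ('k, 'v \<times> 'w \<Rightarrow> 'k) nspace" where
  "tens_free V W =
     c0 ((carrier V - {\<zero>\<^bsub>V\<^esub>}) \<times> (carrier W - {\<zero>\<^bsub>W\<^esub>})) (\<lambda>(v, w). nrm V v * nrm W w)"

definition tens_symb ::
  "('k::complete_nonarch_field, 'v) nspace \<Rightarrow> ('k, 'w) nspace \<Rightarrow> 'v \<Rightarrow> 'w \<Rightarrow> 'v \<times> 'w \<Rightarrow> 'k" where
  "tens_symb V W v w = (if v = \<zero>\<^bsub>V\<^esub> \<or> w = \<zero>\<^bsub>W\<^esub> then (\<lambda>_. 0) else single (v, w))"

definition tens_rel ::
  "('k::complete_nonarch_field, 'v) nspace \<Rightarrow> ('k, 'w) nspace \<Rightarrow> ('v \<times> 'w \<Rightarrow> 'k) set" where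
  "tens_rel V W =
     {(\<lambda>p. tens_symb V W (v \<oplus>\<^bsub>V\<^esub> v') w p - tens_symb V W v w p - tens_symb V W v' w p) | v v' w.
        v \<in> carrier V \<and> v' \<in> carrier V \<and> w \<in> carrier W} \<union>
     {(\<lambda>p. tens_symb V W v (w \<oplus>\<^bsub>W\<^esub> w') p - tens_symb V W v w p - tens_symb V W v w' p) | v w w'.
        v \<in> carrier V \<and> w \<in> carrier W \<and> w' \<in> carrier W} \<union>
     {(\<lambda>p. tens_symb V W (c \<odot>\<^bsub>V\<^esub> v) w p - c * tens_symb V W v w p) | c v w.
        v \<in> carrier V \<and> w \<in> carrier W} \<union>
     {(\<lambda>p. tens_symb V W v (c \<odot>\<^bsub>W\<^esub> w) p - c * tens_symb V W v w p) | c v w.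
        v \<in> carrier V \<and> w \<in> carrier W}"

definition tensor ::
  "('k::complete_nonarch_field, 'v) nspace \<Rightarrow> ('k, 'w) nspace \<Rightarrow> ('k, ('v \<times> 'w \<Rightarrow> 'k) set) nspace" where
  "tensor V W = quot (tens_free V W) (closed_span (tens_free V W) (tens_rel V W))"

definition tens ::
  "('k::complete_nonarch_field, 'v) nspace \<Rightarrow> ('k, 'w) nspace \<Rightarrow> 'v \<Rightarrow> 'w \<Rightarrow> ('v \<times> 'w \<Rightarrow> 'k) set" where
  "tens V W v w =
     closed_span (tens_free V W) (tens_rel V W) +>\<^bsub>tens_free V W\<^esub> tens_symb V W v w"

text \<open>The bounded linear map on the tensor product that corresponds to a bounded bilinear map \<open>b\<close>
  into a Banach space.\<close>

definition tens_lift ::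
  "('k::complete_nonarch_field, 'v) nspace \<Rightarrow> ('k, 'w) nspace \<Rightarrow> ('k, 'z) nspace \<Rightarrow>
   ('v \<Rightarrow> 'w \<Rightarrow> 'z) \<Rightarrow> (('v \<times> 'w \<Rightarrow> 'k) set \<Rightarrow> 'z)" where
  "tens_lift V W Z b = (SOME h. bounded_lin (tensor V W) Z h \<and>
     (\<forall>v\<in>carrier V. \<forall>w\<in>carrier W. h (tens V W v w) = b v w))"

definition tens_map ::
  "('k::complete_nonarch_field, 'v) nspace \<Rightarrow> ('k, 'w) nspace \<Rightarrow> ('k, 'v2) nspace \<Rightarrow>
   ('k, 'w2) nspace \<Rightarrow> ('v \<Rightarrow> 'v2) \<Rightarrow> ('w \<Rightarrow> 'w2) \<Rightarrow>
   (('v \<times> 'w \<Rightarrow> 'k) set \<Rightarrow> ('v2 \<times> 'w2 \<Rightarrow> 'k) set)" where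
  "tens_map V W V' W' f g = tens_lift V W (tensor V' W') (\<lambda>v w. tens V' W' (f v) (g w))"


section \<open>The Ind-completion of the category of Banach spaces\<close>

text \<open>Objects are formal filtered colimits, indexed by directed preordered sets.\<close>

record ('k, 'i, 'v) ind =
  idx :: "'i set"
  ile :: "'i \<Rightarrow> 'i \<Rightarrow> bool"
  isp :: "'i \<Rightarrow> ('k, 'v) nspace"
  itr :: "'i \<Rightarrow> 'i \<Rightarrow> 'v \<Rightarrow> 'v"

definition ind_banach :: "('k::complete_nonarch_field, 'i, 'v) ind \<Rightarrow> bool" where
  "ind_banach X \<longleftrightarrow>
    idx X \<noteq> {} \<and>
    (\<forall>i\<in>idx X. ile X i i) \<and>
    (\<forall>i\<in>idx X. \<forall>j\<in>idx X. \<forall>l\<in>idx X. ile X i j \<and> ile X j l \<longrightarrow> ile X i l) \<and>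
    (\<forall>i\<in>idx X. \<forall>j\<in>idx X. \<exists>l\<in>idx X. ile X i l \<and> ile X j l) \<and>
    (\<forall>i\<in>idx X. banach_space (isp X i)) \<and>
    (\<forall>i\<in>idx X. \<forall>j\<in>idx X. ile X i j \<longrightarrow> bounded_lin (isp X i) (isp X j) (itr X i j)) \<and>
    (\<forall>i\<in>idx X. \<forall>x\<in>carrier (isp X i). itr X i i x = x) \<and>
    (\<forall>i\<in>idx X. \<forall>j\<in>idx X. \<forall>l\<in>idx X. ile X i j \<and> ile X j l \<longrightarrow>
       (\<forall>x\<in>carrier (isp X i). itr X j l (itr X i j x) = itr X i l x))"

text \<open>A morphism is an element of \<open>lim\<^sub>i colim\<^sub>j Hom (X\<^sub>i, Y\<^sub>j)\<close>. It is given by representatives: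
  to \<open>i\<close> corresponds a pair of an index \<open>j\<close> and a bounded map from \<open>X\<^sub>i\<close> to \<open>Y\<^sub>j\<close>. Two pairs
  are the same element of the colimit iff \<^emph>\<open>germ_eq\<close> holds, and equality of morphisms is
  \<^emph>\<open>ind_eq\<close>, not equality of the families of representatives.\<close>

type_synonym ('i, 'v, 'j, 'w) ind_mor = "'i \<Rightarrow> 'j \<times> ('v \<Rightarrow> 'w)"

definition germ_eq ::
  "('k, 'j, 'w) ind \<Rightarrow> 'v set \<Rightarrow> 'j \<times> ('v \<Rightarrow> 'w) \<Rightarrow> 'j \<times> ('v \<Rightarrow> 'w) \<Rightarrow> bool" where
  "germ_eq Y A p q \<longleftrightarrow> (\<exists>l\<in>idx Y. ile Y (fst p) l \<and> ile Y (fst q) l \<and>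
     (\<forall>x\<in>A. itr Y (fst p) l (snd p x) = itr Y (fst q) l (snd q x)))"

definition ind_hom ::
  "('k::complete_nonarch_field, 'i, 'v) ind \<Rightarrow> ('k, 'j, 'w) ind \<Rightarrow> ('i, 'v, 'j, 'w) ind_mor set" where
  "ind_hom X Y = {f. ind_banach X \<and> ind_banach Y \<and>
     (\<forall>i\<in>idx X. fst (f i) \<in> idx Y \<and> bounded_lin (isp X i) (isp Y (fst (f i))) (snd (f i))) \<and>
     (\<forall>i\<in>idx X. \<forall>i'\<in>idx X. ile X i i' \<longrightarrow>
        germ_eq Y (carrier (isp X i)) (f i) (fst (f i'), snd (f i') \<circ> itr X i i'))}"

definition ind_eq ::
  "('k, 'i, 'v) ind \<Rightarrow> ('k, 'j, 'w) ind \<Rightarrow> ('i, 'v, 'j, 'w) ind_mor \<Rightarrow> ('i, 'v, 'j, 'w) ind_mor \<Rightarrow> bool" where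
  "ind_eq X Y f g \<longleftrightarrow> (\<forall>i\<in>idx X. germ_eq Y (carrier (isp X i)) (f i) (g i))"

definition ind_id :: "('i, 'v, 'i, 'v) ind_mor" where
  "ind_id i = (i, \<lambda>x. x)"

definition ind_comp ::
  "('j, 'w, 'l, 'z) ind_mor \<Rightarrow> ('i, 'v, 'j, 'w) ind_mor \<Rightarrow> ('i, 'v, 'l, 'z) ind_mor" where
  "ind_comp g f i = (fst (g (fst (f i))), snd (g (fst (f i))) \<circ> snd (f i))"

definition ind_const :: "('k, 'v) nspace \<Rightarrow> ('k, unit, 'v) ind" where
  "ind_const V = \<lparr>idx = {()}, ile = (\<lambda>_ _. True), isp = (\<lambda>_. V), itr = (\<lambda>_ _ x. x)\<rparr>"

definition ind_tensor ::
  "('k::complete_nonarch_field, 'i, 'v) ind \<Rightarrow> ('k, 'j, 'w) ind \<Rightarrow>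
   ('k, 'i \<times> 'j, ('v \<times> 'w \<Rightarrow> 'k) set) ind" where
  "ind_tensor X Y = \<lparr>idx = idx X \<times> idx Y,
     ile = (\<lambda>(i, j) (i', j'). ile X i i' \<and> ile Y j j'),
     isp = (\<lambda>(i, j). tensor (isp X i) (isp Y j)),
     itr = (\<lambda>(i, j) (i', j').
        tens_map (isp X i) (isp Y j) (isp X i') (isp Y j') (itr X i i') (itr Y j j'))\<rparr>"

definition ind_tensor_map ::
  "('k::complete_nonarch_field, 'i, 'v) ind \<Rightarrow> ('k, 'j, 'w) ind \<Rightarrow>
   ('k, 'i2, 'v2) ind \<Rightarrow> ('k, 'j2, 'w2) ind \<Rightarrow>
   ('i, 'v, 'i2, 'v2) ind_mor \<Rightarrow> ('j, 'w, 'j2, 'w2) ind_mor \<Rightarrow>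
   ('i \<times> 'j, ('v \<times> 'w \<Rightarrow> 'k) set, 'i2 \<times> 'j2, ('v2 \<times> 'w2 \<Rightarrow> 'k) set) ind_mor" where
  "ind_tensor_map X Y X' Y' f g = (\<lambda>(i, j). ((fst (f i), fst (g j)),
     tens_map (isp X i) (isp Y j) (isp X' (fst (f i))) (isp Y' (fst (g j))) (snd (f i)) (snd (g j))))"


section \<open>Power series objects\<close>

text \<open>The product in IndBan of a sequence of Banach spaces \<open>V\<^sub>n\<close> is the formal colimit, over all
  sequences of radii \<open>\<phi>\<close>, of the Banach spaces of sequences with
  \<open>sup\<^sub>n \<phi>\<^sub>n \<parallel>x\<^sub>n\<parallel> < \<infinity>\<close>, these spaces growing as \<open>\<phi>\<close> decreases: a sequence of bounded maps
  \<open>f\<^sub>n\<close> from a Banach space to \<open>V\<^sub>n\<close> is a bounded map to the space for any \<open>\<phi>\<close> with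
  \<open>sup\<^sub>n \<phi>\<^sub>n \<parallel>f\<^sub>n\<parallel> < \<infinity>\<close>.\<close>

definition weighted_prod ::
  "(nat \<Rightarrow> ('k, 'v) nspace) \<Rightarrow> (nat \<Rightarrow> real) \<Rightarrow> ('k, nat \<Rightarrow> 'v) nspace" where
  "weighted_prod V \<phi> = \<lparr>carrier = {x. (\<forall>n. x n \<in> carrier (V n)) \<and>
                                    bdd_above (range (\<lambda>n. \<phi> n * nrm (V n) (x n)))},
     monoid.mult = undefined, one = undefined, zero = (\<lambda>n. \<zero>\<^bsub>V n\<^esub>), add = (\<lambda>x y n. x n \<oplus>\<^bsub>V n\<^esub> y n),
     smult = (\<lambda>c x n. c \<odot>\<^bsub>V n\<^esub> x n), nrm = (\<lambda>x. SUP n. \<phi> n * nrm (V n) (x n))\<rparr>"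

definition ind_prod :: "(nat \<Rightarrow> ('k, 'v) nspace) \<Rightarrow> ('k, nat \<Rightarrow> real, nat \<Rightarrow> 'v) ind" where
  "ind_prod V = \<lparr>idx = {\<phi>. \<forall>n. 0 < \<phi> n}, ile = (\<lambda>\<phi> \<psi>. \<forall>n. \<psi> n \<le> \<phi> n),
     isp = weighted_prod V, itr = (\<lambda>_ _ x. x)\<rparr>"

definition pser :: "('k, 'v) nspace \<Rightarrow> ('k, nat \<Rightarrow> real, nat \<Rightarrow> 'v) ind" where
  "pser V = ind_prod (\<lambda>_. V)"

definition cauchy_radii :: "(nat \<Rightarrow> real) \<Rightarrow> (nat \<Rightarrow> real) \<Rightarrow> nat \<Rightarrow> real" where
  "cauchy_radii \<phi> \<psi> n = Min ((\<lambda>i. \<phi> i * \<psi> (n - i)) ` {..n})"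

text \<open>The \<open>\<hbar>\<close>-bilinear extension (Cauchy product) of a bounded bilinear map \<open>b\<close>.\<close>

definition pser_bilin ::
  "('k::complete_nonarch_field, 'v) nspace \<Rightarrow> ('k, 'w) nspace \<Rightarrow> ('k, 'z) nspace \<Rightarrow>
   ('v \<Rightarrow> 'w \<Rightarrow> 'z) \<Rightarrow>
   ((nat \<Rightarrow> real) \<times> (nat \<Rightarrow> real), ((nat \<Rightarrow> 'v) \<times> (nat \<Rightarrow> 'w) \<Rightarrow> 'k) set,
    nat \<Rightarrow> real, nat \<Rightarrow> 'z) ind_mor" where
  "pser_bilin V W Z b = (\<lambda>(\<phi>, \<psi>). (cauchy_radii \<phi> \<psi>,
     tens_lift (isp (pser V) \<phi>) (isp (pser W) \<psi>) (isp (pser Z) (cauchy_radii \<phi> \<psi>))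
       (\<lambda>x y n. \<Oplus>\<^bsub>Z\<^esub>i\<in>{..n}. b (x i) (y (n - i)))))"

definition pser_const :: "('k, 'v) nspace \<Rightarrow> (unit, 'v, nat \<Rightarrow> real, nat \<Rightarrow> 'v) ind_mor" where
  "pser_const V = (\<lambda>_. (\<lambda>_. 1, \<lambda>x n. if n = 0 then x else \<zero>\<^bsub>V\<^esub>))"

definition mod_hbar :: "(nat \<Rightarrow> real, nat \<Rightarrow> 'v, unit, 'v) ind_mor" where
  "mod_hbar = (\<lambda>_. ((), \<lambda>x. x 0))"


section \<open>Algebras over the power series ring and convolution\<close>

record ('k, 'i, 'v) kh_alg =
  ob :: "('k, 'i, 'v) ind"
  mlt :: "('i \<times> 'i, ('v \<times> 'v \<Rightarrow> 'k) set, 'i, 'v) ind_mor"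
  unt :: "(unit, 'k, 'i, 'v) ind_mor"
  act :: "((nat \<Rightarrow> real) \<times> 'i, ((nat \<Rightarrow> 'k) \<times> 'v \<Rightarrow> 'k) set, 'i, 'v) ind_mor"

definition pser_alg ::
  "('k::complete_nonarch_field, 'v) nspace \<Rightarrow> ('k, nat \<Rightarrow> real, nat \<Rightarrow> 'v) kh_alg" where
  "pser_alg A = \<lparr>ob = pser A,
     mlt = pser_bilin A A A (monoid.mult A),
     unt = ind_comp (pser_const A) (\<lambda>_. ((), \<lambda>c. c \<odot>\<^bsub>A\<^esub> \<one>\<^bsub>A\<^esub>)),
     act = pser_bilin kban A A (smult A)\<rparr>"

definition kh_alg_hom ::
  "('k::complete_nonarch_field, 'i, 'v) kh_alg \<Rightarrow> ('k, 'j, 'w) kh_alg \<Rightarrow> ('i, 'v, 'j, 'w) ind_mor set" where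
  "kh_alg_hom A B = {f \<in> ind_hom (ob A) (ob B).
     ind_eq (ind_tensor (ob A) (ob A)) (ob B)
       (ind_comp f (mlt A))
       (ind_comp (mlt B) (ind_tensor_map (ob A) (ob A) (ob B) (ob B) f f)) \<and>
     ind_eq (ind_const kban) (ob B) (ind_comp f (unt A)) (unt B) \<and>
     ind_eq (ind_tensor (pser kban) (ob A)) (ob B)
       (ind_comp f (act A))
       (ind_comp (act B) (ind_tensor_map (pser kban) (ob A) (pser kban) (ob B) ind_id f))}"

text \<open>The map \<open>\<alpha>\<^sub>0\<close> induced on the quotients by \<open>\<hbar>\<close>; the constants are used as
  representatives modulo \<open>\<hbar>\<close>.\<close>

definition reduction ::
  "('k, 'v) nspace \<Rightarrow> (nat \<Rightarrow> real, nat \<Rightarrow> 'v, nat \<Rightarrow> real, nat \<Rightarrow> 'w) ind_mor \<Rightarrow> 'v \<Rightarrow> 'w" where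
  "reduction V \<alpha> = snd (ind_comp mod_hbar (ind_comp \<alpha> (pser_const V)) ())"

definition cong_mod_hbar ::
  "('k, 'v) nspace \<Rightarrow> ('k, 'w) nspace \<Rightarrow>
   (nat \<Rightarrow> real, nat \<Rightarrow> 'v, nat \<Rightarrow> real, nat \<Rightarrow> 'w) ind_mor \<Rightarrow>
   (nat \<Rightarrow> real, nat \<Rightarrow> 'v, nat \<Rightarrow> real, nat \<Rightarrow> 'w) ind_mor \<Rightarrow> bool" where
  "cong_mod_hbar V W \<alpha> \<alpha>' \<longleftrightarrow>
     ind_eq (pser V) (ind_const W) (ind_comp mod_hbar \<alpha>) (ind_comp mod_hbar \<alpha>')"

text \<open>\<open>k \<cong> k \<otimes> k \<rightarrow> A \<otimes> A \<rightarrow> A\<close>\<close>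

definition conv ::
  "('k::complete_nonarch_field, 'i, 'v) kh_alg \<Rightarrow> (unit, 'k, 'i, 'v) ind_mor \<Rightarrow>
   (unit, 'k, 'i, 'v) ind_mor \<Rightarrow> (unit, 'k, 'i, 'v) ind_mor" where
  "conv A F G =
     ind_comp (mlt A)
       (ind_comp (ind_tensor_map (ind_const kban) (ind_const kban) (ob A) (ob A) F G)
         (\<lambda>_. (((), ()), \<lambda>c. tens kban kban c 1)))"

definition conv_inverse ::
  "('k::complete_nonarch_field, 'i, 'v) kh_alg \<Rightarrow> (unit, 'k, 'i, 'v) ind_mor \<Rightarrow>
   (unit, 'k, 'i, 'v) ind_mor \<Rightarrow> bool" where
  "conv_inverse A F G \<longleftrightarrow>
     F \<in> ind_hom (ind_const kban) (ob A) \<and> G \<in> ind_hom (ind_const kban) (ob A) \<and>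
     ind_eq (ind_const kban) (ob A) (conv A F G) (unt A) \<and>
     ind_eq (ind_const kban) (ob A) (conv A G F) (unt A)"

text \<open>\<open>X \<cong> k \<otimes> X \<otimes> k \<rightarrow> A \<otimes> A \<otimes> A \<rightarrow> A\<close>, triple tensor products bracketed to the left\<close>

definition conv3 ::
  "('k::complete_nonarch_field, 'i, 'v) kh_alg \<Rightarrow> ('k, 'j, 'w) ind \<Rightarrow>
   (unit, 'k, 'i, 'v) ind_mor \<Rightarrow> ('j, 'w, 'i, 'v) ind_mor \<Rightarrow> (unit, 'k, 'i, 'v) ind_mor \<Rightarrow>
   ('j, 'w, 'i, 'v) ind_mor" where
  "conv3 A X F \<alpha> G =
     ind_comp (mlt A)
      (ind_comp (ind_tensor_map (ind_tensor (ob A) (ob A)) (ob A) (ob A) (ob A) (mlt A) ind_id)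
       (ind_comp
         (ind_tensor_map (ind_tensor (ind_const kban) X) (ind_const kban)
            (ind_tensor (ob A) (ob A)) (ob A)
            (ind_tensor_map (ind_const kban) X (ob A) (ob A) F \<alpha>) G)
         (\<lambda>j. ((((), j), ()),
            \<lambda>x. tens (tensor kban (isp X j)) kban (tens kban (isp X j) 1 x) 1))))"


section \<open>Bounded Lie algebra cohomology\<close>

text \<open>A Lie algebra is a space \<open>L\<close> with a bracket \<open>br\<close>; \<open>n\<close>-cochains are functions on lists of
  length \<open>n\<close> of elements of \<open>L\<close>, undefined elsewhere.\<close>

definition args :: "('k, 'x) nspace \<Rightarrow> nat \<Rightarrow> 'x list set" where
  "args L n = {xs. length xs = n \<and> set xs \<subseteq> carrier L}"

definition cochains :: "('k::complete_nonarch_field, 'x) nspace \<Rightarrow> ('k, 'm) nspace \<Rightarrow> nat \<Rightarrow> ('x list \<Rightarrow> 'm) set" where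
  "cochains L M n = {f \<in> extensional (args L n).
     f \<in> args L n \<rightarrow> carrier M \<and>
     (\<forall>xs\<in>args L n. \<forall>i<n. \<forall>x\<in>carrier L. \<forall>y\<in>carrier L.
        f (xs[i := x \<oplus>\<^bsub>L\<^esub> y]) = f (xs[i := x]) \<oplus>\<^bsub>M\<^esub> f (xs[i := y])) \<and>
     (\<forall>xs\<in>args L n. \<forall>i<n. \<forall>x\<in>carrier L. \<forall>c.
        f (xs[i := c \<odot>\<^bsub>L\<^esub> x]) = c \<odot>\<^bsub>M\<^esub> f (xs[i := x])) \<and>
     (\<forall>xs\<in>args L n. \<forall>i j. i < j \<and> j < n \<and> xs ! i = xs ! j \<longrightarrow> f xs = \<zero>\<^bsub>M\<^esub>) \<and>
     (\<exists>C. \<forall>xs\<in>args L n. nrm M (f xs) \<le> C * (\<Prod>i<n. nrm L (xs ! i)))}"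

definition drop_at :: "nat \<Rightarrow> 'x list \<Rightarrow> 'x list" where
  "drop_at i xs = take i xs @ drop (Suc i) xs"

text \<open>List positions start at \<open>0\<close>, so the signs \<open>(-1)\<^sup>i\<^sup>+\<^sup>j\<close> are unchanged and \<open>(-1)\<^sup>i\<^sup>+\<^sup>1\<close> becomes
  \<open>(-1)\<^sup>i\<close>.\<close>

definition coboundary ::
  "('k::complete_nonarch_field, 'x) nspace \<Rightarrow> ('x \<Rightarrow> 'x \<Rightarrow> 'x) \<Rightarrow> ('k, 'm) nspace \<Rightarrow>
   ('x \<Rightarrow> 'm \<Rightarrow> 'm) \<Rightarrow> nat \<Rightarrow> ('x list \<Rightarrow> 'm) \<Rightarrow> ('x list \<Rightarrow> 'm)" where
  "coboundary L br M ac n f = (\<lambda>xs\<in>args L (Suc n).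
     (\<Oplus>\<^bsub>M\<^esub>p\<in>{(i, j). i < j \<and> j \<le> n}.
        (- 1) ^ (fst p + snd p) \<odot>\<^bsub>M\<^esub>
          f (br (xs ! fst p) (xs ! snd p) # drop_at (fst p) (drop_at (snd p) xs))) \<oplus>\<^bsub>M\<^esub>
     (\<Oplus>\<^bsub>M\<^esub>i\<in>{..n}. (- 1) ^ i \<odot>\<^bsub>M\<^esub> ac (xs ! i) (f (drop_at i xs))))"

definition cocycles ::
  "('k::complete_nonarch_field, 'x) nspace \<Rightarrow> ('x \<Rightarrow> 'x \<Rightarrow> 'x) \<Rightarrow> ('k, 'm) nspace \<Rightarrow>
   ('x \<Rightarrow> 'm \<Rightarrow> 'm) \<Rightarrow> nat \<Rightarrow> ('x list \<Rightarrow> 'm) set" where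
  "cocycles L br M ac n =
     {f \<in> cochains L M n. coboundary L br M ac n f = (\<lambda>xs\<in>args L (Suc n). \<zero>\<^bsub>M\<^esub>)}"

fun coboundaries ::
  "('k::complete_nonarch_field, 'x) nspace \<Rightarrow> ('x \<Rightarrow> 'x \<Rightarrow> 'x) \<Rightarrow> ('k, 'm) nspace \<Rightarrow>
   ('x \<Rightarrow> 'm \<Rightarrow> 'm) \<Rightarrow> nat \<Rightarrow> ('x list \<Rightarrow> 'm) set" where
  "coboundaries L br M ac 0 = {\<lambda>xs\<in>args L 0. \<zero>\<^bsub>M\<^esub>}"
| "coboundaries L br M ac (Suc n) = coboundary L br M ac n ` cochains L M n"

definition Hb ::
  "('k::complete_nonarch_field, 'x) nspace \<Rightarrow> ('x \<Rightarrow> 'x \<Rightarrow> 'x) \<Rightarrow> ('k, 'm) nspace \<Rightarrow>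
   ('x \<Rightarrow> 'm \<Rightarrow> 'm) \<Rightarrow> nat \<Rightarrow> ('x list \<Rightarrow> 'm) set set" where
  "Hb L br M ac n =
     (\<lambda>f. (\<lambda>b. \<lambda>xs\<in>args L n. f xs \<oplus>\<^bsub>M\<^esub> b xs) ` coboundaries L br M ac n) ` cocycles L br M ac n"

text \<open>A quotient vector space is zero iff the zero coset is its only element.\<close>

definition Hb_zero ::
  "('k::complete_nonarch_field, 'x) nspace \<Rightarrow> ('x \<Rightarrow> 'x \<Rightarrow> 'x) \<Rightarrow> ('k, 'm) nspace \<Rightarrow>
   ('x \<Rightarrow> 'm \<Rightarrow> 'm) \<Rightarrow> nat \<Rightarrow> bool" where
  "Hb_zero L br M ac n \<longleftrightarrow> Hb L br M ac n = {coboundaries L br M ac n}"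


section \<open>Root data and the analytic enveloping algebras\<close>

definition zscale :: "int \<Rightarrow> 'p::ab_group_add \<Rightarrow> 'p" where
  "zscale n x = (if 0 \<le> n then ((+) x ^^ nat n) 0 else - (((+) x ^^ nat (- n)) 0))"

text \<open>The lattice \<open>\<Phi>\<close> is the type \<^typ>\<open>'p\<close>.\<close>

locale root_datum =
  fixes I :: "'i set"
    and \<Psi> :: "'p::ab_group_add set"
    and root :: "'i \<Rightarrow> 'p"
    and form :: "'p \<Rightarrow> 'p \<Rightarrow> rat"
    and lam :: "'i \<Rightarrow> 'p \<Rightarrow> int"
  assumes free: "\<exists>B :: 'p set. \<not> Modules.module.dependent zscale B \<and> Modules.module.span zscale B = UNIV"
    and root_inj: "inj_on root I"
    and root_independent: "\<not> Modules.module.dependent zscale (root ` I)"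
    and root_span: "Modules.module.span zscale (root ` I) = \<Psi>"
    and form_sym: "form x y = form y x"
    and form_add: "form (x + y) z = form x z + form y z"
    and form_root: "i \<in> I \<Longrightarrow> \<exists>m::nat. m \<noteq> 0 \<and> form (root i) (root i) = of_nat (2 * m)"
    and form_nonpos: "i \<in> I \<Longrightarrow> j \<in> I \<Longrightarrow> i \<noteq> j \<Longrightarrow> form (root i) (root j) \<le> 0"
    and lam_add: "i \<in> I \<Longrightarrow> lam i (x + y) = lam i x + lam i y"
    and lam_eq: "i \<in> I \<Longrightarrow> of_int (lam i x) = 2 * form (root i) x / form (root i) (root i)"

text \<open>Since \<open>V\<^sub>0\<close> has the orthonormal basis \<open>v\<^sub>i\<close>, its \<open>n\<close>-th tensor power has the orthonormal
  basis of words of length \<open>n\<close>, and the Tate tensor algebra is the contracting coproduct of lines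
  indexed by words; its product is concatenation.\<close>

definition tate_tensor :: "'i set \<Rightarrow> real \<Rightarrow> ('k::complete_nonarch_field, 'i list \<Rightarrow> 'k) nspace" where
  "tate_tensor I r = (c0 (lists I) (\<lambda>w. r ^ length w))
     \<lparr>monoid.mult := (\<lambda>f g w. \<Sum>n\<le>length w. f (take n w) * g (drop n w)), one := single []\<rparr>"

definition serre :: "('i \<Rightarrow> 'i \<Rightarrow> int) \<Rightarrow> 'i \<Rightarrow> 'i \<Rightarrow> 'i list \<Rightarrow> 'k::field" where
  "serre a i j = (\<lambda>w. let N = nat (1 - a i j) in
     \<Sum>m\<le>N. (- 1) ^ m * of_nat (N choose m) * single (replicate (N - m) i @ [j] @ replicate m i) w)"

definition serre_ideal ::
  "'i set \<Rightarrow> ('i \<Rightarrow> 'i \<Rightarrow> int) \<Rightarrow> real \<Rightarrow> ('i list \<Rightarrow> 'k::complete_nonarch_field) set" where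
  "serre_ideal I a r = closed_ideal (tate_tensor I r) {serre a i j | i j. i \<in> I \<and> j \<in> I \<and> i \<noteq> j}"

definition U_half ::
  "'i set \<Rightarrow> ('i \<Rightarrow> 'i \<Rightarrow> int) \<Rightarrow> real \<Rightarrow> ('k::complete_nonarch_field, ('i list \<Rightarrow> 'k) set) nspace" where
  "U_half I a r = quot (tate_tensor I r) (serre_ideal I a r)"

definition U_gen ::
  "'i set \<Rightarrow> ('i \<Rightarrow> 'i \<Rightarrow> int) \<Rightarrow> real \<Rightarrow> 'i \<Rightarrow> ('i list \<Rightarrow> 'k::complete_nonarch_field) set" where
  "U_gen I a r i = serre_ideal I a r +>\<^bsub>tate_tensor I r\<^esub> single [i]"

text \<open>Finitely supported elements of \<open>\<nat>\<^sup>I\<close> are multisets over \<open>I\<close>.\<close>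

definition H0 :: "'i set \<Rightarrow> ('k::complete_nonarch_field, 'i multiset \<Rightarrow> 'k) nspace" where
  "H0 I = (c0 {m. set_mset m \<subseteq> I} (\<lambda>_. 1))
     \<lparr>monoid.mult := (\<lambda>f g m. \<Sum>p\<in>{p. p \<subseteq># m}. f p * g (m - p)), one := single {#}\<rparr>"

type_synonym ('k, 'i) uan =
  "((('i list \<Rightarrow> 'k) set \<times> ('i multiset \<Rightarrow> 'k) \<Rightarrow> 'k) set \<times> ('i list \<Rightarrow> 'k) set \<Rightarrow> 'k) set"

definition U_space ::
  "'i set \<Rightarrow> ('i \<Rightarrow> 'i \<Rightarrow> int) \<Rightarrow> real \<Rightarrow> real \<Rightarrow> ('k::complete_nonarch_field, ('k, 'i) uan) nspace" where
  "U_space I a r s = tensor (tensor (U_half I a r) (H0 I)) (U_half I a s)"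

definition U_tens ::
  "'i set \<Rightarrow> ('i \<Rightarrow> 'i \<Rightarrow> int) \<Rightarrow> real \<Rightarrow> real \<Rightarrow>
   ('i list \<Rightarrow> 'k) set \<Rightarrow> ('i multiset \<Rightarrow> 'k) \<Rightarrow> ('i list \<Rightarrow> 'k::complete_nonarch_field) set \<Rightarrow> ('k, 'i) uan" where
  "U_tens I a r s y h x =
     tens (tensor (U_half I a r) (H0 I)) (U_half I a s) (tens (U_half I a r) (H0 I) y h) x"

definition genF :: "'i set \<Rightarrow> ('i \<Rightarrow> 'i \<Rightarrow> int) \<Rightarrow> real \<Rightarrow> real \<Rightarrow> 'i \<Rightarrow> ('k::complete_nonarch_field, 'i) uan" where
  "genF I a r s i = U_tens I a r s (U_gen I a r i) \<one>\<^bsub>H0 I\<^esub> \<one>\<^bsub>U_half I a s\<^esub>"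

definition genH :: "'i set \<Rightarrow> ('i \<Rightarrow> 'i \<Rightarrow> int) \<Rightarrow> real \<Rightarrow> real \<Rightarrow> 'i \<Rightarrow> ('k::complete_nonarch_field, 'i) uan" where
  "genH I a r s i = U_tens I a r s \<one>\<^bsub>U_half I a r\<^esub> (single {#i#}) \<one>\<^bsub>U_half I a s\<^esub>"

definition genE :: "'i set \<Rightarrow> ('i \<Rightarrow> 'i \<Rightarrow> int) \<Rightarrow> real \<Rightarrow> real \<Rightarrow> 'i \<Rightarrow> ('k::complete_nonarch_field, 'i) uan" where
  "genE I a r s i = U_tens I a r s \<one>\<^bsub>U_half I a r\<^esub> \<one>\<^bsub>H0 I\<^esub> (U_gen I a s i)"

definition commutator :: "('k, 'v) nspace \<Rightarrow> 'v \<Rightarrow> 'v \<Rightarrow> 'v" where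
  "commutator A x y = x \<otimes>\<^bsub>A\<^esub> y \<ominus>\<^bsub>A\<^esub> y \<otimes>\<^bsub>A\<^esub> x"

text \<open>\<open>is_U I a r s U\<close>: \<open>U\<close> is the Banach space \<^const>\<open>U_space\<close> equipped with the Banach algebra
  structure described by the commutation relations, which determine it; \<open>a i j\<close> stands for
  \<open>\<lambda>\<^sub>i(\<alpha>\<^sub>j)\<close>.\<close>

definition is_U ::
  "'i set \<Rightarrow> ('i \<Rightarrow> 'i \<Rightarrow> int) \<Rightarrow> real \<Rightarrow> real \<Rightarrow> ('k::complete_nonarch_field, ('k, 'i) uan) nspace \<Rightarrow> bool" where
  "is_U I a r s U \<longleftrightarrow>
    (\<exists>m e. U = (U_space I a r s)\<lparr>monoid.mult := m, one := e\<rparr>) \<and>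
    banach_algebra U \<and>
    (\<lambda>y. U_tens I a r s y \<one>\<^bsub>H0 I\<^esub> \<one>\<^bsub>U_half I a s\<^esub>) \<in> ring_hom (U_half I a r) U \<and>
    (\<lambda>h. U_tens I a r s \<one>\<^bsub>U_half I a r\<^esub> h \<one>\<^bsub>U_half I a s\<^esub>) \<in> ring_hom (H0 I) U \<and>
    (\<lambda>x. U_tens I a r s \<one>\<^bsub>U_half I a r\<^esub> \<one>\<^bsub>H0 I\<^esub> x) \<in> ring_hom (U_half I a s) U \<and>
    (\<forall>y\<in>carrier (U_half I a r). \<forall>h\<in>carrier (H0 I). \<forall>x\<in>carrier (U_half I a s).
       U_tens I a r s y h x =
         U_tens I a r s y \<one>\<^bsub>H0 I\<^esub> \<one>\<^bsub>U_half I a s\<^esub> \<otimes>\<^bsub>U\<^esub>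
         U_tens I a r s \<one>\<^bsub>U_half I a r\<^esub> h \<one>\<^bsub>U_half I a s\<^esub> \<otimes>\<^bsub>U\<^esub>
         U_tens I a r s \<one>\<^bsub>U_half I a r\<^esub> \<one>\<^bsub>H0 I\<^esub> x) \<and>
    (\<forall>i\<in>I. \<forall>j\<in>I.
       commutator U (genH I a r s i) (genE I a r s j) = of_int (a i j) \<odot>\<^bsub>U\<^esub> genE I a r s j \<and>
       commutator U (genH I a r s i) (genF I a r s j) = of_int (- a i j) \<odot>\<^bsub>U\<^esub> genF I a r s j \<and>
       commutator U (genE I a r s i) (genF I a r s j) = (if i = j then genH I a r s i else \<zero>\<^bsub>U\<^esub>))"

definition closed_lie_subalgebra ::
  "('k::complete_nonarch_field, 'v) nspace \<Rightarrow> 'v set \<Rightarrow> ('k, 'v) nspace" where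
  "closed_lie_subalgebra A G = A\<lparr>carrier :=
     \<Inter>{S. submodule S (kban :: ('k, 'k) nspace) A \<and> closed_set A S \<and>
         (\<forall>x\<in>S. \<forall>y\<in>S. commutator A x y \<in> S) \<and> G \<subseteq> S}\<rparr>"

definition g_an ::
  "'i set \<Rightarrow> ('i \<Rightarrow> 'i \<Rightarrow> int) \<Rightarrow> real \<Rightarrow> real \<Rightarrow> ('k::complete_nonarch_field, ('k, 'i) uan) nspace \<Rightarrow>
   ('k, ('k, 'i) uan) nspace" where
  "g_an I a r s U = closed_lie_subalgebra U
     (genF I a r s ` I \<union> genH I a r s ` I \<union> genE I a r s ` I)"

end

theory Submission
  imports Defs "HOL-Algebra.UnivPoly"
begin

text \<open>A family of compatible bounded maps between power series objects is one map on arbitrary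
  sequences, and \<open>k\<lbrakk>\<hbar>\<rbrakk>\<close>-linearity determines it by its values on constants; as every sequence is
  bounded for suitable radii, no estimate is needed in order to construct \<open>F\<close>. Its coefficients are
  found one degree at a time: the first nonzero coefficient of \<open>\<alpha>'(x) F - F \<alpha>(x)\<close> is a bounded
  derivation along \<open>\<alpha>\<^sub>0\<close>, whose restriction to \<open>\<gg>\<^sub>r\<^sub>,\<^sub>s\<close> is a 1-cocycle. As the first
  cohomology vanishes, it is inner on \<open>\<gg>\<^sub>r\<^sub>,\<^sub>s\<close>, hence on the whole algebra, which is topologically
  generated by \<open>\<gg>\<^sub>r\<^sub>,\<^sub>s\<close>, and it is cancelled by a suitable choice of the next coefficient of \<open>F\<close>.\<close>

section \<open>Normed spaces\<close>

text \<open>Vanishing of the first cohomology asserts that an element \<open>u\<close> exists but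
  bounds no norm, so the coefficients of \<open>F\<close> may grow arbitrarily fast and no single
  Banach space of series can be fixed in advance; in the IndBan product the radii are chosen after
  \<open>F\<close> is known. The choice \<open>F 0 = 1\<close> starts the induction, because the two
  homomorphisms agree in degree 0, and it makes \<open>F\<close> invertible. The labour lies in
  passing from morphisms to series. \<open>tens_lift\<close> and \<open>tens_map\<close>, hence the
  product, the action and the convolutions, are defined by choice and mean nothing before the
  universal property of the completed tensor product is established. Its existence half comes from
  summing null families in ultrametric spaces, its uniqueness half from the density of finitely
  supported families. The same density turns vanishing on generators into vanishing on the whole
  algebra. Once squares of morphisms can be evaluated at elementary tensors, only identities in a
  ring of formal series remain.\<close>

lemma kban_simps [simp]:
  "carrier kban = UNIV" "monoid.mult kban = (*)" "one kban = 1" "zero kban = 0"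
  "add kban = (+)" "smult kban = (*)" "nrm kban = absv"
  by (simp_all add: kban_def)

lemma absv_0 [simp]: "absv (0::'k::complete_nonarch_field) = 0"
  by (simp add: absv_eq_0_iff)

lemma absv_1 [simp]: "absv (1::'k::complete_nonarch_field) = 1"
proof -
  have "absv (1::'k) * absv (1::'k) = absv (1::'k)"
    using absv_mult[of "1::'k" 1] by simp
  then show ?thesis
    using absv_eq_0_iff[of "1::'k"] by simp
qed

lemma absv_minus [simp]: "absv (- x) = absv (x::'k::complete_nonarch_field)"
proof -
  have "absv (-1::'k) * absv (-1::'k) = 1"
    using absv_mult[of "-1::'k" "-1"] by simp
  then have "absv (-1::'k) = 1"
    using absv_nonneg[of "-1::'k"] by (simp add: square_eq_1_iff)
  then show ?thesis
    using absv_mult[of "-1" x] by simp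
qed

lemma absv_diff: "absv (x - y) \<le> max (absv x) (absv (y::'k::complete_nonarch_field))"
  using absv_ultrametric[of x "-y"] by simp

lemma cring_kban: "cring (kban :: ('k::complete_nonarch_field, 'k) nspace)"
proof (intro cringI abelian_groupI comm_monoidI)
  fix x :: 'k assume "x \<in> carrier kban"
  show "\<exists>y\<in>carrier kban. y \<oplus>\<^bsub>kban\<^esub> x = \<zero>\<^bsub>kban\<^esub>"
    by (rule bexI[of _ "-x"]) auto
qed (auto simp: algebra_simps)

text \<open>Completeness is split off because the spaces of weighted sequences are shown here only
  to be normed; that they are complete comes with the hypotheses on the morphisms.\<close>

locale normed_sp = module "kban :: ('k::complete_nonarch_field, 'k) nspace" V
  for V :: "('k::complete_nonarch_field, 'v) nspace" (structure) +
  assumes nrm_nonneg: "x \<in> carrier V \<Longrightarrow> 0 \<le> nrm V x"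
    and nrm_eq_0_iff: "x \<in> carrier V \<Longrightarrow> nrm V x = 0 \<longleftrightarrow> x = \<zero>"
    and nrm_smult: "x \<in> carrier V \<Longrightarrow> nrm V (c \<odot> x) = absv c * nrm V x"
    and nrm_add: "x \<in> carrier V \<Longrightarrow> y \<in> carrier V \<Longrightarrow> nrm V (x \<oplus> y) \<le> max (nrm V x) (nrm V y)"

locale banach_sp = normed_sp V
  for V :: "('k::complete_nonarch_field, 'v) nspace" (structure) +
  assumes complete: "\<lbrakk>\<And>n::nat. X n \<in> carrier V;
      \<And>e. e > 0 \<Longrightarrow> \<exists>N. \<forall>m\<ge>N. \<forall>n\<ge>N. nrm V (X m \<ominus> X n) < e\<rbrakk>
    \<Longrightarrow> \<exists>x\<in>carrier V. (\<lambda>n. nrm V (X n \<ominus> x)) \<longlonglongrightarrow> 0"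

lemma banach_space_iff:
  fixes V :: "('k::complete_nonarch_field, 'v) nspace"
  shows "banach_space V \<longleftrightarrow> banach_sp V"
proof
  assume V: "banach_space V"
  show "banach_sp V"
  proof (intro banach_sp.intro normed_sp.intro normed_sp_axioms.intro banach_sp_axioms.intro)
    show "module (kban :: ('k, 'k) nspace) V"
      using V unfolding banach_space_def by (elim conjE)
    fix X :: "nat \<Rightarrow> 'v"
    assume "\<And>n. X n \<in> carrier V"
      "\<And>e. e > 0 \<Longrightarrow> \<exists>N. \<forall>m\<ge>N. \<forall>n\<ge>N. nrm V (X m \<ominus>\<^bsub>V\<^esub> X n) < e"
    moreover have "(\<forall>n. X n \<in> carrier V) \<and>
        (\<forall>e>0. \<exists>N. \<forall>m\<ge>N. \<forall>n\<ge>N. nrm V (X m \<ominus>\<^bsub>V\<^esub> X n) < e)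
       \<longrightarrow> (\<exists>x\<in>carrier V. (\<lambda>n. nrm V (X n \<ominus>\<^bsub>V\<^esub> x)) \<longlonglongrightarrow> 0)"
      using V unfolding banach_space_def by (elim conjE allE)
    ultimately show "\<exists>x\<in>carrier V. (\<lambda>n. nrm V (X n \<ominus>\<^bsub>V\<^esub> x)) \<longlonglongrightarrow> 0"
      by simp
  qed (use V in \<open>simp_all add: banach_space_def\<close>)
next
  assume "banach_sp V"
  then interpret banach_sp V .
  show "banach_space V"
    unfolding banach_space_def
    using module_axioms nrm_nonneg nrm_eq_0_iff nrm_smult nrm_add complete
    by (intro conjI) (simp_all)
qed

context normed_sp
begin

lemma sm_closed [simp]: "x \<in> carrier V \<Longrightarrow> c \<odot> x \<in> carrier V"
  using smult_closed[of c x] by simp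

lemma sm_add: "x \<in> carrier V \<Longrightarrow> (a + b) \<odot> x = a \<odot> x \<oplus> b \<odot> x"
  using smult_l_distr[of a b x] by simp

lemma sm_r_add: "x \<in> carrier V \<Longrightarrow> y \<in> carrier V \<Longrightarrow> c \<odot> (x \<oplus> y) = c \<odot> x \<oplus> c \<odot> y"
  using smult_r_distr[of c x y] by simp

lemma sm_assoc: "x \<in> carrier V \<Longrightarrow> (a * b) \<odot> x = a \<odot> (b \<odot> x)"
  using smult_assoc1[of a b x] by simp

lemma sm_one [simp]: "x \<in> carrier V \<Longrightarrow> 1 \<odot> x = x"
  using smult_one[of x] by simp

lemma sm_zero [simp]: "x \<in> carrier V \<Longrightarrow> 0 \<odot> x = \<zero>"
  using smult_l_null[of x] by simp

lemma sm_r_zero [simp]: "c \<odot> \<zero> = \<zero>"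
  using smult_r_null[of c] by simp

lemma sm_neg: "x \<in> carrier V \<Longrightarrow> (- 1) \<odot> x = \<ominus> x"
  using sm_add[of x "-1" 1] by (intro M.minus_equality[symmetric]) auto

lemma nrm_zero [simp]: "nrm V \<zero> = 0"
  using nrm_eq_0_iff[of \<zero>] by simp

lemma nrm_neg [simp]: "x \<in> carrier V \<Longrightarrow> nrm V (\<ominus> x) = nrm V x"
  using nrm_smult[of x "-1"] by (simp add: sm_neg)

lemma nrm_diff_commute: "x \<in> carrier V \<Longrightarrow> y \<in> carrier V \<Longrightarrow> nrm V (x \<ominus> y) = nrm V (y \<ominus> x)"
  using nrm_neg[of "x \<ominus> y"] by (simp add: M.minus_add a_minus_def M.a_comm)

lemma diff_split: "\<lbrakk>x \<in> carrier V; y \<in> carrier V; z \<in> carrier V\<rbrakk> \<Longrightarrow> x \<ominus> z = (x \<ominus> y) \<oplus> (y \<ominus> z)"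
  by (simp add: a_minus_def M.a_assoc M.r_neg1)

lemma add_diff_cancel: "x \<in> carrier V \<Longrightarrow> y \<in> carrier V \<Longrightarrow> x \<oplus> (y \<ominus> x) = y"
  by (simp add: a_minus_def M.a_lcomm[of x y] M.r_neg)

lemma nrm_tri: "\<lbrakk>x \<in> carrier V; y \<in> carrier V; z \<in> carrier V\<rbrakk> \<Longrightarrow>
    nrm V (x \<ominus> z) \<le> max (nrm V (x \<ominus> y)) (nrm V (y \<ominus> z))"
  using nrm_add[of "x \<ominus> y" "y \<ominus> z"] diff_split[of x y z] by simp

lemma diff_zero_iff: "x \<in> carrier V \<Longrightarrow> y \<in> carrier V \<Longrightarrow> x \<ominus> y = \<zero> \<longleftrightarrow> x = y"
  by (metis M.add.m_lcomm M.minus_equality M.r_neg M.r_zero a_minus_def M.add.inv_closed M.minus_minus)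

text \<open>Shaped for density arguments: the rest of a truncated family has norm at most
  \<open>e\<close>, and its image under a map with bound \<open>C\<close> has norm at most
  \<open>C * e\<close>.\<close>

lemma zeroI_small:
  assumes "x \<in> carrier V" "\<And>e. e > 0 \<Longrightarrow> nrm V x \<le> C * e"
  shows "x = \<zero>"
proof -
  have "nrm V x \<le> 0 + e" if "e > 0" for e
  proof -
    \<comment> \<open>The hypothesis is used at \<open>e\<close> divided by |C| + 1; the added 1
      covers the case \<open>C = 0\<close>.\<close>
    have "nrm V x \<le> C * (e / (\<bar>C\<bar> + 1))"
      using assms(2)[of "e / (\<bar>C\<bar> + 1)"] that by simp
    also have "\<dots> \<le> (\<bar>C\<bar> + 1) * (e / (\<bar>C\<bar> + 1))"
      using that by (intro mult_right_mono) auto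
    finally show ?thesis using that by simp
  qed
  then show ?thesis
    by (metis assms(1) field_le_epsilon nrm_nonneg nrm_eq_0_iff order_antisym)
qed

lemma nrm_finsum:
  assumes "finite T" "f \<in> T \<rightarrow> carrier V" "\<And>t. t \<in> T \<Longrightarrow> nrm V (f t) \<le> B" "0 \<le> B"
  shows "nrm V (finsum V f T) \<le> B"
  using assms
proof (induction T)
  case (insert t T)
  then have "finsum V f (insert t T) = f t \<oplus> finsum V f T"
    by (intro M.finsum_insert) auto
  moreover have "nrm V (f t \<oplus> finsum V f T) \<le> max (nrm V (f t)) (nrm V (finsum V f T))"
    using insert by (intro nrm_add M.finsum_closed) auto
  moreover have "max (nrm V (f t)) (nrm V (finsum V f T)) \<le> B"
    using insert by auto
  ultimately show ?case
    by (metis order_trans)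
qed auto

lemma sm_finsum:
  assumes "finite T" "f \<in> T \<rightarrow> carrier V"
  shows "c \<odot> finsum V f T = (\<Oplus>t\<in>T. c \<odot> f t)"
  using assms
proof (induction T)
  case (insert t T)
  then have "finsum V f (insert t T) = f t \<oplus> finsum V f T"
    by (intro M.finsum_insert) auto
  moreover have "(\<Oplus>t\<in>insert t T. c \<odot> f t) = c \<odot> f t \<oplus> (\<Oplus>t\<in>T. c \<odot> f t)"
    using insert by (intro M.finsum_insert) auto
  ultimately show ?case
    using insert by (auto simp: sm_r_add)
qed auto

lemma normed_sp_self: "normed_sp V" ..

lemma submodule_self: "submodule (carrier V) (kban :: ('k, 'k) nspace) V"
  by (rule carrier_is_submodule)

end

text \<open>Norms given by suprema or infima satisfy one inequality for scalar multiples at once;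
  the reverse one follows by applying it to \<open>inverse c\<close>, so only half is asked.\<close>

lemma normed_spI:
  fixes V :: "('k::complete_nonarch_field, 'v) nspace" (structure)
  assumes "abelian_group V"
    and "\<And>c x. x \<in> carrier V \<Longrightarrow> c \<odot> x \<in> carrier V"
    and "\<And>a b x. x \<in> carrier V \<Longrightarrow> (a + b) \<odot> x = a \<odot> x \<oplus> b \<odot> x"
    and "\<And>c x y. x \<in> carrier V \<Longrightarrow> y \<in> carrier V \<Longrightarrow> c \<odot> (x \<oplus> y) = c \<odot> x \<oplus> c \<odot> y"
    and "\<And>a b x. x \<in> carrier V \<Longrightarrow> (a * b) \<odot> x = a \<odot> (b \<odot> x)"
    and "\<And>x. x \<in> carrier V \<Longrightarrow> 1 \<odot> x = x"
    and nonneg: "\<And>x. x \<in> carrier V \<Longrightarrow> 0 \<le> nrm V x"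
    and definite: "\<And>x. x \<in> carrier V \<Longrightarrow> nrm V x = 0 \<Longrightarrow> x = \<zero>"
    and le: "\<And>c x. x \<in> carrier V \<Longrightarrow> nrm V (c \<odot> x) \<le> absv c * nrm V x"
    and "\<And>x y. x \<in> carrier V \<Longrightarrow> y \<in> carrier V \<Longrightarrow> nrm V (x \<oplus> y) \<le> max (nrm V x) (nrm V y)"
  shows "normed_sp V"
proof -
  interpret module "kban :: ('k, 'k) nspace" V
    by (intro moduleI cring_kban) (use assms in auto)
  have smult: "nrm V (c \<odot> x) = absv c * nrm V x" if x: "x \<in> carrier V" for c x
  proof (cases "c = 0")
    case True
    then show ?thesis using le[OF x, of c] nonneg[of "c \<odot> x"] x by simp
  next
    case False
    then have "nrm V x \<le> absv (inverse c) * nrm V (c \<odot> x)"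
      using le[of "c \<odot> x" "inverse c"] smult_assoc1[of "inverse c" c x] smult_one[OF x] x by simp
    then have "absv c * nrm V x \<le> absv c * (absv (inverse c) * nrm V (c \<odot> x))"
      by (intro mult_left_mono absv_nonneg)
    also have "\<dots> = nrm V (c \<odot> x)"
      using False by (simp flip: mult.assoc absv_mult)
    finally show ?thesis using le[OF x, of c] by simp
  qed
  show ?thesis
  proof (intro normed_sp.intro normed_sp_axioms.intro module_axioms)
    show "nrm V x = 0 \<longleftrightarrow> x = \<zero>" if "x \<in> carrier V" for x
      using definite[OF that] smult[OF M.zero_closed, of 0] smult_l_null[OF M.zero_closed] by auto
  qed (use assms smult in auto)
qed

lemma banach_sp_kban: "banach_sp (kban :: ('k::complete_nonarch_field, 'k) nspace)"
proof -
  interpret K: cring "kban :: ('k, 'k) nspace" by (rule cring_kban)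
  interpret K: normed_sp "kban :: ('k, 'k) nspace"
    by (rule normed_spI)
      (auto simp: K.abelian_group_axioms algebra_simps absv_nonneg absv_eq_0_iff absv_mult absv_ultrametric)
  have minus: "x \<ominus>\<^bsub>kban\<^esub> y = x - y" for x y :: 'k
    using K.sm_neg[of y] by (simp add: a_minus_def)
  show ?thesis
  proof
    fix X :: "nat \<Rightarrow> 'k"
    assume "\<And>e. e > 0 \<Longrightarrow> \<exists>N. \<forall>m\<ge>N. \<forall>n\<ge>N. nrm kban (X m \<ominus>\<^bsub>kban\<^esub> X n) < e"
    then show "\<exists>x\<in>carrier kban. (\<lambda>n. nrm kban (X n \<ominus>\<^bsub>kban\<^esub> x)) \<longlonglongrightarrow> 0"
      using absv_complete[of X] by (auto simp: minus)
  qed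
qed

lemma closed_setD:
  assumes "closed_set V S" "\<And>n. X n \<in> S" "x \<in> carrier V" "(\<lambda>n. nrm V (X n \<ominus>\<^bsub>V\<^esub> x)) \<longlonglongrightarrow> 0"
  shows "x \<in> S"
  using conjunct2[OF assms(1)[unfolded closed_set_def], THEN spec, THEN spec, of X x] assms(2-4)
  by simp

lemma closed_setI:
  assumes "S \<subseteq> carrier V"
    and "\<And>X x. \<lbrakk>\<And>n::nat. X n \<in> S; x \<in> carrier V; (\<lambda>n. nrm V (X n \<ominus>\<^bsub>V\<^esub> x)) \<longlonglongrightarrow> 0\<rbrakk> \<Longrightarrow> x \<in> S"
  shows "closed_set V S"
  unfolding closed_set_def
proof (intro conjI allI impI; (elim conjE)?)
  fix X x assume "\<forall>n::nat. X n \<in> S" "x \<in> carrier V" "(\<lambda>n. nrm V (X n \<ominus>\<^bsub>V\<^esub> x)) \<longlonglongrightarrow> 0"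
  then show "x \<in> S" using assms(2)[of X x] by simp
qed (rule assms(1))

subsection \<open>Bounded maps\<close>

lemma bounded_linI:
  assumes "\<And>x. x \<in> carrier V \<Longrightarrow> f x \<in> carrier W"
    and "\<And>x y. x \<in> carrier V \<Longrightarrow> y \<in> carrier V \<Longrightarrow> f (x \<oplus>\<^bsub>V\<^esub> y) = f x \<oplus>\<^bsub>W\<^esub> f y"
    and "\<And>c x. x \<in> carrier V \<Longrightarrow> f (c \<odot>\<^bsub>V\<^esub> x) = c \<odot>\<^bsub>W\<^esub> f x"
    and "\<And>x. x \<in> carrier V \<Longrightarrow> nrm W (f x) \<le> C * nrm V x"
  shows "bounded_lin V W f"
  unfolding bounded_lin_def using assms by blast

lemma bounded_lin_closed: "bounded_lin V W f \<Longrightarrow> x \<in> carrier V \<Longrightarrow> f x \<in> carrier W"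
  by (auto simp: bounded_lin_def)

lemma bounded_lin_add:
  "bounded_lin V W f \<Longrightarrow> x \<in> carrier V \<Longrightarrow> y \<in> carrier V \<Longrightarrow> f (x \<oplus>\<^bsub>V\<^esub> y) = f x \<oplus>\<^bsub>W\<^esub> f y"
  by (auto simp: bounded_lin_def)

lemma bounded_lin_smult:
  "bounded_lin V W f \<Longrightarrow> x \<in> carrier V \<Longrightarrow> f (c \<odot>\<^bsub>V\<^esub> x) = c \<odot>\<^bsub>W\<^esub> f x"
  by (auto simp: bounded_lin_def)

text \<open>The definition puts no sign on its constant. As norms on \<open>V\<close> are
  nonnegative, \<open>max C 0\<close> is a bound too, and monotonicity arguments need the
  sign.\<close>

lemma bounded_lin_bound:
  assumes "normed_sp V" "bounded_lin V W f"
  obtains C where "0 \<le> C" "\<And>x. x \<in> carrier V \<Longrightarrow> nrm W (f x) \<le> C * nrm V x"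
proof -
  obtain C where C: "\<And>x. x \<in> carrier V \<Longrightarrow> nrm W (f x) \<le> C * nrm V x"
    using assms(2) unfolding bounded_lin_def by blast
  have "nrm W (f x) \<le> max C 0 * nrm V x" if "x \<in> carrier V" for x
  proof -
    have "C * nrm V x \<le> max C 0 * nrm V x"
      using normed_sp.nrm_nonneg[OF assms(1) that] by (intro mult_right_mono) auto
    then show ?thesis using C[OF that] by simp
  qed
  then show thesis
    by (intro that[of "max C 0"]) auto
qed

lemma bounded_lin_comp:
  assumes "normed_sp V" "normed_sp W" "bounded_lin V W f" "bounded_lin W Z g"
  shows "bounded_lin V Z (\<lambda>x. g (f x))"
proof -
  obtain C where C: "0 \<le> C" "\<And>x. x \<in> carrier V \<Longrightarrow> nrm W (f x) \<le> C * nrm V x"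
    using bounded_lin_bound[OF assms(1,3)] by metis
  obtain D where D: "0 \<le> D" "\<And>x. x \<in> carrier W \<Longrightarrow> nrm Z (g x) \<le> D * nrm W x"
    using bounded_lin_bound[OF assms(2,4)] by metis
  note cl = bounded_lin_closed[OF assms(3)]
  show ?thesis
  proof (rule bounded_linI)
    fix x assume x: "x \<in> carrier V"
    have "nrm Z (g (f x)) \<le> D * nrm W (f x)"
      using D cl x by simp
    also have "\<dots> \<le> D * (C * nrm V x)"
      using C D x by (intro mult_left_mono) auto
    finally show "nrm Z (g (f x)) \<le> (D * C) * nrm V x" by (simp add: mult.assoc)
  qed (use assms(3,4) cl in \<open>auto simp: bounded_lin_def\<close>)
qed

lemma bounded_lin_0:
  assumes "normed_sp V" "normed_sp W" "bounded_lin V W f"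
  shows "f \<zero>\<^bsub>V\<^esub> = \<zero>\<^bsub>W\<^esub>"
proof -
  interpret V: normed_sp V by fact
  interpret W: normed_sp W by fact
  have "f (0 \<odot>\<^bsub>V\<^esub> \<zero>\<^bsub>V\<^esub>) = 0 \<odot>\<^bsub>W\<^esub> f \<zero>\<^bsub>V\<^esub>"
    by (rule bounded_lin_smult[OF assms(3)]) simp
  then show ?thesis
    using bounded_lin_closed[OF assms(3)] by simp
qed

lemma bounded_lin_minus:
  assumes "normed_sp V" "normed_sp W" "bounded_lin V W f" "x \<in> carrier V" "y \<in> carrier V"
  shows "f (x \<ominus>\<^bsub>V\<^esub> y) = f x \<ominus>\<^bsub>W\<^esub> f y"
proof -
  interpret V: normed_sp V by fact
  interpret W: normed_sp W by fact
  have "f (x \<oplus>\<^bsub>V\<^esub> (- 1) \<odot>\<^bsub>V\<^esub> y) = f x \<oplus>\<^bsub>W\<^esub> (- 1) \<odot>\<^bsub>W\<^esub> f y"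
    using assms by (simp add: bounded_lin_def)
  then show ?thesis
    using assms bounded_lin_closed[OF assms(3)]
    by (simp add: a_minus_def V.sm_neg W.sm_neg)
qed

text \<open>Together with \<open>closed_span_least\<close> this shows that a bounded map killing a
  set of relations kills the closed subspace they generate.\<close>

lemma bounded_lin_kernel_closed:
  assumes "normed_sp V" "normed_sp W" "bounded_lin V W f"
  shows "submodule {x \<in> carrier V. f x = \<zero>\<^bsub>W\<^esub>} (kban :: ('k::complete_nonarch_field, 'k) nspace) V"
    and "closed_set V {x \<in> carrier V. f x = \<zero>\<^bsub>W\<^esub>}"
proof -
  interpret V: normed_sp V by fact
  interpret W: normed_sp W by fact
  note f = assms(3)
  show "submodule {x \<in> carrier V. f x = \<zero>\<^bsub>W\<^esub>} (kban :: ('k, 'k) nspace) V"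
  proof (rule V.submoduleI)
    fix x assume "x \<in> {x \<in> carrier V. f x = \<zero>\<^bsub>W\<^esub>}"
    then show "\<ominus>\<^bsub>V\<^esub> x \<in> {x \<in> carrier V. f x = \<zero>\<^bsub>W\<^esub>}"
      using bounded_lin_smult[OF f, of x "-1"] by (auto simp: V.sm_neg)
  qed (use bounded_lin_0[OF assms] in \<open>auto simp: bounded_lin_add[OF f] bounded_lin_smult[OF f]\<close>)
  obtain C where C: "0 \<le> C" "\<And>x. x \<in> carrier V \<Longrightarrow> nrm W (f x) \<le> C * nrm V x"
    using bounded_lin_bound[OF assms(1,3)] by metis
  show "closed_set V {x \<in> carrier V. f x = \<zero>\<^bsub>W\<^esub>}"
    unfolding closed_set_def
  proof (intro conjI allI impI)
    fix X x assume *: "(\<forall>n::nat. X n \<in> {x \<in> carrier V. f x = \<zero>\<^bsub>W\<^esub>}) \<and> x \<in> carrier V \<and>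
        (\<lambda>n. nrm V (X n \<ominus>\<^bsub>V\<^esub> x)) \<longlonglongrightarrow> 0"
    have fx: "f x \<in> carrier W" using * bounded_lin_closed[OF f] by blast
    \<comment> \<open>As \<open>f (X n)\<close> is zero, \<open>f x\<close> is up to sign the image
      of the difference of \<open>X n\<close> and \<open>x\<close>, which tends to 0.\<close>
    have "nrm W (f x) \<le> C * nrm V (X n \<ominus>\<^bsub>V\<^esub> x)" for n
    proof -
      have "nrm W (f (X n \<ominus>\<^bsub>V\<^esub> x)) \<le> C * nrm V (X n \<ominus>\<^bsub>V\<^esub> x)"
        using * by (intro C) auto
      then show ?thesis
        using * fx bounded_lin_minus[OF assms, of "X n" x]
        by (simp add: a_minus_def)
    qed
    moreover have "(\<lambda>n. C * nrm V (X n \<ominus>\<^bsub>V\<^esub> x)) \<longlonglongrightarrow> C * 0"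
      using * by (intro tendsto_mult_left) auto
    ultimately have "nrm W (f x) \<le> 0"
      by (intro LIMSEQ_le_const) auto
    then show "x \<in> {x \<in> carrier V. f x = \<zero>\<^bsub>W\<^esub>}"
      using fx * W.nrm_nonneg[OF fx] W.nrm_eq_0_iff[OF fx] by auto
  qed auto
qed

section \<open>Contracting coproducts\<close>

context banach_sp
begin

text \<open>The limit is taken over the net of finite subsets because the index sets that occur,
  such as pairs of vectors, can be uncountable. It is expressed through the norm since
  \<open>carrier V\<close> carries no topology.\<close>

definition has_sm :: "'s set \<Rightarrow> ('s \<Rightarrow> 'v) \<Rightarrow> 'v \<Rightarrow> bool" where
  "has_sm S g z \<longleftrightarrow> z \<in> carrier V \<and>
     ((\<lambda>T. nrm V (z \<ominus> finsum V g T)) \<longlongrightarrow> 0) (finite_subsets_at_top S)"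

text \<open>In an ultrametric space a finite sum is no larger than its largest term, so a null
  family is summable without any absolute convergence.\<close>

lemma has_sm_exists:
  assumes g: "g \<in> S \<rightarrow> carrier V" and fin: "\<And>e. e > 0 \<Longrightarrow> finite {s\<in>S. e \<le> nrm V (g s)}"
  shows "\<exists>z. has_sm S g z"
proof -
  \<comment> \<open>These finite sets form a sequence that exhausts all nonzero terms, even if
    \<open>S\<close> is uncountable; completeness is stated for sequences only.\<close>
  define T where "T n = {s\<in>S. 1 / real (Suc n) \<le> nrm V (g s)}" for n
  have finT: "finite (T n)" and TS: "T n \<subseteq> S" for n
    unfolding T_def using fin by auto
  have cl: "finsum V g A \<in> carrier V" if "A \<subseteq> S" for A
    using g that by (intro M.finsum_closed) auto
  \<comment> \<open>Enlarging \<open>T n\<close> to a finite set \<open>A\<close> adds only terms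
    below 1/(n+1), and so does not change the sum by more than that.\<close>
  have diff: "nrm V (finsum V g (T n) \<ominus> finsum V g A) \<le> 1 / real (Suc n)"
    if "finite A" "T n \<subseteq> A" "A \<subseteq> S" for A n
  proof -
    have c2: "finsum V g (A - T n) \<in> carrier V"
      using that by (intro cl) auto
    have "finsum V g A = finsum V g (T n \<union> (A - T n))"
      using that by (simp add: Un_absorb1)
    also have "\<dots> = finsum V g (T n) \<oplus> finsum V g (A - T n)"
      using that finT TS g by (intro M.finsum_Un_disjoint) auto
    finally have "finsum V g (T n) \<ominus> finsum V g A = \<ominus> finsum V g (A - T n)"
      using cl[OF TS] c2 by (simp add: a_minus_def M.minus_add M.r_neg1 M.r_neg2)
    moreover have "nrm V (finsum V g (A - T n)) \<le> 1 / real (Suc n)"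
      using that g by (intro nrm_finsum) (auto simp: T_def)
    ultimately show ?thesis
      using c2 by simp
  qed
  have mono: "T m \<subseteq> T n" if "m \<le> n" for m n
  proof -
    have "1 / real (Suc n) \<le> 1 / real (Suc m)"
      using that by (intro divide_left_mono) auto
    then show ?thesis unfolding T_def by (auto intro: order_trans)
  qed
  have "\<exists>x\<in>carrier V. (\<lambda>n. nrm V (finsum V g (T n) \<ominus> x)) \<longlonglongrightarrow> 0"
  proof (rule complete)
    fix e :: real assume "e > 0"
    then obtain N where N: "1 / real (Suc N) < e"
      using nat_approx_posE by blast
    have "nrm V (finsum V g (T m) \<ominus> finsum V g (T n)) < e" if "N \<le> m" "N \<le> n" for m n
    proof -
      have "nrm V (finsum V g (T m) \<ominus> finsum V g (T n))
          \<le> max (nrm V (finsum V g (T m) \<ominus> finsum V g (T N))) (nrm V (finsum V g (T N) \<ominus> finsum V g (T n)))"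
        using cl[OF TS] by (intro nrm_tri)
      moreover have "nrm V (finsum V g (T N) \<ominus> finsum V g (T m)) \<le> 1 / real (Suc N)"
        "nrm V (finsum V g (T N) \<ominus> finsum V g (T n)) \<le> 1 / real (Suc N)"
        using that mono finT TS by (intro diff; blast)+
      ultimately show ?thesis
        using N cl[OF TS] by (simp add: nrm_diff_commute)
    qed
    then show "\<exists>N. \<forall>m\<ge>N. \<forall>n\<ge>N. nrm V (finsum V g (T m) \<ominus> finsum V g (T n)) < e"
      by blast
  qed (use cl TS in blast)
  then obtain x where x: "x \<in> carrier V" "(\<lambda>n. nrm V (finsum V g (T n) \<ominus> x)) \<longlonglongrightarrow> 0"
    by blast
  have "((\<lambda>A. nrm V (x \<ominus> finsum V g A)) \<longlongrightarrow> 0) (finite_subsets_at_top S)"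
  proof (rule tendstoI)
    fix e :: real assume e: "e > 0"
    have "\<forall>\<^sub>F n in sequentially. nrm V (finsum V g (T n) \<ominus> x) < e"
      using x(2) e cl[OF TS] x(1) by (auto simp: tendsto_iff nrm_nonneg)
    moreover have "\<forall>\<^sub>F n in sequentially. 1 / real (Suc n) < e"
      using e LIMSEQ_inverse_real_of_nat by (auto simp: tendsto_iff inverse_eq_divide)
    ultimately have "\<forall>\<^sub>F n in sequentially. nrm V (finsum V g (T n) \<ominus> x) < e \<and> 1 / real (Suc n) < e"
      by (rule eventually_conj)
    then obtain n where n: "nrm V (finsum V g (T n) \<ominus> x) < e" "1 / real (Suc n) < e"
      by (auto simp: eventually_sequentially)
    have "dist (nrm V (x \<ominus> finsum V g A)) 0 < e" if "finite A" "T n \<subseteq> A" "A \<subseteq> S" for A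
    proof -
      have "nrm V (x \<ominus> finsum V g A) \<le>
          max (nrm V (x \<ominus> finsum V g (T n))) (nrm V (finsum V g (T n) \<ominus> finsum V g A))"
        by (intro nrm_tri cl TS x that)
      then show ?thesis
        using diff[OF that] n x cl TS[of n] that by (simp add: nrm_diff_commute nrm_nonneg)
    qed
    then show "\<forall>\<^sub>F A in finite_subsets_at_top S. dist (nrm V (x \<ominus> finsum V g A)) 0 < e"
      using finT[of n] TS[of n] by (auto simp: eventually_finite_subsets_at_top intro!: exI[of _ "T n"])
  qed
  then show ?thesis
    unfolding has_sm_def using x(1) by blast
qed

lemma has_sm_cong:
  assumes "has_sm S g z" "\<And>s. s \<in> S \<Longrightarrow> g s = g' s" "g' \<in> S \<rightarrow> carrier V"
  shows "has_sm S g' z"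
proof -
  have "\<forall>\<^sub>F T in finite_subsets_at_top S. nrm V (z \<ominus> finsum V g T) = nrm V (z \<ominus> finsum V g' T)"
  proof (rule eventually_finite_subsets_at_top_weakI)
    fix T assume "finite T" "T \<subseteq> S"
    then have "finsum V g T = finsum V g' T"
      using assms by (intro M.finsum_cong') auto
    then show "nrm V (z \<ominus> finsum V g T) = nrm V (z \<ominus> finsum V g' T)" by simp
  qed
  from tendsto_cong[OF this, of 0] show ?thesis
    using assms(1) by (simp add: has_sm_def)
qed

text \<open>Comparison with a common partial sum bounds the difference of \<open>z\<close> and
  \<open>w\<close> by a maximum of two null nets.\<close>

lemma has_sm_unique:
  assumes "g \<in> S \<rightarrow> carrier V" "has_sm S g z" "has_sm S g w"
  shows "z = w"
proof -
  let ?F = "finite_subsets_at_top S"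
  have cl: "z \<in> carrier V" "w \<in> carrier V" using assms by (auto simp: has_sm_def)
  have "((\<lambda>T. max (nrm V (z \<ominus> finsum V g T)) (nrm V (w \<ominus> finsum V g T))) \<longlongrightarrow> max 0 0) ?F"
    using assms by (intro tendsto_max) (auto simp: has_sm_def)
  moreover have "\<forall>\<^sub>F T in ?F. nrm V (z \<ominus> w) \<le> max (nrm V (z \<ominus> finsum V g T)) (nrm V (w \<ominus> finsum V g T))"
  proof (rule eventually_finite_subsets_at_top_weakI)
    fix T assume "finite T" "T \<subseteq> S"
    then have "finsum V g T \<in> carrier V" using assms(1) by (intro M.finsum_closed) auto
    then show "nrm V (z \<ominus> w) \<le> max (nrm V (z \<ominus> finsum V g T)) (nrm V (w \<ominus> finsum V g T))"
      using nrm_tri[of z "finsum V g T" w] cl by (simp add: nrm_diff_commute)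
  qed
  ultimately have "nrm V (z \<ominus> w) \<le> 0"
    using tendsto_lowerbound[of _ "max 0 0" ?F "nrm V (z \<ominus> w)"] by simp
  then show ?thesis
    using cl by (metis M.minus_closed diff_zero_iff nrm_eq_0_iff nrm_nonneg order_antisym)
qed

lemma has_sm_add:
  assumes g: "g \<in> S \<rightarrow> carrier V" "h \<in> S \<rightarrow> carrier V" and s: "has_sm S g z" "has_sm S h w"
  shows "has_sm S (\<lambda>s. g s \<oplus> h s) (z \<oplus> w)"
proof -
  let ?F = "finite_subsets_at_top S"
  have cl: "z \<in> carrier V" "w \<in> carrier V" using assms by (auto simp: has_sm_def)
  have "((\<lambda>T. max (nrm V (z \<ominus> finsum V g T)) (nrm V (w \<ominus> finsum V h T))) \<longlongrightarrow> max 0 0) ?F"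
    using assms by (intro tendsto_max) (auto simp: has_sm_def)
  then have lim: "((\<lambda>T. max (nrm V (z \<ominus> finsum V g T)) (nrm V (w \<ominus> finsum V h T))) \<longlongrightarrow> 0) ?F"
    by simp
  have *: "0 \<le> nrm V (z \<oplus> w \<ominus> (\<Oplus>s\<in>T. g s \<oplus> h s)) \<and>
      nrm V (z \<oplus> w \<ominus> (\<Oplus>s\<in>T. g s \<oplus> h s)) \<le> max (nrm V (z \<ominus> finsum V g T)) (nrm V (w \<ominus> finsum V h T))"
    if "finite T" "T \<subseteq> S" for T
  proof -
    have c: "finsum V g T \<in> carrier V" "finsum V h T \<in> carrier V"
      using that g by (intro M.finsum_closed; auto)+
    have "(\<Oplus>s\<in>T. g s \<oplus> h s) = finsum V g T \<oplus> finsum V h T"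
      using that g by (intro M.finsum_addf) auto
    then have "z \<oplus> w \<ominus> (\<Oplus>s\<in>T. g s \<oplus> h s) = (z \<ominus> finsum V g T) \<oplus> (w \<ominus> finsum V h T)"
      using cl c by (simp add: a_minus_def M.minus_add M.a_ac)
    then show ?thesis
      using cl c nrm_add[of "z \<ominus> finsum V g T" "w \<ominus> finsum V h T"] by (simp add: nrm_nonneg)
  qed
  have "((\<lambda>T. nrm V (z \<oplus> w \<ominus> (\<Oplus>s\<in>T. g s \<oplus> h s))) \<longlongrightarrow> 0) ?F"
    by (rule tendsto_sandwich[OF _ _ tendsto_const lim])
      (rule eventually_finite_subsets_at_top_weakI; use * in blast)+
  then show ?thesis
    using cl by (simp add: has_sm_def)
qed

lemma has_sm_smult:
  assumes g: "g \<in> S \<rightarrow> carrier V" and s: "has_sm S g z"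
  shows "has_sm S (\<lambda>s. c \<odot> g s) (c \<odot> z)"
proof -
  let ?F = "finite_subsets_at_top S"
  have cl: "z \<in> carrier V" using assms by (auto simp: has_sm_def)
  have lim: "((\<lambda>T. absv c * nrm V (z \<ominus> finsum V g T)) \<longlongrightarrow> absv c * 0) ?F"
    using assms by (intro tendsto_mult_left) (auto simp: has_sm_def)
  have *: "nrm V (c \<odot> z \<ominus> (\<Oplus>s\<in>T. c \<odot> g s)) = absv c * nrm V (z \<ominus> finsum V g T)"
    if "finite T" "T \<subseteq> S" for T
  proof -
    have c: "finsum V g T \<in> carrier V"
      using that g by (intro M.finsum_closed) auto
    have "(\<Oplus>s\<in>T. c \<odot> g s) = c \<odot> finsum V g T"
      using that g by (intro sm_finsum[symmetric]) auto
    moreover have "c \<odot> z \<ominus> c \<odot> finsum V g T = c \<odot> (z \<ominus> finsum V g T)"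
      using cl c by (simp add: a_minus_def sm_r_add smult_r_minus)
    ultimately show ?thesis
      using cl c by (simp add: nrm_smult)
  qed
  have "\<forall>\<^sub>F T in ?F. nrm V (c \<odot> z \<ominus> (\<Oplus>s\<in>T. c \<odot> g s)) = absv c * nrm V (z \<ominus> finsum V g T)"
    by (rule eventually_finite_subsets_at_top_weakI) (use * in blast)
  then show ?thesis
    using cl lim tendsto_cong by (fastforce simp add: has_sm_def)
qed

lemma has_sm_bound:
  assumes g: "g \<in> S \<rightarrow> carrier V" and s: "has_sm S g z"
    and B: "\<And>s. s \<in> S \<Longrightarrow> nrm V (g s) \<le> B" "0 \<le> B"
  shows "nrm V z \<le> B"
proof -
  let ?F = "finite_subsets_at_top S"
  have cl: "z \<in> carrier V" using assms by (auto simp: has_sm_def)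
  have "((\<lambda>T. max (nrm V (z \<ominus> finsum V g T)) B) \<longlongrightarrow> max 0 B) ?F"
    using assms by (intro tendsto_max) (auto simp: has_sm_def)
  moreover have "\<forall>\<^sub>F T in ?F. nrm V z \<le> max (nrm V (z \<ominus> finsum V g T)) B"
  proof (rule eventually_finite_subsets_at_top_weakI)
    fix T assume T: "finite T" "T \<subseteq> S"
    then have c: "finsum V g T \<in> carrier V" using g by (intro M.finsum_closed) auto
    have "nrm V (finsum V g T) \<le> B"
      using T g B by (intro nrm_finsum) auto
    moreover have "nrm V z \<le> max (nrm V (z \<ominus> finsum V g T)) (nrm V (finsum V g T))"
      using nrm_add[of "z \<ominus> finsum V g T" "finsum V g T"] c cl
      by (simp add: a_minus_def M.a_assoc M.l_neg)
    ultimately show "nrm V z \<le> max (nrm V (z \<ominus> finsum V g T)) B"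
      by auto
  qed
  ultimately have "nrm V z \<le> max 0 B"
    using tendsto_lowerbound[of _ "max 0 B" ?F "nrm V z"] by simp
  then show ?thesis using B by simp
qed

lemma has_sm_single:
  assumes "s \<in> S" "x \<in> carrier V"
  shows "has_sm S (\<lambda>t. if t = s then x else \<zero>) x"
proof -
  have "\<forall>\<^sub>F T in finite_subsets_at_top S. nrm V (x \<ominus> (\<Oplus>t\<in>T. if t = s then x else \<zero>)) = 0"
    unfolding eventually_finite_subsets_at_top
  proof (intro exI conjI allI impI)
    fix T assume T: "finite T \<and> {s} \<subseteq> T \<and> T \<subseteq> S"
    have "(\<Oplus>t\<in>T. if s = t then x else \<zero>) = x"
      using T assms M.finsum_singleton[of s T "\<lambda>_. x"] by auto
    then have "(\<Oplus>t\<in>T. if t = s then x else \<zero>) = x"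
      by (simp add: eq_commute)
    then show "nrm V (x \<ominus> (\<Oplus>t\<in>T. if t = s then x else \<zero>)) = 0"
      using assms by (simp add: a_minus_def M.r_neg)
  qed (use assms in auto)
  from tendsto_eventually[OF this] show ?thesis
    using assms by (simp add: has_sm_def)
qed

end

section \<open>Weighted null families: completeness and universal property\<close>

lemma c0_simps [simp]:
  "zero (c0 S wt) = (\<lambda>_. 0)" "add (c0 S wt) = (\<lambda>f g s. f s + g s)" "smult (c0 S wt) = (\<lambda>c f s. c * f s)"
  by (simp_all add: c0_def)

lemma c0_carrier:
  "f \<in> carrier (c0 S wt) \<longleftrightarrow> (\<forall>s. s \<notin> S \<longrightarrow> f s = 0) \<and> (\<forall>e>0. finite {s\<in>S. e \<le> absv (f s) * wt s})"
  by (simp add: c0_def)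

lemma c0_nrm: "nrm (c0 S wt) f = Sup (insert 0 ((\<lambda>s. absv (f s) * wt s) ` S))"
  by (simp add: c0_def)

text \<open>\<open>Sup\<close> of an unbounded set of reals is unspecified. Here only finitely many
  weighted entries reach 1, which bounds the set.\<close>

lemma c0_bdd:
  assumes "f \<in> carrier (c0 S wt)"
  shows "bdd_above (insert 0 ((\<lambda>s. absv (f s) * wt s) ` S))"
proof -
  have fin: "finite {s\<in>S. 1 \<le> absv (f s) * wt s}"
    using assms by (auto simp: c0_carrier)
  have "insert 0 ((\<lambda>s. absv (f s) * wt s) ` S) \<subseteq>
      {..1} \<union> (\<lambda>s. absv (f s) * wt s) ` {s\<in>S. 1 \<le> absv (f s) * wt s}"
    by auto
  moreover have "bdd_above ({..1} \<union> (\<lambda>s. absv (f s) * wt s) ` {s\<in>S. 1 \<le> absv (f s) * wt s})"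
    using fin by (simp add: bdd_above_finite)
  ultimately show ?thesis by (meson bdd_above_mono)
qed

lemma c0_le_nrm: "f \<in> carrier (c0 S wt) \<Longrightarrow> s \<in> S \<Longrightarrow> absv (f s) * wt s \<le> nrm (c0 S wt) f"
  unfolding c0_nrm by (intro cSup_upper c0_bdd) auto

lemma c0_nrm_nonneg: "f \<in> carrier (c0 S wt) \<Longrightarrow> 0 \<le> nrm (c0 S wt) f"
  unfolding c0_nrm by (intro cSup_upper c0_bdd) auto

lemma c0_nrm_le: "(\<And>s. s \<in> S \<Longrightarrow> absv (f s) * wt s \<le> B) \<Longrightarrow> 0 \<le> B \<Longrightarrow> nrm (c0 S wt) f \<le> B"
  unfolding c0_nrm by (intro cSup_least) auto

lemma c0_dominated:
  assumes "f \<in> carrier (c0 S wt)" "\<And>s. s \<notin> S \<Longrightarrow> g s = 0"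
    and "\<And>s. s \<in> S \<Longrightarrow> absv (g s) * wt s \<le> absv (f s) * wt s"
  shows "g \<in> carrier (c0 S wt)"
  unfolding c0_carrier
proof (intro conjI allI impI)
  fix e :: real assume "e > 0"
  then have "finite {s\<in>S. e \<le> absv (f s) * wt s}"
    using assms by (auto simp: c0_carrier)
  then show "finite {s\<in>S. e \<le> absv (g s) * wt s}"
    by (rule rev_finite_subset) (use assms(3) order_trans in blast)
qed (use assms in auto)

lemma c0_finite_support:
  assumes "finite T" "T \<subseteq> S" "\<And>s. s \<notin> T \<Longrightarrow> f s = 0"
  shows "f \<in> carrier (c0 S wt)"
  unfolding c0_carrier
proof (intro conjI allI impI)
  fix e :: real assume "e > 0"
  then have "{s\<in>S. e \<le> absv (f s) * wt s} \<subseteq> T"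
    using assms(3) by force
  then show "finite {s\<in>S. e \<le> absv (f s) * wt s}"
    using assms(1) finite_subset by blast
qed (use assms in auto)

lemma single_carrier: "s \<in> S \<Longrightarrow> single s \<in> carrier (c0 S wt)"
  by (rule c0_finite_support[of "{s}"]) (auto simp: single_def)

context
  fixes S :: "'s set" and wt :: "'s \<Rightarrow> real"
  assumes wt: "\<And>s. s \<in> S \<Longrightarrow> 0 < wt s"
begin

lemma c0_add_closed:
  assumes "f \<in> carrier (c0 S wt :: ('k::complete_nonarch_field, 's \<Rightarrow> 'k) nspace)" "g \<in> carrier (c0 S wt)"
  shows "(\<lambda>s. f s + g s) \<in> carrier (c0 S wt)"
  unfolding c0_carrier
proof (intro conjI allI impI)
  fix e :: real assume "e > 0"
  then have "finite ({s\<in>S. e \<le> absv (f s) * wt s} \<union> {s\<in>S. e \<le> absv (g s) * wt s})"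
    using assms by (auto simp: c0_carrier)
  moreover have "{s\<in>S. e \<le> absv (f s + g s) * wt s} \<subseteq>
      {s\<in>S. e \<le> absv (f s) * wt s} \<union> {s\<in>S. e \<le> absv (g s) * wt s}"
  proof
    fix s assume s: "s \<in> {s\<in>S. e \<le> absv (f s + g s) * wt s}"
    then have "absv (f s + g s) * wt s \<le> max (absv (f s)) (absv (g s)) * wt s"
      using wt[of s] absv_ultrametric by (intro mult_right_mono) auto
    then show "s \<in> {s\<in>S. e \<le> absv (f s) * wt s} \<union> {s\<in>S. e \<le> absv (g s) * wt s}"
      using s by (auto simp: max_def split: if_splits)
  qed
  ultimately show "finite {s\<in>S. e \<le> absv (f s + g s) * wt s}"
    using finite_subset by blast
qed (use assms in \<open>auto simp: c0_carrier\<close>)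

lemma c0_smult_closed:
  assumes "f \<in> carrier (c0 S wt :: ('k::complete_nonarch_field, 's \<Rightarrow> 'k) nspace)"
  shows "(\<lambda>s. c * f s) \<in> carrier (c0 S wt)"
proof (cases "c = 0")
  case True
  then show ?thesis by (intro c0_finite_support[of "{}"]) auto
next
  case False
  then have c: "0 < absv c" using absv_nonneg[of c] absv_eq_0_iff[of c] by linarith
  show ?thesis
    unfolding c0_carrier
  proof (intro conjI allI impI)
    fix e :: real assume "e > 0"
    then have "finite {s\<in>S. e / absv c \<le> absv (f s) * wt s}"
      using assms c by (auto simp: c0_carrier)
    moreover have "{s\<in>S. e \<le> absv (c * f s) * wt s} = {s\<in>S. e / absv c \<le> absv (f s) * wt s}"
      using c by (auto simp: absv_mult field_simps)
    ultimately show "finite {s\<in>S. e \<le> absv (c * f s) * wt s}" by simp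
  qed (use assms in \<open>auto simp: c0_carrier\<close>)
qed

lemma c0_normed: "normed_sp (c0 S wt :: ('k::complete_nonarch_field, 's \<Rightarrow> 'k) nspace)" (is "normed_sp ?V")
proof (rule normed_spI)
  show "abelian_group ?V"
  proof (rule abelian_groupI)
    show "\<zero>\<^bsub>?V\<^esub> \<in> carrier ?V"
      by (simp add: c0_finite_support[of "{}"])
    fix f assume "f \<in> carrier ?V"
    then have "(\<lambda>s. (-1) * f s) \<in> carrier ?V"
      by (rule c0_smult_closed)
    then show "\<exists>g\<in>carrier ?V. g \<oplus>\<^bsub>?V\<^esub> f = \<zero>\<^bsub>?V\<^esub>"
      by (intro bexI) auto
  qed (auto simp: c0_add_closed algebra_simps)
  fix f g :: "'s \<Rightarrow> 'k" and c assume f: "f \<in> carrier ?V"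
  show "c \<odot>\<^bsub>?V\<^esub> f \<in> carrier ?V"
    using f by (simp add: c0_smult_closed)
  show "0 \<le> nrm ?V f" using f by (rule c0_nrm_nonneg)
  show "f = \<zero>\<^bsub>?V\<^esub>" if 0: "nrm ?V f = 0"
  proof -
    have "f s = 0" for s
    proof (cases "s \<in> S")
      case True
      have "absv (f s) * wt s \<le> 0"
        using c0_le_nrm[OF f True] 0 by simp
      then show ?thesis
        using wt[OF True] absv_nonneg[of "f s"] absv_eq_0_iff[of "f s"]
        by (simp add: mult_le_0_iff)
    qed (use f in \<open>auto simp: c0_carrier\<close>)
    then show ?thesis by auto
  qed
  show "nrm ?V (c \<odot>\<^bsub>?V\<^esub> f) \<le> absv c * nrm ?V f"
  proof (rule c0_nrm_le)
    fix s assume "s \<in> S"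
    have "absv c * (absv (f s) * wt s) \<le> absv c * nrm ?V f"
      using c0_le_nrm[OF f \<open>s \<in> S\<close>] by (intro mult_left_mono absv_nonneg)
    then show "absv ((c \<odot>\<^bsub>?V\<^esub> f) s) * wt s \<le> absv c * nrm ?V f"
      by (simp add: absv_mult mult.assoc)
  qed (simp add: absv_nonneg c0_nrm_nonneg f)
  assume g: "g \<in> carrier ?V"
  show "nrm ?V (f \<oplus>\<^bsub>?V\<^esub> g) \<le> max (nrm ?V f) (nrm ?V g)"
  proof (rule c0_nrm_le)
    fix s assume s: "s \<in> S"
    have "absv (f s + g s) * wt s \<le> max (absv (f s)) (absv (g s)) * wt s"
      using wt[OF s] absv_ultrametric by (intro mult_right_mono) auto
    then show "absv ((f \<oplus>\<^bsub>?V\<^esub> g) s) * wt s \<le> max (nrm ?V f) (nrm ?V g)"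
      using c0_le_nrm[OF f s] c0_le_nrm[OF g s] by (auto simp: max_def split: if_splits)
  qed (use c0_nrm_nonneg[OF f] in auto)
qed (auto simp: algebra_simps)

lemma c0_minus:
  assumes "f \<in> carrier (c0 S wt :: ('k::complete_nonarch_field, 's \<Rightarrow> 'k) nspace)" "g \<in> carrier (c0 S wt)"
  shows "f \<ominus>\<^bsub>c0 S wt\<^esub> g = (\<lambda>s. f s - g s)"
proof -
  interpret normed_sp "c0 S wt :: ('k, 's \<Rightarrow> 'k) nspace" by (rule c0_normed)
  show ?thesis
    using assms sm_neg[of g] by (simp add: a_minus_def flip: sm_neg)
qed

lemma c0_banach: "banach_sp (c0 S wt :: ('k::complete_nonarch_field, 's \<Rightarrow> 'k) nspace)" (is "banach_sp ?V")
proof -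
  interpret normed_sp ?V by (rule c0_normed)
  show ?thesis
  proof
    fix X :: "nat \<Rightarrow> 's \<Rightarrow> 'k"
    assume X: "\<And>n. X n \<in> carrier ?V"
      and cauchy: "\<And>e. e > 0 \<Longrightarrow> \<exists>N. \<forall>m\<ge>N. \<forall>n\<ge>N. nrm ?V (X m \<ominus>\<^bsub>?V\<^esub> X n) < e"
    have pt: "absv (X m s - X n s) * wt s \<le> nrm ?V (X m \<ominus>\<^bsub>?V\<^esub> X n)" if "s \<in> S" for m n s
      using c0_le_nrm[OF M.minus_closed[OF X[of m] X[of n]] that] X by (simp add: c0_minus)
    have "\<exists>x. (\<lambda>n. absv (X n s - x)) \<longlonglongrightarrow> 0" if s: "s \<in> S" for s
    proof (rule absv_complete, intro allI impI)
      fix e :: real assume "0 < e"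
      then have "0 < e * wt s" using wt[OF s] by simp
      then obtain N where N: "\<forall>m\<ge>N. \<forall>n\<ge>N. nrm ?V (X m \<ominus>\<^bsub>?V\<^esub> X n) < e * wt s"
        using cauchy by blast
      have "absv (X m s - X n s) * wt s < e * wt s" if "m \<ge> N" "n \<ge> N" for m n
        using N that pt[OF s, of m n] by force
      then have "absv (X m s - X n s) < e" if "m \<ge> N" "n \<ge> N" for m n
        using wt[OF s] that by (simp add: mult_less_cancel_right)
      then show "\<exists>N. \<forall>m\<ge>N. \<forall>n\<ge>N. absv (X m s - X n s) < e" by blast
    qed
    then obtain f0 where f0: "\<And>s. s \<in> S \<Longrightarrow> (\<lambda>n. absv (X n s - f0 s)) \<longlonglongrightarrow> 0"
      by metis
    define f where "f s = (if s \<in> S then f0 s else 0)" for s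
    \<comment> \<open>The Cauchy condition is uniform in \<open>s\<close>; letting \<open>m\<close>
      tend to infinity in the estimate between \<open>X n\<close> and \<open>X m\<close> keeps it
      uniform.\<close>
    have unif: "\<exists>N. \<forall>n\<ge>N. \<forall>s\<in>S. absv (X n s - f s) * wt s \<le> e" if e: "e > 0" for e
    proof -
      obtain N where N: "\<forall>m\<ge>N. \<forall>n\<ge>N. nrm ?V (X m \<ominus>\<^bsub>?V\<^esub> X n) < e"
        using cauchy e by blast
      have "absv (X n s - f s) * wt s \<le> e" if n: "n \<ge> N" and s: "s \<in> S" for n s
      proof -
        have "(\<lambda>m. max e (absv (X m s - f0 s) * wt s)) \<longlonglongrightarrow> max e (0 * wt s)"
          by (intro tendsto_max tendsto_const tendsto_mult_right f0 s)
        moreover have "absv (X n s - f s) * wt s \<le> max e (absv (X m s - f0 s) * wt s)" if "m \<ge> N" for m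
        proof -
          have "absv (X n s - f s) * wt s \<le> max (absv (X n s - X m s)) (absv (X m s - f0 s)) * wt s"
            using absv_ultrametric[of "X n s - X m s" "X m s - f0 s"] wt[OF s] s
            by (intro mult_right_mono) (auto simp: f_def)
          moreover have "absv (X n s - X m s) * wt s \<le> e"
            using pt[OF s, of n m] N n that by force
          ultimately show ?thesis by (auto simp: max_def split: if_splits)
        qed
        then have "\<exists>N. \<forall>m\<ge>N. absv (X n s - f s) * wt s \<le> max e (absv (X m s - f0 s) * wt s)"
          by blast
        ultimately have "absv (X n s - f s) * wt s \<le> max e (0 * wt s)"
          by (rule LIMSEQ_le_const)
        then show ?thesis using e by simp
      qed
      then show ?thesis by blast
    qed
    have f: "f \<in> carrier ?V"
      unfolding c0_carrier
    proof (intro conjI allI impI)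
      fix e :: real assume e: "e > 0"
      obtain N where N: "\<forall>n\<ge>N. \<forall>s\<in>S. absv (X n s - f s) * wt s \<le> e / 2"
        using unif[of "e / 2"] e by auto
      \<comment> \<open>The difference of \<open>X N\<close> and \<open>f\<close> contributes at
        most \<open>e / 2\<close>, so by the ultrametric inequality an entry of \<open>f\<close> of
        size at least \<open>e\<close> forces an entry of \<open>X N\<close> of that size.\<close>
      have "{s\<in>S. e \<le> absv (f s) * wt s} \<subseteq> {s\<in>S. e \<le> absv (X N s) * wt s}"
      proof safe
        fix s assume s: "s \<in> S" "e \<le> absv (f s) * wt s"
        have "absv (f s) * wt s \<le> max (absv (X N s)) (absv (X N s - f s)) * wt s"
          using absv_diff[of "X N s" "X N s - f s"] wt[of s] s by (intro mult_right_mono) auto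
        moreover have "absv (X N s - f s) * wt s \<le> e / 2" using N s by auto
        ultimately show "e \<le> absv (X N s) * wt s"
          using s e by (auto simp: max_def split: if_splits)
      qed
      moreover have "finite {s\<in>S. e \<le> absv (X N s) * wt s}"
        using X[of N] e by (auto simp: c0_carrier)
      ultimately show "finite {s\<in>S. e \<le> absv (f s) * wt s}"
        using finite_subset by blast
    qed (auto simp: f_def)
    have "(\<lambda>n. nrm ?V (X n \<ominus>\<^bsub>?V\<^esub> f)) \<longlonglongrightarrow> 0"
    proof (rule LIMSEQ_I)
      fix e :: real assume e: "e > 0"
      obtain N where N: "\<forall>n\<ge>N. \<forall>s\<in>S. absv (X n s - f s) * wt s \<le> e / 2"
        using unif[of "e / 2"] e by auto
      have "norm (nrm ?V (X n \<ominus>\<^bsub>?V\<^esub> f) - 0) < e" if "n \<ge> N" for n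
      proof -
        have "nrm ?V (X n \<ominus>\<^bsub>?V\<^esub> f) \<le> e / 2"
          using N that e X f by (intro c0_nrm_le) (auto simp: c0_minus)
        then show ?thesis using e X f by (simp add: nrm_nonneg)
      qed
      then show "\<exists>N. \<forall>n\<ge>N. norm (nrm ?V (X n \<ominus>\<^bsub>?V\<^esub> f) - 0) < e" by blast
    qed
    then show "\<exists>f\<in>carrier ?V. (\<lambda>n. nrm ?V (X n \<ominus>\<^bsub>?V\<^esub> f)) \<longlonglongrightarrow> 0"
      using f by blast
  qed
qed

text \<open>The image of \<open>f\<close> is the unconditional sum of the multiples of
  \<open>b s\<close> by \<open>f s\<close>. The bound on \<open>b\<close> makes this family null
  because the weighted entries of \<open>f\<close> are.\<close>

lemma c0_lift:
  fixes Z :: "('k::complete_nonarch_field, 'z) nspace"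
  assumes "banach_sp Z" and b: "\<And>s. s \<in> S \<Longrightarrow> b s \<in> carrier Z" "\<And>s. s \<in> S \<Longrightarrow> nrm Z (b s) \<le> C * wt s"
  shows "\<exists>h. bounded_lin (c0 S wt) Z h \<and> (\<forall>s\<in>S. h (single s) = b s)"
proof -
  interpret Z: banach_sp Z by fact
  let ?V = "c0 S wt :: ('k, 's \<Rightarrow> 'k) nspace"
  \<comment> \<open>The maximum with 1 makes the constant positive, so that \<open>e / D\<close> can
    serve as a threshold.\<close>
  define D where "D = max C 1"
  have D: "0 < D" "nrm Z (b s) \<le> D * wt s" if "s \<in> S" for s
  proof -
    have "C * wt s \<le> D * wt s" unfolding D_def using wt[OF that] by (intro mult_right_mono) auto
    then show "nrm Z (b s) \<le> D * wt s" using b(2)[OF that] by simp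
  qed (simp add: D_def)
  have D0: "0 < D" by (simp add: D_def)
  define g where "g f s = f s \<odot>\<^bsub>Z\<^esub> b s" for f s
  have g: "g f \<in> S \<rightarrow> carrier Z" for f
    using b by (auto simp: g_def)
  have gb: "nrm Z (g f s) \<le> D * (absv (f s) * wt s)" if "s \<in> S" for f s
    using mult_left_mono[OF D(2)[OF that] absv_nonneg[of "f s"]] b(1)[OF that]
    by (simp add: g_def Z.nrm_smult mult.left_commute)
  define h where "h f = (SOME z. Z.has_sm S (g f) z)" for f
  have h: "Z.has_sm S (g f) (h f)" if f: "f \<in> carrier ?V" for f
    unfolding h_def
  proof (rule someI_ex, rule Z.has_sm_exists[OF g])
    fix e :: real assume "e > 0"
    then have "finite {s\<in>S. e / D \<le> absv (f s) * wt s}"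
      using f D0 by (auto simp: c0_carrier)
    moreover have "{s\<in>S. e \<le> nrm Z (g f s)} \<subseteq> {s\<in>S. e / D \<le> absv (f s) * wt s}"
      using gb D0 by (auto simp: field_simps intro: order_trans)
    ultimately show "finite {s\<in>S. e \<le> nrm Z (g f s)}"
      using finite_subset by blast
  qed
  have hc: "h f \<in> carrier Z" if "f \<in> carrier ?V" for f
    using h[OF that] by (simp add: Z.has_sm_def)
  have "bounded_lin ?V Z h"
  proof (rule bounded_linI)
    fix f assume f: "f \<in> carrier ?V"
    show "h f \<in> carrier Z" by (rule hc[OF f])
    show "nrm Z (h f) \<le> D * nrm ?V f"
    proof (rule Z.has_sm_bound[OF g h[OF f]])
      fix s assume s: "s \<in> S"
      have "D * (absv (f s) * wt s) \<le> D * nrm ?V f"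
        using c0_le_nrm[OF f s] D0 by (intro mult_left_mono) auto
      then show "nrm Z (g f s) \<le> D * nrm ?V f" using gb[OF s, of f] by simp
    qed (use D0 c0_nrm_nonneg[OF f] in simp)
    fix c
    have "Z.has_sm S (g (c \<odot>\<^bsub>?V\<^esub> f)) (c \<odot>\<^bsub>Z\<^esub> h f)"
      by (rule Z.has_sm_cong[OF Z.has_sm_smult[OF g h[OF f]]])
        (use b in \<open>auto simp: g_def Z.sm_assoc\<close>)
    moreover have "Z.has_sm S (g (c \<odot>\<^bsub>?V\<^esub> f)) (h (c \<odot>\<^bsub>?V\<^esub> f))"
      using f by (intro h) (simp add: c0_smult_closed)
    ultimately show "h (c \<odot>\<^bsub>?V\<^esub> f) = c \<odot>\<^bsub>Z\<^esub> h f"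
      using Z.has_sm_unique[OF g] by blast
    fix f' assume f': "f' \<in> carrier ?V"
    have "Z.has_sm S (g (f \<oplus>\<^bsub>?V\<^esub> f')) (h f \<oplus>\<^bsub>Z\<^esub> h f')"
      by (rule Z.has_sm_cong[OF Z.has_sm_add[OF g g h[OF f] h[OF f']]])
        (use b in \<open>auto simp: g_def Z.sm_add\<close>)
    moreover have "Z.has_sm S (g (f \<oplus>\<^bsub>?V\<^esub> f')) (h (f \<oplus>\<^bsub>?V\<^esub> f'))"
      using f f' by (intro h) (simp add: c0_add_closed)
    ultimately show "h (f \<oplus>\<^bsub>?V\<^esub> f') = h f \<oplus>\<^bsub>Z\<^esub> h f'"
      using Z.has_sm_unique[OF g] by blast
  qed
  moreover have "h (single s) = b s" if s: "s \<in> S" for s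
  proof -
    have "Z.has_sm S (g (single s)) (b s)"
      by (rule Z.has_sm_cong[OF Z.has_sm_single[OF s b(1)[OF s]] _ g])
        (use b in \<open>auto simp: g_def single_def\<close>)
    then show ?thesis
      using Z.has_sm_unique[OF g] h[OF single_carrier[OF s]] by blast
  qed
  ultimately show ?thesis by blast
qed

text \<open>Cutting \<open>f\<close> at size \<open>e\<close> leaves a finite part, on which
  \<open>Q\<close> vanishes by linearity, and a rest of norm at most \<open>e\<close>.\<close>

lemma c0_dense:
  fixes Z :: "('k::complete_nonarch_field, 'z) nspace"
  assumes Z: "normed_sp Z" and Q: "bounded_lin (c0 S wt) Z Q"
    and 0: "\<And>s. s \<in> S \<Longrightarrow> Q (single s) = \<zero>\<^bsub>Z\<^esub>" and f: "f \<in> carrier (c0 S wt)"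
  shows "Q f = \<zero>\<^bsub>Z\<^esub>"
proof -
  let ?V = "c0 S wt :: ('k, 's \<Rightarrow> 'k) nspace"
  interpret Z: normed_sp Z by fact
  interpret V: normed_sp ?V by (rule c0_normed)
  obtain C where C: "0 \<le> C" "\<And>x. x \<in> carrier ?V \<Longrightarrow> nrm Z (Q x) \<le> C * nrm ?V x"
    using bounded_lin_bound[OF c0_normed Q] by metis
  have fin: "Q (\<lambda>s. if s \<in> T then f s else 0) = \<zero>\<^bsub>Z\<^esub>" if "finite T" "T \<subseteq> S" for T
    using that
  proof (induction T)
    case empty
    then show ?case using bounded_lin_0[OF c0_normed Z Q] by simp
  next
    case (insert t T)
    have c1: "(\<lambda>s. if s \<in> T then f s else 0) \<in> carrier ?V"
      using insert by (intro c0_finite_support[of T]) auto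
    have c2: "single t \<in> carrier ?V"
      using insert by (intro single_carrier) auto
    have "(\<lambda>s. if s \<in> insert t T then f s else 0) =
        f t \<odot>\<^bsub>?V\<^esub> single t \<oplus>\<^bsub>?V\<^esub> (\<lambda>s. if s \<in> T then f s else 0)"
      using insert by (auto simp: single_def fun_eq_iff)
    then have "Q (\<lambda>s. if s \<in> insert t T then f s else 0) =
        f t \<odot>\<^bsub>Z\<^esub> Q (single t) \<oplus>\<^bsub>Z\<^esub> Q (\<lambda>s. if s \<in> T then f s else 0)"
      using bounded_lin_add[OF Q V.sm_closed[OF c2] c1, of "f t"] bounded_lin_smult[OF Q c2, of "f t"] by simp
    then show ?case using insert 0 by simp
  qed
  show ?thesis
  proof (rule Z.zeroI_small)
    show "Q f \<in> carrier Z" by (rule bounded_lin_closed[OF Q f])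
    fix e :: real assume e: "e > 0"
    define T where "T = {s\<in>S. e \<le> absv (f s) * wt s}"
    have T: "finite T" "T \<subseteq> S" using f e by (auto simp: T_def c0_carrier)
    let ?a = "\<lambda>s. if s \<in> T then f s else 0" and ?b = "\<lambda>s. if s \<in> T then 0 else f s"
    have a: "?a \<in> carrier ?V" using T by (intro c0_finite_support[of T]) auto
    have b: "?b \<in> carrier ?V"
      by (rule c0_dominated[OF f]) (use f wt in \<open>auto simp: c0_carrier absv_nonneg less_imp_le\<close>)
    have "f = ?a \<oplus>\<^bsub>?V\<^esub> ?b" by auto
    then have "Q f = Q ?a \<oplus>\<^bsub>Z\<^esub> Q ?b"
      using bounded_lin_add[OF Q a b] by simp
    then have "Q f = Q ?b"
      using fin[OF T] bounded_lin_closed[OF Q b] by simp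
    moreover have "nrm ?V ?b \<le> e"
      using e by (intro c0_nrm_le) (auto simp: T_def)
    moreover have "nrm Z (Q ?b) \<le> C * nrm ?V ?b"
      by (rule C(2)[OF b])
    ultimately show "nrm Z (Q f) \<le> C * e"
      using mult_left_mono[OF \<open>nrm ?V ?b \<le> e\<close> C(1)] by simp
  qed
qed

end

section \<open>Quotients\<close>

locale closed_sub = normed_sp V
  for V :: "('k::complete_nonarch_field, 'v) nspace" (structure) +
  fixes N :: "'v set"
  assumes sub: "submodule N (kban :: ('k, 'k) nspace) V" and clo: "closed_set V N"

sublocale closed_sub \<subseteq> N: abelian_subgroup N V
  by (intro abelian_subgroupI3 additive_subgroupI M.abelian_group_axioms)
    (rule submodule.axioms(1)[OF sub])

context closed_sub
begin

lemma N_sm: "n \<in> N \<Longrightarrow> c \<odot> n \<in> N"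
  using submodule.smult_closed[OF sub, of c n] by simp

lemma coset_carrier: "x' \<in> N +> x \<Longrightarrow> x \<in> carrier V \<Longrightarrow> x' \<in> carrier V"
  using N.a_subset by (auto simp: a_r_coset_def')

lemma coset_self: "x \<in> carrier V \<Longrightarrow> x \<in> N +> x"
  by (rule N.a_rcos_self)

lemma coset_eq: "x' \<in> N +> x \<Longrightarrow> x \<in> carrier V \<Longrightarrow> N +> x' = N +> x"
  using N.a_repr_independence' by blast

lemma coset_zero: "N +> \<zero> = N"
  using M.a_coset_add_zero N.a_subset by blast

lemma coset_eq_N: "x \<in> carrier V \<Longrightarrow> N +> x = N \<longleftrightarrow> x \<in> N"
  using coset_self N.a_rcos_const by blast

lemma quot_simps [simp]:
  "carrier (quot V N) = (\<lambda>x. N +> x) ` carrier V" "zero (quot V N) = N"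
  by (auto simp: quot_def A_RCOSETS_def')

lemma quot_add:
  "x \<in> carrier V \<Longrightarrow> y \<in> carrier V \<Longrightarrow> (N +> x) \<oplus>\<^bsub>quot V N\<^esub> (N +> y) = N +> (x \<oplus> y)"
  by (simp add: quot_def N.a_rcos_sum)

text \<open>In \<open>quot\<close> the scalar multiple of a coset is a union over all its
  representatives. It collapses to one coset because \<open>N\<close> is stable under
  scalars.\<close>

lemma quot_smult:
  assumes "x \<in> carrier V"
  shows "c \<odot>\<^bsub>quot V N\<^esub> (N +> x) = N +> (c \<odot> x)"
proof -
  have "N +> (c \<odot> x') = N +> (c \<odot> x)" if x': "x' \<in> N +> x" for x'
  proof -
    obtain n where n: "n \<in> N" "x' = n \<oplus> x"
      using x' by (auto simp: a_r_coset_def')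
    then have "c \<odot> x' = c \<odot> n \<oplus> c \<odot> x"
      using assms N.a_Hcarr sm_r_add by auto
    then have "c \<odot> x' \<in> N +> (c \<odot> x)"
      using N_sm[OF n(1)] by (auto simp: a_r_coset_def')
    then show ?thesis using coset_eq assms by simp
  qed
  then have "(\<Union>x'\<in>N +> x. N +> (c \<odot> x')) = (\<Union>x'\<in>N +> x. N +> (c \<odot> x))"
    by (intro SUP_cong refl)
  also have "\<dots> = N +> (c \<odot> x)"
    using coset_self[OF assms] by blast
  finally show ?thesis
    by (simp add: quot_def)
qed

lemma quot_nrm: "nrm (quot V N) X = Inf (nrm V ` X)"
  by (simp add: quot_def)

lemma quot_bdd: "x \<in> carrier V \<Longrightarrow> bdd_below (nrm V ` (N +> x))"
  by (rule bdd_belowI[of _ 0]) (auto dest: coset_carrier nrm_nonneg)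

lemma quot_nrm_le: "x \<in> carrier V \<Longrightarrow> x' \<in> N +> x \<Longrightarrow> nrm (quot V N) (N +> x) \<le> nrm V x'"
  unfolding quot_nrm by (intro cInf_lower quot_bdd) auto

lemma quot_nrm_nonneg: "x \<in> carrier V \<Longrightarrow> 0 \<le> nrm (quot V N) (N +> x)"
  unfolding quot_nrm using coset_self[of x] coset_carrier nrm_nonneg by (intro cInf_greatest) auto

text \<open>The infimum defining the quotient norm need not be attained, so representatives are only
  nearly minimal and the bounds derived from them carry an \<open>e\<close>.\<close>

lemma quot_approx:
  assumes "x \<in> carrier V" "e > 0"
  obtains x' where "x' \<in> carrier V" "N +> x' = N +> x" "nrm V x' < nrm (quot V N) (N +> x) + e"
proof -
  have "Inf (nrm V ` (N +> x)) < nrm (quot V N) (N +> x) + e"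
    using assms by (simp add: quot_nrm)
  then obtain y where "y \<in> N +> x" "nrm V y < nrm (quot V N) (N +> x) + e"
    using cInf_less_iff[OF _ quot_bdd[OF assms(1)]] coset_self[OF assms(1)] by fastforce
  then show thesis
    using that coset_carrier coset_eq assms(1) by blast
qed

lemma quot_nrm_self: "x \<in> carrier V \<Longrightarrow> nrm (quot V N) (N +> x) \<le> nrm V x"
  using quot_nrm_le coset_self by blast

lemma quot_normed: "normed_sp (quot V N)"
proof (rule normed_spI)
  let ?Q = "quot V N"
  show "abelian_group ?Q"
  proof (rule abelian_groupI)
    fix X assume "X \<in> carrier ?Q"
    then obtain x where "x \<in> carrier V" "X = N +> x" by auto
    then show "\<exists>Y\<in>carrier ?Q. Y \<oplus>\<^bsub>?Q\<^esub> X = \<zero>\<^bsub>?Q\<^esub>"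
      by (intro bexI[of _ "N +> (\<ominus> x)"]) (auto simp: quot_add M.l_neg coset_zero)
    show "\<zero>\<^bsub>?Q\<^esub> \<oplus>\<^bsub>?Q\<^esub> X = X"
      using quot_add[of \<zero> x] coset_zero \<open>x \<in> carrier V\<close> \<open>X = N +> x\<close> by simp
  next
    show "\<zero>\<^bsub>?Q\<^esub> \<in> carrier ?Q"
      using coset_zero by force
  qed (auto simp: quot_add M.a_ac)
  fix X c assume "X \<in> carrier ?Q"
  then obtain x where x: "x \<in> carrier V" "X = N +> x" by auto
  show "c \<odot>\<^bsub>?Q\<^esub> X \<in> carrier ?Q" using x by (simp add: quot_smult)
  show "0 \<le> nrm ?Q X" using x quot_nrm_nonneg by simp
  \<comment> \<open>Representatives \<open>Y n\<close> with norms tending to 0 exist. The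
    differences of \<open>x\<close> and \<open>Y n\<close> lie in \<open>N\<close> and tend to
    \<open>x\<close>, so \<open>x\<close> lies in the closed set \<open>N\<close>.\<close>
  show "X = \<zero>\<^bsub>?Q\<^esub>" if 0: "nrm ?Q X = 0"
  proof -
    have "\<exists>x'. x' \<in> carrier V \<and> N +> x' = N +> x \<and> nrm V x' < 1 / real (Suc n)" for n
      using quot_approx[OF x(1), of "1 / real (Suc n)"] 0 x by force
    then obtain Y where Y: "\<And>n. Y n \<in> carrier V" "\<And>n. N +> Y n = N +> x" "\<And>n. nrm V (Y n) < 1 / real (Suc n)"
      by metis
    have "x \<ominus> Y n \<in> N" for n
    proof -
      have "Y n \<in> N +> x" using Y(1,2) coset_self by blast
      then obtain m where "m \<in> N" "Y n = m \<oplus> x" by (auto simp: a_r_coset_def')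
      then have "x \<ominus> Y n = \<ominus> m"
        using x(1) N.a_Hcarr by (simp add: a_minus_def M.minus_add M.a_lcomm[of x "\<ominus> m"] M.r_neg)
      then show ?thesis using \<open>m \<in> N\<close> by simp
    qed
    moreover have "(\<lambda>n. nrm V ((x \<ominus> Y n) \<ominus> x)) \<longlonglongrightarrow> 0"
    proof -
      have "(x \<ominus> Y n) \<ominus> x = \<ominus> Y n" for n
        using x(1) Y(1)[of n] by (simp add: a_minus_def M.a_comm[of x "\<ominus> Y n"] M.a_assoc M.r_neg)
      then have "nrm V ((x \<ominus> Y n) \<ominus> x) = nrm V (Y n)" for n
        using Y(1) by simp
      moreover have "(\<lambda>n. nrm V (Y n)) \<longlonglongrightarrow> 0"
        by (rule tendsto_sandwich[OF _ _ tendsto_const LIMSEQ_inverse_real_of_nat])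
          (use Y nrm_nonneg in \<open>auto simp: inverse_eq_divide less_imp_le\<close>)
      ultimately show ?thesis by simp
    qed
    ultimately have "x \<in> N"
      using closed_setD[OF clo, of "\<lambda>n. x \<ominus> Y n" x] x(1) by simp
    then show ?thesis using x by (simp add: coset_eq_N)
  qed
  have "nrm ?Q (N +> (c \<odot> x)) \<le> absv c * nrm ?Q (N +> x)"
  proof (rule field_le_epsilon)
    fix e :: real assume e: "e > 0"
    have pos: "absv c + 1 > 0" using absv_nonneg[of c] by simp
    obtain x' where x': "x' \<in> carrier V" "N +> x' = N +> x" "nrm V x' < nrm ?Q (N +> x) + e / (absv c + 1)"
      using quot_approx[OF x(1), of "e / (absv c + 1)"] e pos by auto
    have "N +> (c \<odot> x) = N +> (c \<odot> x')"
      using quot_smult[OF x(1)] quot_smult[OF x'(1)] x'(2) by metis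
    then have "nrm ?Q (N +> (c \<odot> x)) \<le> absv c * nrm V x'"
      using quot_nrm_self[of "c \<odot> x'"] x' by (simp add: nrm_smult)
    also have "\<dots> \<le> absv c * (nrm ?Q (N +> x) + e / (absv c + 1))"
      using x'(3) by (intro mult_left_mono absv_nonneg) auto
    also have "\<dots> \<le> absv c * nrm ?Q (N +> x) + e"
      using pos e absv_nonneg[of c] by (simp add: field_simps)
    finally show "nrm ?Q (N +> (c \<odot> x)) \<le> absv c * nrm ?Q (N +> x) + e" .
  qed
  then show "nrm ?Q (c \<odot>\<^bsub>?Q\<^esub> X) \<le> absv c * nrm ?Q X"
    using x by (simp add: quot_smult)
  fix Y assume "Y \<in> carrier ?Q"
  then obtain y where y: "y \<in> carrier V" "Y = N +> y" by auto
  show "nrm ?Q (X \<oplus>\<^bsub>?Q\<^esub> Y) \<le> max (nrm ?Q X) (nrm ?Q Y)"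
  proof (rule field_le_epsilon)
    fix e :: real assume e: "e > 0"
    obtain x' where x': "x' \<in> carrier V" "N +> x' = N +> x" "nrm V x' < nrm ?Q (N +> x) + e"
      using quot_approx[OF x(1) e] by blast
    obtain y' where y': "y' \<in> carrier V" "N +> y' = N +> y" "nrm V y' < nrm ?Q (N +> y) + e"
      using quot_approx[OF y(1) e] by blast
    have "X \<oplus>\<^bsub>?Q\<^esub> Y = N +> (x' \<oplus> y')"
      using quot_add[OF x'(1) y'(1)] x y x' y' by simp
    then have "nrm ?Q (X \<oplus>\<^bsub>?Q\<^esub> Y) \<le> nrm V (x' \<oplus> y')"
      using quot_nrm_self x' y' by simp
    also have "\<dots> \<le> max (nrm V x') (nrm V y')" using x' y' by (intro nrm_add)
    finally show "nrm ?Q (X \<oplus>\<^bsub>?Q\<^esub> Y) \<le> max (nrm ?Q X) (nrm ?Q Y) + e"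
      using x' y' x y by auto
  qed
qed (auto simp: quot_add quot_smult sm_add sm_r_add sm_assoc)

lemma quot_map: "bounded_lin V (quot V N) (\<lambda>x. N +> x)"
  by (rule bounded_linI[where C = 1]) (auto simp: quot_add quot_smult quot_nrm_self)

text \<open>\<open>f\<close> is constant on cosets, so any representative serves to define
  \<open>h\<close>; evaluation at nearly minimal representatives shows that \<open>h\<close>
  inherits the bound \<open>C\<close>.\<close>

lemma quot_lift:
  assumes Z: "normed_sp Z" and f: "bounded_lin V Z f" and N0: "\<And>n. n \<in> N \<Longrightarrow> f n = \<zero>\<^bsub>Z\<^esub>"
  shows "\<exists>h. bounded_lin (quot V N) Z h \<and> (\<forall>x\<in>carrier V. h (N +> x) = f x)"
proof -
  interpret Z: normed_sp Z by fact
  obtain C where C: "0 \<le> C" "\<And>x. x \<in> carrier V \<Longrightarrow> nrm Z (f x) \<le> C * nrm V x"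
    using bounded_lin_bound[OF normed_sp_self f] by metis
  define h where "h X = f (SOME x. x \<in> X)" for X
  have eq: "f x' = f x" if "x' \<in> N +> x" "x \<in> carrier V" for x x'
  proof -
    obtain n where n: "n \<in> N" "x' = n \<oplus> x" using \<open>x' \<in> N +> x\<close> by (auto simp: a_r_coset_def')
    then have "f x' = f n \<oplus>\<^bsub>Z\<^esub> f x"
      using that N.a_Hcarr bounded_lin_add[OF f] by simp
    then show ?thesis
      using N0[OF n(1)] bounded_lin_closed[OF f that(2)] by simp
  qed
  have h: "h (N +> x) = f x" if "x \<in> carrier V" for x
    unfolding h_def using someI[of "\<lambda>y. y \<in> N +> x", OF coset_self[OF that]] eq that by blast
  have "bounded_lin (quot V N) Z h"
  proof (rule bounded_linI)
    fix X assume "X \<in> carrier (quot V N)"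
    then obtain x where x: "x \<in> carrier V" "X = N +> x" by auto
    show "h X \<in> carrier Z" using x h bounded_lin_closed[OF f] by simp
    show "h (c \<odot>\<^bsub>quot V N\<^esub> X) = c \<odot>\<^bsub>Z\<^esub> h X" for c
      using x h by (simp add: quot_smult bounded_lin_smult[OF f])
    show "nrm Z (h X) \<le> C * nrm (quot V N) X"
    proof (rule field_le_epsilon)
      fix e :: real assume e: "e > 0"
      obtain x' where x': "x' \<in> carrier V" "N +> x' = N +> x" "nrm V x' < nrm (quot V N) (N +> x) + e / (C + 1)"
        using quot_approx[OF x(1), of "e / (C + 1)"] e C by auto
      have "h X = f x'" using x x' h by metis
      then have "nrm Z (h X) \<le> C * nrm V x'" using C(2) x' by simp
      also have "\<dots> \<le> C * (nrm (quot V N) X + e / (C + 1))"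
        using x'(3) x C by (intro mult_left_mono) auto
      also have "\<dots> \<le> C * nrm (quot V N) X + e"
        using C e by (simp add: field_simps)
      finally show "nrm Z (h X) \<le> C * nrm (quot V N) X + e" .
    qed
    fix Y assume "Y \<in> carrier (quot V N)"
    then obtain y where y: "y \<in> carrier V" "Y = N +> y" by auto
    show "h (X \<oplus>\<^bsub>quot V N\<^esub> Y) = h X \<oplus>\<^bsub>Z\<^esub> h Y"
      using x y h by (simp add: quot_add bounded_lin_add[OF f])
  qed
  then show ?thesis using h by blast
qed

end

text \<open>In an ultrametric space the lifts of the consecutive differences can be summed directly,
  without passing to a subsequence.\<close>

lemma quot_banach:
  assumes V: "banach_sp V" and "closed_sub V N"
  shows "banach_sp (quot V N)"
proof -
  interpret V: banach_sp V by fact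
  interpret closed_sub V N by fact
  let ?Q = "quot V N"
  interpret Q: normed_sp ?Q by (rule quot_normed)
  show ?thesis
  proof
    fix X :: "nat \<Rightarrow> _"
    assume X: "\<And>n. X n \<in> carrier ?Q"
      and cauchy: "\<And>e. e > 0 \<Longrightarrow> \<exists>K. \<forall>m\<ge>K. \<forall>n\<ge>K. nrm ?Q (X m \<ominus>\<^bsub>?Q\<^esub> X n) < e"
    \<comment> \<open>The differences are lifted within 1/(n+1) of their quotient norms, so the
      lifts still tend to 0.\<close>
    have "\<exists>d. d \<in> carrier V \<and> N +>\<^bsub>V\<^esub> d = X (Suc n) \<ominus>\<^bsub>?Q\<^esub> X n \<and>
        nrm V d < nrm ?Q (X (Suc n) \<ominus>\<^bsub>?Q\<^esub> X n) + 1 / real (Suc n)" for n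
    proof -
      have "X (Suc n) \<ominus>\<^bsub>?Q\<^esub> X n \<in> carrier ?Q" using X by (intro Q.minus_closed)
      then obtain x where "x \<in> carrier V" "X (Suc n) \<ominus>\<^bsub>?Q\<^esub> X n = N +>\<^bsub>V\<^esub> x" by auto
      then show ?thesis using quot_approx[of x "1 / real (Suc n)"] by (metis divide_pos_pos of_nat_0_less_iff zero_less_Suc zero_less_one)
    qed
    then obtain d where d: "\<And>n. d n \<in> carrier V" "\<And>n. N +>\<^bsub>V\<^esub> d n = X (Suc n) \<ominus>\<^bsub>?Q\<^esub> X n"
        "\<And>n. nrm V (d n) < nrm ?Q (X (Suc n) \<ominus>\<^bsub>?Q\<^esub> X n) + 1 / real (Suc n)"
      by metis
    obtain x0 where x0: "x0 \<in> carrier V" "X 0 = N +>\<^bsub>V\<^esub> x0" using X[of 0] by auto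
    define x where "x = rec_nat x0 (\<lambda>n y. y \<oplus>\<^bsub>V\<^esub> d n)"
    have x_Suc: "x (Suc n) = x n \<oplus>\<^bsub>V\<^esub> d n" and x_0: "x 0 = x0" for n by (simp_all add: x_def)
    have xc: "x n \<in> carrier V" for n
      by (induction n) (auto simp: x_Suc x_0 x0 d)
    have xX: "N +>\<^bsub>V\<^esub> x n = X n" for n
    proof (induction n)
      case (Suc n)
      have "N +>\<^bsub>V\<^esub> x (Suc n) = X n \<oplus>\<^bsub>?Q\<^esub> (X (Suc n) \<ominus>\<^bsub>?Q\<^esub> X n)"
        using quot_add[OF xc[of n] d(1)[of n]] Suc d(2)[of n] by (simp add: x_Suc)
      then show ?case
        using Q.add_diff_cancel[OF X[of n] X[of "Suc n"]] by simp
    qed (use x0 x_0 in simp)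
    have dlim: "\<exists>K. \<forall>n\<ge>K. nrm V (d n) < e" if e: "e > 0" for e
    proof -
      obtain K where K: "\<forall>m\<ge>K. \<forall>n\<ge>K. nrm ?Q (X m \<ominus>\<^bsub>?Q\<^esub> X n) < e / 2"
        using cauchy[of "e / 2"] e by auto
      obtain L where L: "1 / real (Suc L) < e / 2"
        using nat_approx_posE[of "e / 2"] e by auto
      have "nrm V (d n) < e" if "n \<ge> max K L" for n
      proof -
        have "1 / real (Suc n) \<le> 1 / real (Suc L)"
          using that by (intro divide_left_mono) auto
        moreover have "nrm ?Q (X (Suc n) \<ominus>\<^bsub>?Q\<^esub> X n) < e / 2"
          using K that by auto
        ultimately show ?thesis using d(3)[of n] L by linarith
      qed
      then show ?thesis by blast
    qed
    have "\<exists>y\<in>carrier V. (\<lambda>n. nrm V (x n \<ominus>\<^bsub>V\<^esub> y)) \<longlonglongrightarrow> 0"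
    proof (rule V.complete[OF xc])
      fix e :: real assume e: "e > 0"
      obtain K where K: "\<forall>n\<ge>K. nrm V (d n) < e" using dlim[OF e] by blast
      \<comment> \<open>The difference telescopes into terms \<open>d\<close>, all below
        \<open>e\<close> from index \<open>K\<close> on, and the ultrametric inequality does not let
        them accumulate.\<close>
      have step: "nrm V (x (K + n) \<ominus>\<^bsub>V\<^esub> x K) < e" for n
      proof (induction n)
        case 0
        then show ?case using e xc by (simp add: a_minus_def V.M.r_neg)
      next
        case (Suc n)
        have "x (K + Suc n) \<ominus>\<^bsub>V\<^esub> x K = (x (K + n) \<ominus>\<^bsub>V\<^esub> x K) \<oplus>\<^bsub>V\<^esub> d (K + n)"
          using xc d(1) by (simp add: x_Suc a_minus_def V.M.a_ac)
        then show ?case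
          using V.nrm_add[of "x (K + n) \<ominus>\<^bsub>V\<^esub> x K" "d (K + n)"] Suc K xc d(1)
          by (smt (verit) V.M.minus_closed le_add1)
      qed
      have "nrm V (x m \<ominus>\<^bsub>V\<^esub> x n) < e" if "m \<ge> K" "n \<ge> K" for m n
      proof -
        have "nrm V (x m \<ominus>\<^bsub>V\<^esub> x n) \<le> max (nrm V (x m \<ominus>\<^bsub>V\<^esub> x K)) (nrm V (x K \<ominus>\<^bsub>V\<^esub> x n))"
          by (intro V.nrm_tri xc)
        moreover have "nrm V (x K \<ominus>\<^bsub>V\<^esub> x n) < e"
          using step[of "n - K"] that V.nrm_diff_commute[OF xc xc, of K n] by simp
        ultimately show ?thesis
          using step[of "m - K"] that by simp
      qed
      then show "\<exists>K. \<forall>m\<ge>K. \<forall>n\<ge>K. nrm V (x m \<ominus>\<^bsub>V\<^esub> x n) < e" by blast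
    qed
    then obtain y where y: "y \<in> carrier V" "(\<lambda>n. nrm V (x n \<ominus>\<^bsub>V\<^esub> y)) \<longlonglongrightarrow> 0" by blast
    have diff: "X n \<ominus>\<^bsub>?Q\<^esub> (N +>\<^bsub>V\<^esub> y) = N +>\<^bsub>V\<^esub> (x n \<ominus>\<^bsub>V\<^esub> y)" for n
      using bounded_lin_minus[OF V.normed_sp_self quot_normed quot_map xc y(1)] xX by simp
    have "(\<lambda>n. nrm ?Q (X n \<ominus>\<^bsub>?Q\<^esub> (N +>\<^bsub>V\<^esub> y))) \<longlonglongrightarrow> 0"
      by (rule tendsto_sandwich[OF _ _ tendsto_const y(2)])
        (use xc y(1) in \<open>auto simp: diff quot_nrm_nonneg quot_nrm_self\<close>)
    then show "\<exists>Y\<in>carrier ?Q. (\<lambda>n. nrm ?Q (X n \<ominus>\<^bsub>?Q\<^esub> Y)) \<longlonglongrightarrow> 0"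
      using y(1) by force
  qed
qed

section \<open>Completed tensor products\<close>

lemma (in normed_sp) submodule_Inter:
  assumes "\<F> \<noteq> {}" "\<And>S. S \<in> \<F> \<Longrightarrow> submodule S (kban :: ('k, 'k) nspace) V"
  shows "submodule (\<Inter>\<F>) (kban :: ('k, 'k) nspace) V"
proof -
  note E = submoduleE[OF assms(2)]
  show ?thesis
  proof (rule submoduleI)
    show "\<Inter>\<F> \<subseteq> carrier V" using assms(1) E(1) by blast
    show "\<zero> \<in> \<Inter>\<F>"
      using assms(2) submodule.axioms(1) subgroup.one_closed by force
    fix x y c assume x: "x \<in> \<Inter>\<F>" and y: "y \<in> \<Inter>\<F>"
    show "\<ominus> x \<in> \<Inter>\<F>" using E(3) x by auto
    show "x \<oplus> y \<in> \<Inter>\<F>" using E(5) x y by auto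
    show "c \<odot> x \<in> \<Inter>\<F>" using E(4) x by auto
  qed
qed

lemma closed_set_Inter:
  assumes "\<F> \<noteq> {}" "\<And>S. S \<in> \<F> \<Longrightarrow> closed_set V S"
  shows "closed_set V (\<Inter>\<F>)"
proof (rule closed_setI)
  show "\<Inter>\<F> \<subseteq> carrier V"
    using assms by (auto simp: closed_set_def)
  fix X x
  assume X: "\<And>n::nat. X n \<in> \<Inter>\<F>" "x \<in> carrier V" "(\<lambda>n. nrm V (X n \<ominus>\<^bsub>V\<^esub> x)) \<longlonglongrightarrow> 0"
  show "x \<in> \<Inter>\<F>"
  proof
    fix S assume "S \<in> \<F>"
    then show "x \<in> S"
      using closed_setD[OF assms(2) _ X(2,3)] X(1) by blast
  qed
qed

lemma closed_set_carrier: "closed_set V (carrier V)"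
  by (auto simp: closed_set_def)

lemma closed_span_sub:
  assumes "normed_sp V" "G \<subseteq> carrier V"
  shows "closed_sub V (closed_span V G)"
proof -
  interpret normed_sp V by fact
  have ne: "carrier V \<in> {S. submodule S kban V \<and> closed_set V S \<and> G \<subseteq> S}"
    using submodule_self closed_set_carrier assms(2) by auto
  show ?thesis
    unfolding closed_sub_def closed_sub_axioms_def closed_span_def
    using ne by (intro conjI normed_sp_self submodule_Inter closed_set_Inter) auto
qed

lemma closed_span_superset: "G \<subseteq> closed_span V G"
  by (auto simp: closed_span_def)

lemma closed_span_least:
  assumes "submodule S (kban :: ('k::complete_nonarch_field, 'k) nspace) V" "closed_set V S" "G \<subseteq> S"
  shows "closed_span V G \<subseteq> S"
  using assms by (auto simp: closed_span_def)

locale normed_pair = V: normed_sp V + W: normed_sp W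
  for V :: "('k::complete_nonarch_field, 'v) nspace" and W :: "('k, 'w) nspace"
begin

abbreviation (input) "TF \<equiv> tens_free V W"
abbreviation (input) "TN \<equiv> closed_span (tens_free V W) (tens_rel V W)"

text \<open>This is what leaving out symbols with a zero entry achieves; positive weights make the
  norm of \<open>TF\<close> definite.\<close>

lemma wt_pos:
  assumes "p \<in> (carrier V - {\<zero>\<^bsub>V\<^esub>}) \<times> (carrier W - {\<zero>\<^bsub>W\<^esub>})"
  shows "0 < (\<lambda>(v, w). nrm V v * nrm W w) p"
proof -
  obtain v w where p: "p = (v, w)" by fastforce
  then have "0 < nrm V v" "0 < nrm W w"
    using assms V.nrm_nonneg[of v] V.nrm_eq_0_iff[of v] W.nrm_nonneg[of w] W.nrm_eq_0_iff[of w] by auto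
  then show ?thesis using p by simp
qed

lemma TF_banach: "banach_sp TF"
  unfolding tens_free_def by (rule c0_banach[OF wt_pos])

lemma TF_normed: "normed_sp TF"
  using TF_banach banach_sp.axioms(1) by blast

lemma TF_simps:
  "zero TF = (\<lambda>_. 0)" "add TF = (\<lambda>f g s. f s + g s)" "smult TF = (\<lambda>c f s. c * f s)"
  by (simp_all add: tens_free_def)

lemma TF_minus: "f \<in> carrier TF \<Longrightarrow> g \<in> carrier TF \<Longrightarrow> f \<ominus>\<^bsub>TF\<^esub> g = (\<lambda>s. f s - g s)"
  unfolding tens_free_def by (rule c0_minus[OF wt_pos])

lemma symb_carrier: "v \<in> carrier V \<Longrightarrow> w \<in> carrier W \<Longrightarrow> tens_symb V W v w \<in> carrier TF"
  unfolding tens_symb_def tens_free_def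
  by (cases "v = \<zero>\<^bsub>V\<^esub> \<or> w = \<zero>\<^bsub>W\<^esub>") (simp add: c0_finite_support[of "{}"], simp add: single_carrier)

lemma tens_relI:
  "\<lbrakk>v \<in> carrier V; v' \<in> carrier V; w \<in> carrier W\<rbrakk> \<Longrightarrow>
    (\<lambda>p. tens_symb V W (v \<oplus>\<^bsub>V\<^esub> v') w p - tens_symb V W v w p - tens_symb V W v' w p) \<in> tens_rel V W"
  "\<lbrakk>v \<in> carrier V; w \<in> carrier W; w' \<in> carrier W\<rbrakk> \<Longrightarrow>
    (\<lambda>p. tens_symb V W v (w \<oplus>\<^bsub>W\<^esub> w') p - tens_symb V W v w p - tens_symb V W v w' p) \<in> tens_rel V W"
  "\<lbrakk>v \<in> carrier V; w \<in> carrier W\<rbrakk> \<Longrightarrow>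
    (\<lambda>p. tens_symb V W (c \<odot>\<^bsub>V\<^esub> v) w p - c * tens_symb V W v w p) \<in> tens_rel V W"
  "\<lbrakk>v \<in> carrier V; w \<in> carrier W\<rbrakk> \<Longrightarrow>
    (\<lambda>p. tens_symb V W v (c \<odot>\<^bsub>W\<^esub> w) p - c * tens_symb V W v w p) \<in> tens_rel V W"
  unfolding tens_rel_def
     apply (rule UnI1, rule UnI1, rule UnI1, rule CollectI, (rule exI)+, intro conjI, rule refl, assumption+)
    apply (rule UnI1, rule UnI1, rule UnI2, rule CollectI, (rule exI)+, intro conjI, rule refl, assumption+)
   apply (rule UnI1, rule UnI2, rule CollectI, (rule exI)+, intro conjI, rule refl, assumption+)
  apply (rule UnI2, rule CollectI, (rule exI)+, intro conjI, rule refl, assumption+)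
  done

lemma rel_carrier: "tens_rel V W \<subseteq> carrier TF"
proof -
  interpret TF: normed_sp TF by (rule TF_normed)
  have d: "(\<lambda>p. f p - g p) \<in> carrier TF" if "f \<in> carrier TF" "g \<in> carrier TF" for f g
    using TF_minus[OF that] TF.minus_closed[OF that] by simp
  have m: "(\<lambda>p. c * f p) \<in> carrier TF" if "f \<in> carrier TF" for f c
    using TF.sm_closed[OF that] by (simp add: TF_simps)
  show ?thesis
    unfolding tens_rel_def by (auto intro!: d m symb_carrier)
qed

lemma TN_sub: "closed_sub TF TN"
  by (rule closed_span_sub[OF TF_normed rel_carrier])

text \<open>Completeness comes from the field through the free space \<open>TF\<close>, so it holds
  for factors that are merely normed.\<close>

lemma tensor_banach: "banach_sp (tensor V W)"
  unfolding tensor_def by (rule quot_banach[OF TF_banach TN_sub])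

lemma tensor_normed: "normed_sp (tensor V W)"
  using tensor_banach banach_sp.axioms(1) by blast

lemma tens_closed [simp]: "v \<in> carrier V \<Longrightarrow> w \<in> carrier W \<Longrightarrow> tens V W v w \<in> carrier (tensor V W)"
  using closed_sub.quot_simps(1)[OF TN_sub] symb_carrier by (auto simp: tensor_def tens_def)

lemma tensor_cases:
  assumes "X \<in> carrier (tensor V W)"
  obtains f where "f \<in> carrier TF" "X = TN +>\<^bsub>TF\<^esub> f"
  using assms closed_sub.quot_simps(1)[OF TN_sub] by (auto simp: tensor_def)

text \<open>Additivity in either variable is an instance. Adding the sum of \<open>g\<close> and
  \<open>h\<close> to the relation, an element of \<open>TN\<close>, places \<open>f\<close> in the
  coset of that sum.\<close>

lemma tens_rel_add:
  assumes "f \<in> carrier TF" "g \<in> carrier TF" "h \<in> carrier TF" "(\<lambda>p. f p - g p - h p) \<in> tens_rel V W"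
  shows "TN +>\<^bsub>TF\<^esub> f = (TN +>\<^bsub>TF\<^esub> g) \<oplus>\<^bsub>quot TF TN\<^esub> (TN +>\<^bsub>TF\<^esub> h)"
proof -
  interpret N: closed_sub TF TN by (rule TN_sub)
  note gh = N.M.a_closed[OF assms(2,3)]
  have "(\<lambda>p. f p - g p - h p) \<in> TN" by (rule subsetD[OF closed_span_superset assms(4)])
  then have "(\<lambda>p. f p - g p - h p) \<oplus>\<^bsub>TF\<^esub> (g \<oplus>\<^bsub>TF\<^esub> h) \<in> TN +>\<^bsub>TF\<^esub> (g \<oplus>\<^bsub>TF\<^esub> h)"
    by (rule N.M.a_rcosI[OF _ N.N.a_subset gh])
  then have "f \<in> TN +>\<^bsub>TF\<^esub> (g \<oplus>\<^bsub>TF\<^esub> h)" by (simp add: TF_simps)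
  then show ?thesis using N.coset_eq[OF _ gh] N.quot_add[OF assms(2,3)] by simp
qed

lemma tens_rel_smult:
  assumes "f \<in> carrier TF" "g \<in> carrier TF" "(\<lambda>p. f p - c * g p) \<in> tens_rel V W"
  shows "TN +>\<^bsub>TF\<^esub> f = c \<odot>\<^bsub>quot TF TN\<^esub> (TN +>\<^bsub>TF\<^esub> g)"
proof -
  interpret N: closed_sub TF TN by (rule TN_sub)
  note cg = N.sm_closed[OF assms(2), of c]
  have "(\<lambda>p. f p - c * g p) \<in> TN" by (rule subsetD[OF closed_span_superset assms(3)])
  then have "(\<lambda>p. f p - c * g p) \<oplus>\<^bsub>TF\<^esub> (c \<odot>\<^bsub>TF\<^esub> g) \<in> TN +>\<^bsub>TF\<^esub> (c \<odot>\<^bsub>TF\<^esub> g)"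
    by (rule N.M.a_rcosI[OF _ N.N.a_subset cg])
  then have "f \<in> TN +>\<^bsub>TF\<^esub> (c \<odot>\<^bsub>TF\<^esub> g)" by (simp add: TF_simps)
  then show ?thesis using N.coset_eq[OF _ cg] N.quot_smult[OF assms(2)] by simp
qed

lemma tens_add_left:
  "\<lbrakk>v \<in> carrier V; v' \<in> carrier V; w \<in> carrier W\<rbrakk> \<Longrightarrow>
    tens V W (v \<oplus>\<^bsub>V\<^esub> v') w = tens V W v w \<oplus>\<^bsub>tensor V W\<^esub> tens V W v' w"
  unfolding tens_def tensor_def by (intro tens_rel_add tens_relI symb_carrier V.M.a_closed)

lemma tens_add_right:
  "\<lbrakk>v \<in> carrier V; w \<in> carrier W; w' \<in> carrier W\<rbrakk> \<Longrightarrow>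
    tens V W v (w \<oplus>\<^bsub>W\<^esub> w') = tens V W v w \<oplus>\<^bsub>tensor V W\<^esub> tens V W v w'"
  unfolding tens_def tensor_def by (intro tens_rel_add tens_relI symb_carrier W.M.a_closed)

lemma tens_smult_left:
  "\<lbrakk>v \<in> carrier V; w \<in> carrier W\<rbrakk> \<Longrightarrow>
    tens V W (c \<odot>\<^bsub>V\<^esub> v) w = c \<odot>\<^bsub>tensor V W\<^esub> tens V W v w"
  unfolding tens_def tensor_def by (intro tens_rel_smult tens_relI symb_carrier V.sm_closed)

lemma tens_smult_right:
  "\<lbrakk>v \<in> carrier V; w \<in> carrier W\<rbrakk> \<Longrightarrow>
    tens V W v (c \<odot>\<^bsub>W\<^esub> w) = c \<odot>\<^bsub>tensor V W\<^esub> tens V W v w"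
  unfolding tens_def tensor_def by (intro tens_rel_smult tens_relI symb_carrier W.sm_closed)

lemma tens_nrm:
  assumes "v \<in> carrier V" "w \<in> carrier W"
  shows "nrm (tensor V W) (tens V W v w) \<le> nrm V v * nrm W w"
proof -
  interpret N: closed_sub TF TN by (rule TN_sub)
  have "nrm (tensor V W) (tens V W v w) \<le> nrm TF (tens_symb V W v w)"
    using N.quot_nrm_self[OF symb_carrier[OF assms]] by (simp add: tensor_def tens_def)
  also have "\<dots> \<le> nrm V v * nrm W w"
    unfolding tens_free_def
    by (rule c0_nrm_le) (use assms in \<open>auto simp: tens_symb_def single_def V.nrm_nonneg W.nrm_nonneg\<close>)
  finally show ?thesis .
qed

lemma tens_left_bounded: "w \<in> carrier W \<Longrightarrow> bounded_lin V (tensor V W) (\<lambda>v. tens V W v w)"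
  by (rule bounded_linI[where C = "nrm W w"])
    (use tens_nrm in \<open>auto simp: tens_add_left tens_smult_left mult.commute\<close>)

lemma tens_right_bounded: "v \<in> carrier V \<Longrightarrow> bounded_lin W (tensor V W) (\<lambda>w. tens V W v w)"
  by (rule bounded_linI[where C = "nrm V v"])
    (use tens_nrm in \<open>auto simp: tens_add_right tens_smult_right mult.commute\<close>)

text \<open>Uniqueness half of the universal property: the span of the symbols is dense in the free
  space by \<open>c0_dense\<close>, and the free space maps onto the tensor product.\<close>

lemma tensor_dense:
  fixes Z :: "('k, 'z) nspace"
  assumes Z: "normed_sp Z" and Q: "bounded_lin (tensor V W) Z Q"
    and 0: "\<And>v w. v \<in> carrier V \<Longrightarrow> w \<in> carrier W \<Longrightarrow> Q (tens V W v w) = \<zero>\<^bsub>Z\<^esub>"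
    and X: "X \<in> carrier (tensor V W)"
  shows "Q X = \<zero>\<^bsub>Z\<^esub>"
proof -
  interpret N: closed_sub TF TN by (rule TN_sub)
  obtain f where f: "f \<in> carrier TF" "X = TN +>\<^bsub>TF\<^esub> f" using X by (rule tensor_cases)
  have "bounded_lin TF Z (\<lambda>f. Q (TN +>\<^bsub>TF\<^esub> f))"
    using bounded_lin_comp[OF TF_normed N.quot_normed N.quot_map] Q by (simp add: tensor_def)
  then have B: "bounded_lin (c0 ((carrier V - {\<zero>\<^bsub>V\<^esub>}) \<times> (carrier W - {\<zero>\<^bsub>W\<^esub>})) (\<lambda>(v, w). nrm V v * nrm W w)) Z
      (\<lambda>f. Q (TN +>\<^bsub>TF\<^esub> f))"
    by (simp add: tens_free_def)
  have "Q (TN +>\<^bsub>TF\<^esub> single p) = \<zero>\<^bsub>Z\<^esub>"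
    if "p \<in> (carrier V - {\<zero>\<^bsub>V\<^esub>}) \<times> (carrier W - {\<zero>\<^bsub>W\<^esub>})" for p
  proof -
    obtain v w where p: "p = (v, w)" by fastforce
    then show ?thesis
      using that 0[of v w] by (simp add: tens_def tens_symb_def)
  qed
  from c0_dense[OF wt_pos Z B this f(1)[unfolded tens_free_def]]
  show ?thesis using f(2) by simp
qed

text \<open>Existence half of the universal property, phrased as the specification of the choice in
  \<open>tens_lift\<close>. The map on symbols extends to \<open>TF\<close> by
  \<open>c0_lift\<close>; its kernel is closed and contains the relations, hence all of
  \<open>TN\<close>.\<close>

lemma tens_lift_exists:
  fixes Z :: "('k, 'z) nspace"
  assumes Z: "banach_sp Z"
    and b: "\<And>v w. v \<in> carrier V \<Longrightarrow> w \<in> carrier W \<Longrightarrow> b v w \<in> carrier Z"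
    and b_add1: "\<And>v v' w. v \<in> carrier V \<Longrightarrow> v' \<in> carrier V \<Longrightarrow> w \<in> carrier W \<Longrightarrow>
      b (v \<oplus>\<^bsub>V\<^esub> v') w = b v w \<oplus>\<^bsub>Z\<^esub> b v' w"
    and b_add2: "\<And>v w w'. v \<in> carrier V \<Longrightarrow> w \<in> carrier W \<Longrightarrow> w' \<in> carrier W \<Longrightarrow>
      b v (w \<oplus>\<^bsub>W\<^esub> w') = b v w \<oplus>\<^bsub>Z\<^esub> b v w'"
    and b_smult1: "\<And>c v w. v \<in> carrier V \<Longrightarrow> w \<in> carrier W \<Longrightarrow> b (c \<odot>\<^bsub>V\<^esub> v) w = c \<odot>\<^bsub>Z\<^esub> b v w"
    and b_smult2: "\<And>c v w. v \<in> carrier V \<Longrightarrow> w \<in> carrier W \<Longrightarrow> b v (c \<odot>\<^bsub>W\<^esub> w) = c \<odot>\<^bsub>Z\<^esub> b v w"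
    and bound: "\<And>v w. v \<in> carrier V \<Longrightarrow> w \<in> carrier W \<Longrightarrow> nrm Z (b v w) \<le> C * (nrm V v * nrm W w)"
  shows "bounded_lin (tensor V W) Z (tens_lift V W Z b) \<and>
    (\<forall>v\<in>carrier V. \<forall>w\<in>carrier W. tens_lift V W Z b (tens V W v w) = b v w)"
proof -
  interpret Z: banach_sp Z by fact
  interpret N: closed_sub TF TN by (rule TN_sub)
  let ?S = "(carrier V - {\<zero>\<^bsub>V\<^esub>}) \<times> (carrier W - {\<zero>\<^bsub>W\<^esub>})"
  obtain h where h: "bounded_lin TF Z h" "\<And>p. p \<in> ?S \<Longrightarrow> h (single p) = case_prod b p"
  proof -
    have "\<exists>h. bounded_lin TF Z h \<and> (\<forall>p\<in>?S. h (single p) = case_prod b p)"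
      unfolding tens_free_def
      by (rule c0_lift[where C = C, OF wt_pos Z]) (use b bound in auto)
    then show thesis using that by blast
  qed
  \<comment> \<open>Symbols with a zero entry are read as 0, so \<open>b\<close> has to vanish on
    such pairs before \<open>hs\<close> can hold for all of them.\<close>
  have b0: "b \<zero>\<^bsub>V\<^esub> w = \<zero>\<^bsub>Z\<^esub>" if "w \<in> carrier W" for w
    using b_smult1[of "\<zero>\<^bsub>V\<^esub>" w 0] that b by simp
  have b0': "b v \<zero>\<^bsub>W\<^esub> = \<zero>\<^bsub>Z\<^esub>" if "v \<in> carrier V" for v
    using b_smult2[of v "\<zero>\<^bsub>W\<^esub>" 0] that b by simp
  have hs: "h (tens_symb V W v w) = b v w" if "v \<in> carrier V" "w \<in> carrier W" for v w
    using that h(2)[of "(v, w)"] b0 b0' bounded_lin_0[OF TF_normed Z.normed_sp_self h(1)]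
    by (auto simp: tens_symb_def TF_simps)
  have hd: "h (\<lambda>p. f p - g p) = h f \<ominus>\<^bsub>Z\<^esub> h g" if "f \<in> carrier TF" "g \<in> carrier TF" for f g
    using bounded_lin_minus[OF TF_normed Z.normed_sp_self h(1) that] TF_minus[OF that] by simp
  have dc: "(\<lambda>p. f p - g p) \<in> carrier TF" if "f \<in> carrier TF" "g \<in> carrier TF" for f g
    using TF_minus[OF that] N.minus_closed[OF that] by simp
  have hm: "h (\<lambda>p. c * f p) = c \<odot>\<^bsub>Z\<^esub> h f" if "f \<in> carrier TF" for f c
    using bounded_lin_smult[OF h(1) that] by (simp add: TF_simps)
  have mc: "(\<lambda>p. c * f p) \<in> carrier TF" if "f \<in> carrier TF" for f c
    using N.sm_closed[OF that] by (simp add: TF_simps)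
  have diff_self: "x \<ominus>\<^bsub>Z\<^esub> x = \<zero>\<^bsub>Z\<^esub>" if "x \<in> carrier Z" for x
    using that by (simp add: a_minus_def Z.M.r_neg)
  have diff3: "x \<oplus>\<^bsub>Z\<^esub> y \<ominus>\<^bsub>Z\<^esub> x \<ominus>\<^bsub>Z\<^esub> y = \<zero>\<^bsub>Z\<^esub>" if "x \<in> carrier Z" "y \<in> carrier Z" for x y
    using that by (simp add: a_minus_def Z.M.a_assoc Z.M.a_lcomm[of y "\<ominus>\<^bsub>Z\<^esub> x"] Z.M.r_neg)
  have "tens_rel V W \<subseteq> {f \<in> carrier TF. h f = \<zero>\<^bsub>Z\<^esub>}"
  proof
    fix f assume f: "f \<in> tens_rel V W"
    then have "h f = \<zero>\<^bsub>Z\<^esub>"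
      unfolding tens_rel_def
      by (auto simp: hd dc hm mc hs symb_carrier b b_add1 b_add2 b_smult1 b_smult2
          diff3 diff_self)
    then show "f \<in> {f \<in> carrier TF. h f = \<zero>\<^bsub>Z\<^esub>}"
      using f rel_carrier by blast
  qed
  then have "TN \<subseteq> {f \<in> carrier TF. h f = \<zero>\<^bsub>Z\<^esub>}"
    using bounded_lin_kernel_closed[OF TF_normed Z.normed_sp_self h(1)] by (intro closed_span_least)
  then have "\<exists>g. bounded_lin (quot TF TN) Z g \<and> (\<forall>x\<in>carrier TF. g (TN +>\<^bsub>TF\<^esub> x) = h x)"
    by (intro N.quot_lift Z.normed_sp_self h(1)) auto
  then obtain g where g: "bounded_lin (quot TF TN) Z g" "\<forall>x\<in>carrier TF. g (TN +>\<^bsub>TF\<^esub> x) = h x"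
    by blast
  have "\<exists>h. bounded_lin (tensor V W) Z h \<and> (\<forall>v\<in>carrier V. \<forall>w\<in>carrier W. h (tens V W v w) = b v w)"
    by (rule exI[of _ g]) (use g hs symb_carrier in \<open>auto simp: tensor_def tens_def\<close>)
  from someI_ex[OF this] show ?thesis
    unfolding tens_lift_def .
qed

end

lemma tens_map_lift:
  assumes "normed_sp V" "normed_sp W" "normed_sp V'" "normed_sp W'"
    and f: "bounded_lin V V' f" and g: "bounded_lin W W' g"
  shows "bounded_lin (tensor V W) (tensor V' W') (tens_map V W V' W' f g)"
    and "v \<in> carrier V \<Longrightarrow> w \<in> carrier W \<Longrightarrow>
      tens_map V W V' W' f g (tens V W v w) = tens V' W' (f v) (g w)"
proof -
  interpret P: normed_pair V W using assms by (simp add: normed_pair_def)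
  interpret P': normed_pair V' W' using assms by (simp add: normed_pair_def)
  obtain C where C: "0 \<le> C" "\<And>x. x \<in> carrier V \<Longrightarrow> nrm V' (f x) \<le> C * nrm V x"
    using bounded_lin_bound[OF assms(1) f] by metis
  obtain D where D: "0 \<le> D" "\<And>x. x \<in> carrier W \<Longrightarrow> nrm W' (g x) \<le> D * nrm W x"
    using bounded_lin_bound[OF assms(2) g] by metis
  note cl = bounded_lin_closed[OF f] bounded_lin_closed[OF g]
  have bd: "nrm (tensor V' W') (tens V' W' (f v) (g w)) \<le> (C * D) * (nrm V v * nrm W w)"
    if "v \<in> carrier V" "w \<in> carrier W" for v w
  proof -
    have "nrm (tensor V' W') (tens V' W' (f v) (g w)) \<le> nrm V' (f v) * nrm W' (g w)"
      using that cl by (intro P'.tens_nrm)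
    also have "\<dots> \<le> (C * nrm V v) * (D * nrm W w)"
      using that C D cl by (intro mult_mono C D) (auto simp: P.V.nrm_nonneg P'.W.nrm_nonneg)
    finally show ?thesis by (simp add: mult_ac)
  qed
  have "bounded_lin (tensor V W) (tensor V' W') (tens_map V W V' W' f g) \<and>
    (\<forall>v\<in>carrier V. \<forall>w\<in>carrier W. tens_map V W V' W' f g (tens V W v w) = tens V' W' (f v) (g w))"
    unfolding tens_map_def
    by (rule P.tens_lift_exists[OF P'.tensor_banach _ _ _ _ _ bd])
      (auto simp: cl bounded_lin_add[OF f] bounded_lin_add[OF g] bounded_lin_smult[OF f] bounded_lin_smult[OF g]
        P'.tens_add_left P'.tens_add_right P'.tens_smult_left P'.tens_smult_right)
  then show "bounded_lin (tensor V W) (tensor V' W') (tens_map V W V' W' f g)"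
    and "v \<in> carrier V \<Longrightarrow> w \<in> carrier W \<Longrightarrow>
      tens_map V W V' W' f g (tens V W v w) = tens V' W' (f v) (g w)"
    by auto
qed

section \<open>Formal power series over a noncommutative ring\<close>

definition cauchy :: "('v, 'm) ring_scheme \<Rightarrow> (nat \<Rightarrow> 'v) \<Rightarrow> (nat \<Rightarrow> 'v) \<Rightarrow> nat \<Rightarrow> 'v" where
  "cauchy R x y n = (\<Oplus>\<^bsub>R\<^esub>i\<in>{..n}. x i \<otimes>\<^bsub>R\<^esub> y (n - i))"

text \<open>All sequences are allowed and no norm is recorded, so identities between series can be
  left to the ring axioms and the \<open>algebra\<close> method.\<close>

definition fps_ring :: "('v, 'm) ring_scheme \<Rightarrow> (nat \<Rightarrow> 'v) ring" where
  "fps_ring R = \<lparr>carrier = UNIV \<rightarrow> carrier R, monoid.mult = cauchy R,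
     one = (\<lambda>n. if n = 0 then \<one>\<^bsub>R\<^esub> else \<zero>\<^bsub>R\<^esub>), zero = (\<lambda>_. \<zero>\<^bsub>R\<^esub>), add = (\<lambda>x y n. x n \<oplus>\<^bsub>R\<^esub> y n)\<rparr>"

lemma fps_ring_simps [simp]:
  "carrier (fps_ring R) = UNIV \<rightarrow> carrier R" "monoid.mult (fps_ring R) = cauchy R"
  "one (fps_ring R) = (\<lambda>n. if n = 0 then \<one>\<^bsub>R\<^esub> else \<zero>\<^bsub>R\<^esub>)" "zero (fps_ring R) = (\<lambda>_. \<zero>\<^bsub>R\<^esub>)"
  "add (fps_ring R) = (\<lambda>x y n. x n \<oplus>\<^bsub>R\<^esub> y n)"
  by (simp_all add: fps_ring_def)

text \<open>Multiplication by \<hbar>.\<close>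

definition hshift :: "('v, 'm) ring_scheme \<Rightarrow> (nat \<Rightarrow> 'v) \<Rightarrow> nat \<Rightarrow> 'v" where
  "hshift R x n = (case n of 0 \<Rightarrow> \<zero>\<^bsub>R\<^esub> | Suc m \<Rightarrow> x m)"

lemma hshift_simps [simp]: "hshift R x 0 = \<zero>\<^bsub>R\<^esub>" "hshift R x (Suc n) = x n"
  by (simp_all add: hshift_def)

context ring
begin

lemma cauchy_closed: "x \<in> UNIV \<rightarrow> carrier R \<Longrightarrow> y \<in> UNIV \<rightarrow> carrier R \<Longrightarrow> cauchy R x y n \<in> carrier R"
  unfolding cauchy_def by (intro finsum_closed) auto

lemma cauchy_cong:
  assumes "x \<in> UNIV \<rightarrow> carrier R" "y \<in> UNIV \<rightarrow> carrier R"
    and "\<And>i. i \<le> n \<Longrightarrow> x' i = x i" "\<And>i. i \<le> n \<Longrightarrow> y' i = y i"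
  shows "cauchy R x' y' n = cauchy R x y n"
  unfolding cauchy_def using assms by (intro finsum_cong') auto

lemma cauchy_trunc:
  assumes "x \<in> UNIV \<rightarrow> carrier R" "y \<in> UNIV \<rightarrow> carrier R" "n \<le> N"
  defines "t \<equiv> \<lambda>x i. if i \<le> N then x i else \<zero>"
  shows "t x \<in> up R" "t y \<in> up R" "(t x \<otimes>\<^bsub>UP R\<^esub> t y) n = cauchy R x y n"
proof -
  have t: "t z \<in> up R" if "z \<in> UNIV \<rightarrow> carrier R" for z
    using that by (intro mem_upI exI[of _ N]) (auto simp: t_def bound_def)
  show "t x \<in> up R" "t y \<in> up R" using t assms(1,2) by auto
  then have "(t x \<otimes>\<^bsub>UP R\<^esub> t y) n = cauchy R (t x) (t y) n"
    by (simp add: UP_def cauchy_def)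
  also have "\<dots> = cauchy R x y n"
    using assms by (intro cauchy_cong) auto
  finally show "(t x \<otimes>\<^bsub>UP R\<^esub> t y) n = cauchy R x y n" .
qed

text \<open>A coefficient of a product depends on finitely many coefficients of the factors only, so
  associativity is inherited from polynomials.\<close>

lemma cauchy_assoc:
  assumes x: "x \<in> UNIV \<rightarrow> carrier R" and y: "y \<in> UNIV \<rightarrow> carrier R" and z: "z \<in> UNIV \<rightarrow> carrier R"
  shows "cauchy R (cauchy R x y) z = cauchy R x (cauchy R y z)"
proof
  fix n
  interpret UP: UP_ring R "UP R" by unfold_locales
  let ?t = "\<lambda>x (i::nat). if i \<le> n then x i else \<zero>"
  let ?P = "UP R"
  have up: "carrier ?P = up R" by (simp add: UP_def)
  have tc: "?t x \<in> carrier ?P" "?t y \<in> carrier ?P" "?t z \<in> carrier ?P"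
    using cauchy_trunc(1)[OF x y order_refl] cauchy_trunc(1)[OF y z order_refl]
      cauchy_trunc(1)[OF z z order_refl] by (auto simp: up)
  have upc: "w \<in> UNIV \<rightarrow> carrier R" if "w \<in> carrier ?P" for w
    using that by (auto simp: up)
  have mult: "(v \<otimes>\<^bsub>?P\<^esub> w) i = cauchy R v w i" if "v \<in> carrier ?P" "w \<in> carrier ?P" for v w i
    using that by (simp add: UP_def cauchy_def)
  have "cauchy R (cauchy R x y) z n = cauchy R (?t x \<otimes>\<^bsub>?P\<^esub> ?t y) (?t z) n"
    using cauchy_trunc(3)[OF x y, of _ n] tc
    by (intro cauchy_cong upc) auto
  also have "\<dots> = (?t x \<otimes>\<^bsub>?P\<^esub> ?t y \<otimes>\<^bsub>?P\<^esub> ?t z) n"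
    using tc by (intro mult[symmetric]) auto
  also have "\<dots> = (?t x \<otimes>\<^bsub>?P\<^esub> (?t y \<otimes>\<^bsub>?P\<^esub> ?t z)) n"
    using tc by (simp add: UP.P.m_assoc)
  also have "\<dots> = cauchy R (?t x) (?t y \<otimes>\<^bsub>?P\<^esub> ?t z) n"
    using tc by (intro mult) auto
  also have "\<dots> = cauchy R x (cauchy R y z) n"
    using cauchy_trunc(3)[OF y z, of _ n] tc
    by (intro cauchy_cong[symmetric] upc) auto
  finally show "cauchy R (cauchy R x y) z n = cauchy R x (cauchy R y z) n" .
qed

lemma cauchy_add:
  assumes "x \<in> UNIV \<rightarrow> carrier R" "y \<in> UNIV \<rightarrow> carrier R" "z \<in> UNIV \<rightarrow> carrier R"
  shows "cauchy R (\<lambda>n. x n \<oplus> y n) z n = cauchy R x z n \<oplus> cauchy R y z n"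
    and "cauchy R z (\<lambda>n. x n \<oplus> y n) n = cauchy R z x n \<oplus> cauchy R z y n"
proof -
  have "cauchy R (\<lambda>n. x n \<oplus> y n) z n = (\<Oplus>i\<in>{..n}. x i \<otimes> z (n - i) \<oplus> y i \<otimes> z (n - i))"
    unfolding cauchy_def using assms by (intro finsum_cong') (auto simp: l_distr Pi_iff)
  then show "cauchy R (\<lambda>n. x n \<oplus> y n) z n = cauchy R x z n \<oplus> cauchy R y z n"
    unfolding cauchy_def using assms by (simp add: finsum_addf Pi_iff)
  have "cauchy R z (\<lambda>n. x n \<oplus> y n) n = (\<Oplus>i\<in>{..n}. z i \<otimes> x (n - i) \<oplus> z i \<otimes> y (n - i))"
    unfolding cauchy_def using assms by (intro finsum_cong') (auto simp: r_distr Pi_iff)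
  then show "cauchy R z (\<lambda>n. x n \<oplus> y n) n = cauchy R z x n \<oplus> cauchy R z y n"
    unfolding cauchy_def using assms by (simp add: finsum_addf Pi_iff)
qed

text \<open>If \<open>x\<close> is divisible by the n-th power of \<hbar>, the coefficient of degree
  \<open>n\<close> of a product sees only the leading coefficient of \<open>x\<close> and the
  constant term of \<open>y\<close>. This is how an identity of series becomes a derivation
  law.\<close>

lemma cauchy_low:
  assumes x: "x \<in> UNIV \<rightarrow> carrier R" and y: "y \<in> UNIV \<rightarrow> carrier R" and 0: "\<And>i. i < n \<Longrightarrow> x i = \<zero>"
  shows "cauchy R x y n = x n \<otimes> y 0" "cauchy R y x n = y 0 \<otimes> x n"
proof -
  have "cauchy R x y n = (\<Oplus>i\<in>{..n}. if n = i then x i \<otimes> y (n - i) else \<zero>)"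
    unfolding cauchy_def using x y 0 by (intro finsum_cong') (auto simp: Pi_iff)
  also have "\<dots> = x n \<otimes> y (n - n)"
    using x y by (subst finsum_singleton) (auto simp: Pi_iff)
  finally show "cauchy R x y n = x n \<otimes> y 0" by simp
  have "cauchy R y x n = (\<Oplus>i\<in>{..n}. if 0 = i then y i \<otimes> x (n - i) else \<zero>)"
    unfolding cauchy_def using x y 0 by (intro finsum_cong') (auto simp: Pi_iff)
  also have "\<dots> = y 0 \<otimes> x (n - 0)"
    using x y by (subst finsum_singleton) (auto simp: Pi_iff)
  finally show "cauchy R y x n = y 0 \<otimes> x n" by simp
qed

lemma cauchy_one:
  assumes "x \<in> UNIV \<rightarrow> carrier R"
  shows "cauchy R (\<lambda>n. if n = 0 then \<one> else \<zero>) x = x" "cauchy R x (\<lambda>n. if n = 0 then \<one> else \<zero>) = x"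
proof -
  have "cauchy R (\<lambda>n. if n = 0 then \<one> else \<zero>) x n = x n" for n
  proof -
    have "cauchy R (\<lambda>n. if n = 0 then \<one> else \<zero>) x n = (\<Oplus>i\<in>{..n}. if 0 = i then x (n - i) else \<zero>)"
      unfolding cauchy_def using assms by (intro finsum_cong') (auto simp: Pi_iff)
    then show ?thesis using assms by (subst (asm) finsum_singleton) (auto simp: Pi_iff)
  qed
  then show "cauchy R (\<lambda>n. if n = 0 then \<one> else \<zero>) x = x" by auto
  have "cauchy R x (\<lambda>n. if n = 0 then \<one> else \<zero>) n = x n" for n
  proof -
    have "cauchy R x (\<lambda>n. if n = 0 then \<one> else \<zero>) n = (\<Oplus>i\<in>{..n}. if n = i then x i else \<zero>)"
      unfolding cauchy_def using assms by (intro finsum_cong') (auto simp: Pi_iff)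
    then show ?thesis using assms by (subst (asm) finsum_singleton) (auto simp: Pi_iff)
  qed
  then show "cauchy R x (\<lambda>n. if n = 0 then \<one> else \<zero>) = x" by auto
qed

text \<open>In other words, \<hbar> is central in the ring of series.\<close>

lemma cauchy_hshift:
  assumes x: "x \<in> UNIV \<rightarrow> carrier R" and y: "y \<in> UNIV \<rightarrow> carrier R"
  shows "cauchy R (hshift R x) y = hshift R (cauchy R x y)" "cauchy R x (hshift R y) = hshift R (cauchy R x y)"
proof -
  have s: "hshift R z n \<in> carrier R" if "z \<in> UNIV \<rightarrow> carrier R" for z n
    using that by (auto simp: hshift_def split: nat.split)
  show "cauchy R (hshift R x) y = hshift R (cauchy R x y)"
  proof
    fix n show "cauchy R (hshift R x) y n = hshift R (cauchy R x y) n"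
    proof (cases n)
      case (Suc m)
      have "cauchy R (hshift R x) y (Suc m) =
          (\<Oplus>i\<in>{..m}. hshift R x (Suc i) \<otimes> y (Suc m - Suc i)) \<oplus> hshift R x 0 \<otimes> y (Suc m - 0)"
        unfolding cauchy_def using s[OF x] y by (intro finsum_Suc2) (auto simp del: hshift_simps)
      then show ?thesis
        using Suc cauchy_closed[OF x y] y by (simp add: cauchy_def Pi_iff)
    qed (use x y in \<open>auto simp: cauchy_def Pi_iff\<close>)
  qed
  show "cauchy R x (hshift R y) = hshift R (cauchy R x y)"
  proof
    fix n show "cauchy R x (hshift R y) n = hshift R (cauchy R x y) n"
    proof (cases n)
      case (Suc m)
      have "cauchy R x (hshift R y) (Suc m) =
          x (Suc m) \<otimes> hshift R y (Suc m - Suc m) \<oplus> (\<Oplus>i\<in>{..m}. x i \<otimes> hshift R y (Suc m - i))"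
        unfolding cauchy_def using s[OF y] x by (intro finsum_Suc) (auto simp del: hshift_simps)
      moreover have "(\<Oplus>i\<in>{..m}. x i \<otimes> hshift R y (Suc m - i)) = cauchy R x y m"
        unfolding cauchy_def using x y by (intro finsum_cong') (auto simp: Suc_diff_le Pi_iff)
      ultimately show ?thesis
        using Suc cauchy_closed[OF x y] x by (simp add: Pi_iff)
    qed (use x y in \<open>auto simp: cauchy_def Pi_iff\<close>)
  qed
qed

lemma fps_ring_ring: "ring (fps_ring R)"
proof (rule ringI)
  show "abelian_group (fps_ring R)"
  proof (rule abelian_groupI)
    fix x assume "x \<in> carrier (fps_ring R)"
    then show "\<exists>y\<in>carrier (fps_ring R). y \<oplus>\<^bsub>fps_ring R\<^esub> x = \<zero>\<^bsub>fps_ring R\<^esub>"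
      by (intro bexI[of _ "\<lambda>n. \<ominus> x n"]) (auto simp: l_neg Pi_iff)
  qed (auto simp: a_ac Pi_iff fun_eq_iff)
  show "monoid (fps_ring R)"
    by (rule monoidI) (auto simp: cauchy_closed cauchy_assoc cauchy_one)
qed (auto simp: cauchy_add fun_eq_iff)

lemma fps_ring_minus:
  assumes x: "x \<in> UNIV \<rightarrow> carrier R" and y: "y \<in> UNIV \<rightarrow> carrier R"
  shows "x \<ominus>\<^bsub>fps_ring R\<^esub> y = (\<lambda>n. x n \<ominus> y n)"
proof -
  interpret S: ring "fps_ring R" by (rule fps_ring_ring)
  have "\<ominus>\<^bsub>fps_ring R\<^esub> y = (\<lambda>n. \<ominus> y n)"
    using y by (intro S.minus_equality) (auto simp: l_neg Pi_iff)
  then show ?thesis by (simp add: a_minus_def)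
qed

text \<open>The equation in degree \<open>n\<close> can be solved for \<open>G n\<close> in terms of
  the earlier coefficients because \<open>F 0\<close> is 1. That \<open>G 0\<close> is 1 again
  allows the lemma to be applied to \<open>G\<close> as well.\<close>

lemma fps_right_inverse:
  assumes F: "F \<in> UNIV \<rightarrow> carrier R" "F 0 = \<one>"
  shows "\<exists>G. G \<in> UNIV \<rightarrow> carrier R \<and> G 0 = \<one> \<and> cauchy R F G = (\<lambda>n. if n = 0 then \<one> else \<zero>)"
proof -
  \<comment> \<open>The candidate \<open>r\<close> fills all places from \<open>n\<close> on. Places
    above \<open>n\<close> do not enter degree \<open>n\<close>, and \<open>P\<close> reads
    \<open>G\<close> only below \<open>n\<close>, as \<open>dependent_wf_choice\<close>
    demands.\<close>
  define P where "P G n r \<longleftrightarrow> r \<in> carrier R \<and>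
    cauchy R F (\<lambda>i. if i < n then G i else r) n = (if n = 0 then \<one> else \<zero>)" for G n r
  have "\<exists>G. \<forall>n. P G n (G n)"
  proof (rule dependent_wf_choice[OF wf_less_than])
    fix G G' :: "nat \<Rightarrow> 'a" and n r
    assume eq: "\<And>z. (z, n) \<in> less_than \<Longrightarrow> G z = G' z"
    then have "(\<lambda>i. if i < n then G i else r) = (\<lambda>i. if i < n then G' i else r)" by auto
    then show "P G n r = P G' n r" by (simp only: P_def)
  next
    fix n and G :: "nat \<Rightarrow> 'a"
    assume "\<And>m. (m, n) \<in> less_than \<Longrightarrow> P G m (G m)"
    then have G: "G m \<in> carrier R" if "m < n" for m using that by (auto simp: P_def)
    show "\<exists>r. P G n r"
    proof (cases n)
      case 0
      then show ?thesis by (intro exI[of _ \<one>]) (auto simp: P_def cauchy_def F)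
    next
      case (Suc m)
      define T where "T i = (if i < n then G i else \<zero>)" for i
      have T: "T \<in> UNIV \<rightarrow> carrier R" using G by (auto simp: T_def)
      \<comment> \<open>All contributions of the earlier coefficients are collected in
        \<open>T\<close>; since \<open>F 0\<close> is 1, the new coefficient enters degree
        \<open>n\<close> as the bare summand \<open>r\<close>, which has to cancel them.\<close>
      define r where "r = \<ominus> cauchy R F T n"
      have r: "r \<in> carrier R" using cauchy_closed[OF F(1) T] by (simp add: r_def)
      define S where "S i = (if i < n then \<zero> else r)" for i
      have S: "S \<in> UNIV \<rightarrow> carrier R" using r by (auto simp: S_def)
      have eq: "(\<lambda>i. if i < n then G i else r) = (\<lambda>i. T i \<oplus> S i)"
        using G r by (auto simp: T_def S_def)
      have "cauchy R F (\<lambda>i. if i < n then G i else r) n = cauchy R F T n \<oplus> F 0 \<otimes> S n"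
        unfolding eq cauchy_add(2)[OF T S F(1)] using cauchy_low(2)[OF S F(1), of n] by (simp add: S_def)
      also have "\<dots> = \<zero>"
        using cauchy_closed[OF F(1) T] r F by (simp add: S_def r_def r_neg)
      finally show ?thesis using r Suc by (auto simp: P_def)
    qed
  qed
  then obtain G where G: "\<And>n. P G n (G n)" by blast
  have Gc: "G \<in> UNIV \<rightarrow> carrier R" using G by (auto simp: P_def)
  have eq: "cauchy R F G n = (if n = 0 then \<one> else \<zero>)" for n
  proof -
    have "cauchy R F G n = cauchy R F (\<lambda>i. if i < n then G i else G n) n"
      using Gc F by (intro cauchy_cong) (auto simp: Pi_iff)
    then show ?thesis using G[of n] by (simp add: P_def)
  qed
  have "G 0 = \<one>" using eq[of 0] Gc F by (simp add: cauchy_def Pi_iff)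
  then show ?thesis using Gc eq by blast
qed

text \<open>The right inverse \<open>G\<close> has itself a right inverse \<open>H\<close>, and
  associativity identifies \<open>H\<close> with \<open>F\<close>; so \<open>G\<close> is a
  two-sided inverse.\<close>

lemma fps_inverse:
  assumes F: "F \<in> UNIV \<rightarrow> carrier R" "F 0 = \<one>"
  obtains G where "G \<in> UNIV \<rightarrow> carrier R" "cauchy R F G = (\<lambda>n. if n = 0 then \<one> else \<zero>)"
    "cauchy R G F = (\<lambda>n. if n = 0 then \<one> else \<zero>)"
proof -
  obtain G where G: "G \<in> UNIV \<rightarrow> carrier R" "G 0 = \<one>" "cauchy R F G = (\<lambda>n. if n = 0 then \<one> else \<zero>)"
    using fps_right_inverse[OF F] by blast
  obtain H where H: "H \<in> UNIV \<rightarrow> carrier R" "cauchy R G H = (\<lambda>n. if n = 0 then \<one> else \<zero>)"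
    using fps_right_inverse[OF G(1,2)] by blast
  have "F = cauchy R F (cauchy R G H)" using cauchy_one(2)[OF F(1)] H(2) by simp
  also have "\<dots> = H" using cauchy_assoc[OF F(1) G(1) H(1)] G(3) cauchy_one(1)[OF H(1)] by simp
  finally show thesis using that G H by simp
qed

end

section \<open>Banach algebras\<close>

locale banach_alg = banach_sp A + ring A
  for A :: "('k::complete_nonarch_field, 'v) nspace" (structure) +
  assumes mult_sm1: "x \<in> carrier A \<Longrightarrow> y \<in> carrier A \<Longrightarrow> (c \<odot> x) \<otimes> y = c \<odot> (x \<otimes> y)"
    and mult_sm2: "x \<in> carrier A \<Longrightarrow> y \<in> carrier A \<Longrightarrow> x \<otimes> (c \<odot> y) = c \<odot> (x \<otimes> y)"
    and mult_bound: "\<exists>C. \<forall>x\<in>carrier A. \<forall>y\<in>carrier A. nrm A (x \<otimes> y) \<le> C * nrm A x * nrm A y"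

lemma banach_algebra_iff: "banach_algebra A \<longleftrightarrow> banach_alg A"
  unfolding banach_algebra_def banach_alg_def banach_alg_axioms_def banach_space_iff
  by (simp add: Ball_def imp_conjL all_conj_distrib) meson

section \<open>Sums and multiples of bounded maps\<close>

lemma bounded_lin_cong:
  assumes "normed_sp W" "\<And>x. x \<in> carrier W \<Longrightarrow> g x = f x" "bounded_lin W V f"
  shows "bounded_lin W V g"
proof -
  interpret W: normed_sp W by fact
  obtain C where C: "\<And>x. x \<in> carrier W \<Longrightarrow> nrm V (f x) \<le> C * nrm W x"
    using bounded_lin_bound[OF assms(1,3)] by metis
  show ?thesis
    by (rule bounded_linI[where C = C])
      (simp_all add: assms(2) C bounded_lin_closed[OF assms(3)] bounded_lin_add[OF assms(3)]
        bounded_lin_smult[OF assms(3)])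
qed

context normed_sp
begin

lemma bounded_lin_sum:
  assumes "normed_sp W" "bounded_lin W V f" "bounded_lin W V g"
  shows "bounded_lin W V (\<lambda>x. f x \<oplus> g x)"
proof -
  interpret W: normed_sp W by fact
  obtain C where C: "0 \<le> C" "\<And>x. x \<in> carrier W \<Longrightarrow> nrm V (f x) \<le> C * nrm W x"
    using bounded_lin_bound[OF assms(1,2)] by metis
  obtain D where D: "0 \<le> D" "\<And>x. x \<in> carrier W \<Longrightarrow> nrm V (g x) \<le> D * nrm W x"
    using bounded_lin_bound[OF assms(1,3)] by metis
  note [simp] = bounded_lin_closed[OF assms(2)] bounded_lin_closed[OF assms(3)]
    bounded_lin_add[OF assms(2)] bounded_lin_add[OF assms(3)]
    bounded_lin_smult[OF assms(2)] bounded_lin_smult[OF assms(3)]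
  show ?thesis
  proof (rule bounded_linI[where C = "max C D"])
    fix x assume x: "x \<in> carrier W"
    have "nrm V (f x \<oplus> g x) \<le> max (nrm V (f x)) (nrm V (g x))"
      using x by (intro nrm_add) auto
    also have "\<dots> \<le> max (C * nrm W x) (D * nrm W x)"
      using C(2)[OF x] D(2)[OF x] by auto
    also have "\<dots> \<le> max C D * nrm W x"
      using W.nrm_nonneg[OF x] by (auto intro!: mult_right_mono)
    finally show "nrm V (f x \<oplus> g x) \<le> max C D * nrm W x" .
  qed (auto simp: M.a_ac sm_r_add)
qed

lemma bounded_lin_neg:
  assumes "bounded_lin W V f" "normed_sp W"
  shows "bounded_lin W V (\<lambda>x. \<ominus> f x)"
proof -
  obtain C where C: "0 \<le> C" "\<And>x. x \<in> carrier W \<Longrightarrow> nrm V (f x) \<le> C * nrm W x"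
    using bounded_lin_bound[OF assms(2,1)] by metis
  note [simp] = bounded_lin_closed[OF assms(1)] bounded_lin_add[OF assms(1)] bounded_lin_smult[OF assms(1)]
  show ?thesis
    by (rule bounded_linI[where C = C]) (auto simp: M.minus_add C smult_r_minus)
qed

lemma bounded_lin_diff:
  assumes "normed_sp W" "bounded_lin W V f" "bounded_lin W V g"
  shows "bounded_lin W V (\<lambda>x. f x \<ominus> g x)"
  unfolding a_minus_def using assms by (intro bounded_lin_sum bounded_lin_neg)

lemma bounded_lin_finsum:
  assumes W: "normed_sp W" and "finite I" "\<And>i. i \<in> I \<Longrightarrow> bounded_lin W V (f i)"
  shows "bounded_lin W V (\<lambda>x. \<Oplus>i\<in>I. f i x)"
  using assms(2,3)
proof (induction I)
  case empty
  interpret W: normed_sp W by fact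
  show ?case by (rule bounded_linI[where C = 0]) auto
next
  case (insert j I)
  have "bounded_lin W V (\<lambda>x. f j x \<oplus> (\<Oplus>i\<in>I. f i x))"
    using insert by (intro bounded_lin_sum W) auto
  moreover have "(\<Oplus>i\<in>insert j I. f i x) = f j x \<oplus> (\<Oplus>i\<in>I. f i x)" if "x \<in> carrier W" for x
    using insert that by (intro M.finsum_insert) (auto intro: bounded_lin_closed)
  ultimately show ?case
    by (rule bounded_lin_cong[OF W, rotated]) simp
qed

end

context banach_alg
begin

lemma mult_bound':
  obtains C where "0 \<le> C" "\<And>x y. x \<in> carrier A \<Longrightarrow> y \<in> carrier A \<Longrightarrow> nrm A (x \<otimes> y) \<le> C * (nrm A x * nrm A y)"
proof -
  obtain C where C: "\<And>x y. x \<in> carrier A \<Longrightarrow> y \<in> carrier A \<Longrightarrow> nrm A (x \<otimes> y) \<le> C * nrm A x * nrm A y"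
    using mult_bound by blast
  have "nrm A (x \<otimes> y) \<le> max C 0 * (nrm A x * nrm A y)" if "x \<in> carrier A" "y \<in> carrier A" for x y
  proof -
    have "C * (nrm A x * nrm A y) \<le> max C 0 * (nrm A x * nrm A y)"
      using that by (intro mult_right_mono) (auto simp: nrm_nonneg)
    then show ?thesis using C[OF that] by (simp add: mult.assoc)
  qed
  then show thesis by (intro that[of "max C 0"]) auto
qed

lemma bounded_lin_mult_right: "u \<in> carrier A \<Longrightarrow> bounded_lin A A (\<lambda>x. x \<otimes> u)"
proof -
  assume u: "u \<in> carrier A"
  obtain C where C: "\<And>x y. x \<in> carrier A \<Longrightarrow> y \<in> carrier A \<Longrightarrow> nrm A (x \<otimes> y) \<le> C * (nrm A x * nrm A y)"
    using mult_bound' by metis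
  show ?thesis
    by (rule bounded_linI[where C = "C * nrm A u"]) (use u C in \<open>auto simp: l_distr mult_sm1 mult_ac\<close>)
qed

lemma bounded_lin_mult_left: "u \<in> carrier A \<Longrightarrow> bounded_lin A A (\<lambda>x. u \<otimes> x)"
proof -
  assume u: "u \<in> carrier A"
  obtain C where C: "\<And>x y. x \<in> carrier A \<Longrightarrow> y \<in> carrier A \<Longrightarrow> nrm A (x \<otimes> y) \<le> C * (nrm A x * nrm A y)"
    using mult_bound' by metis
  show ?thesis
  proof (rule bounded_linI)
    fix x assume "x \<in> carrier A"
    then show "nrm A (u \<otimes> x) \<le> (C * nrm A u) * nrm A x" using C[OF u] by (simp add: mult.assoc)
  qed (use u in \<open>auto simp: r_distr mult_sm2\<close>)
qed

end

text \<open>With \<open>T\<close> the truncation of \<open>F\<close> before degree \<open>n\<close>, the identity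
  \<open>a' (x y) T - T (a (x y)) = a' x (a' y T - T (a y)) + (a' x T - T (a x)) a y\<close>
  shows that the coefficient of \<open>a' x T - T (a x)\<close> in degree \<open>n\<close> is a derivation of \<open>x\<close>.\<close>

lemma conjugating_series:
  fixes U :: "('k::complete_nonarch_field, 'u) nspace" and V :: "('k, 'v) nspace"
  assumes "banach_alg U" "banach_alg V"
    and a: "\<And>n. bounded_lin U V (\<lambda>x. a x n)" and a': "\<And>n. bounded_lin U V (\<lambda>x. a' x n)"
    and a_mult: "\<And>x y. x \<in> carrier U \<Longrightarrow> y \<in> carrier U \<Longrightarrow> a (x \<otimes>\<^bsub>U\<^esub> y) = cauchy V (a x) (a y)"
    and a'_mult: "\<And>x y. x \<in> carrier U \<Longrightarrow> y \<in> carrier U \<Longrightarrow> a' (x \<otimes>\<^bsub>U\<^esub> y) = cauchy V (a' x) (a' y)"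
    and a0: "\<And>x. x \<in> carrier U \<Longrightarrow> a' x 0 = a x 0"
    and inner: "\<And>D. \<lbrakk>bounded_lin U V D; \<And>x y. x \<in> carrier U \<Longrightarrow> y \<in> carrier U \<Longrightarrow>
        D (x \<otimes>\<^bsub>U\<^esub> y) = a x 0 \<otimes>\<^bsub>V\<^esub> D y \<oplus>\<^bsub>V\<^esub> D x \<otimes>\<^bsub>V\<^esub> a y 0\<rbrakk>
      \<Longrightarrow> \<exists>u\<in>carrier V. \<forall>x\<in>carrier U. D x = a x 0 \<otimes>\<^bsub>V\<^esub> u \<ominus>\<^bsub>V\<^esub> u \<otimes>\<^bsub>V\<^esub> a x 0"
  shows "\<exists>F. F \<in> UNIV \<rightarrow> carrier V \<and> F 0 = \<one>\<^bsub>V\<^esub> \<and> (\<forall>x\<in>carrier U. cauchy V F (a x) = cauchy V (a' x) F)"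
proof -
  interpret U: banach_alg U by fact
  interpret V: banach_alg V by fact
  interpret S: ring "fps_ring V" by (rule V.fps_ring_ring)
  have ac: "a x \<in> UNIV \<rightarrow> carrier V" and a'c: "a' x \<in> UNIV \<rightarrow> carrier V" if "x \<in> carrier U" for x
    using bounded_lin_closed[OF a that] bounded_lin_closed[OF a' that] by auto
  \<comment> \<open>The relation is imposed one degree at a time: degree \<open>n\<close> sees
    \<open>F\<close> below \<open>n\<close> and the candidate \<open>r\<close>, so the coefficients
    can be chosen recursively, with no uniformity in \<open>n\<close>.\<close>
  define P where "P F n r \<longleftrightarrow> r \<in> carrier V \<and> (n = 0 \<longrightarrow> r = \<one>\<^bsub>V\<^esub>) \<and>
    (\<forall>x\<in>carrier U. cauchy V (\<lambda>i. if i < n then F i else r) (a x) n =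
      cauchy V (a' x) (\<lambda>i. if i < n then F i else r) n)" for F n r
  have "\<exists>F. \<forall>n. P F n (F n)"
  proof (rule dependent_wf_choice[OF wf_less_than])
    fix F F' :: "nat \<Rightarrow> 'v" and n r
    assume eq: "\<And>z. (z, n) \<in> less_than \<Longrightarrow> F z = F' z"
    then have "(\<lambda>i. if i < n then F i else r) = (\<lambda>i. if i < n then F' i else r)" by auto
    then show "P F n r = P F' n r" by (simp only: P_def)
  next
    fix n and F :: "nat \<Rightarrow> 'v"
    assume "\<And>m. (m, n) \<in> less_than \<Longrightarrow> P F m (F m)"
    then have PF: "P F m (F m)" if "m < n" for m using that by auto
    show "\<exists>r. P F n r"
    proof (cases "n = 0")
      case True
      \<comment> \<open>In degree 0, with coefficient 1, the relation says that \<open>a\<close> and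
        \<open>a'\<close> agree there; this is where the congruence modulo \<hbar> enters.\<close>
      have "cauchy V (\<lambda>i. \<one>\<^bsub>V\<^esub>) (a x) 0 = cauchy V (a' x) (\<lambda>i. \<one>\<^bsub>V\<^esub>) 0" if "x \<in> carrier U" for x
        using ac[OF that] a0[OF that] by (simp add: cauchy_def Pi_iff)
      then show ?thesis using True by (intro exI[of _ "\<one>\<^bsub>V\<^esub>"]) (auto simp: P_def)
    next
      case False
      define T where "T i = (if i < n then F i else \<zero>\<^bsub>V\<^esub>)" for i
      have Fc: "F m \<in> carrier V" if "m < n" for m using PF[OF that] by (simp add: P_def)
      have T: "T \<in> UNIV \<rightarrow> carrier V" using Fc by (auto simp: T_def)
      define E where "E x = cauchy V (a' x) T \<ominus>\<^bsub>fps_ring V\<^esub> cauchy V T (a x)" for x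
      have Ec: "E x \<in> UNIV \<rightarrow> carrier V" if "x \<in> carrier U" for x
        using S.minus_closed[of "cauchy V (a' x) T" "cauchy V T (a x)"] V.cauchy_closed ac[OF that] a'c[OF that] T
        by (simp add: E_def)
      have En: "E x m = cauchy V (a' x) T m \<ominus>\<^bsub>V\<^esub> cauchy V T (a x) m" if "x \<in> carrier U" for x m
        using V.fps_ring_minus[of "cauchy V (a' x) T" "cauchy V T (a x)"] V.cauchy_closed ac[OF that] a'c[OF that] T
        by (simp add: E_def)
      \<comment> \<open>Below degree \<open>n\<close> the truncation \<open>T\<close> agrees with
        the coefficients already chosen, so the relations solved so far make the defect
        \<open>E x\<close> start in degree \<open>n\<close>.\<close>
      have E0: "E x m = \<zero>\<^bsub>V\<^esub>" if x: "x \<in> carrier U" and m: "m < n" for x m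
      proof -
        let ?H = "\<lambda>i. if i < m then F i else F m"
        have H: "?H \<in> UNIV \<rightarrow> carrier V" using Fc m by auto
        have "cauchy V T (a x) m = cauchy V ?H (a x) m" "cauchy V (a' x) T m = cauchy V (a' x) ?H m"
          using m by (intro V.cauchy_cong H ac a'c x; auto simp: T_def)+
        moreover have "cauchy V ?H (a x) m = cauchy V (a' x) ?H m"
          using PF[OF m] x by (simp add: P_def)
        moreover have "cauchy V (a' x) ?H m \<in> carrier V"
          by (intro V.cauchy_closed a'c x H)
        ultimately show ?thesis by (simp add: En[OF x] a_minus_def V.M.r_neg)
      qed
      define D where "D x = cauchy V (a' x) T n \<ominus>\<^bsub>V\<^esub> cauchy V T (a x) n" for x
      have DE: "D x = E x n" if "x \<in> carrier U" for x using En[OF that] by (simp add: D_def)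
      \<comment> \<open>For fixed \<open>n\<close> this is a finite combination of products of
        bounded coefficient maps with fixed elements of \<open>V\<close>.\<close>
      have D: "bounded_lin U V D"
        unfolding D_def cauchy_def
      proof (intro V.bounded_lin_diff V.bounded_lin_finsum U.normed_sp_self finite_atMost)
        fix i
        show "bounded_lin U V (\<lambda>x. a' x i \<otimes>\<^bsub>V\<^esub> T (n - i))"
          using T by (intro bounded_lin_comp[OF U.normed_sp_self V.normed_sp_self a'] V.bounded_lin_mult_right) auto
        show "bounded_lin U V (\<lambda>x. T i \<otimes>\<^bsub>V\<^esub> a x (n - i))"
          using T by (intro bounded_lin_comp[OF U.normed_sp_self V.normed_sp_self a] V.bounded_lin_mult_left) auto
      qed
      have D_mult: "D (x \<otimes>\<^bsub>U\<^esub> y) = a x 0 \<otimes>\<^bsub>V\<^esub> D y \<oplus>\<^bsub>V\<^esub> D x \<otimes>\<^bsub>V\<^esub> a y 0"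
        if x: "x \<in> carrier U" and y: "y \<in> carrier U" for x y
      proof -
        note xy = U.m_closed[OF x y]
        let ?S = "fps_ring V"
        have c: "a x \<in> carrier ?S" "a' x \<in> carrier ?S" "a y \<in> carrier ?S" "a' y \<in> carrier ?S" "T \<in> carrier ?S"
          using ac a'c x y T by auto
        have "E (x \<otimes>\<^bsub>U\<^esub> y) = (a' x \<otimes>\<^bsub>?S\<^esub> a' y) \<otimes>\<^bsub>?S\<^esub> T \<ominus>\<^bsub>?S\<^esub> T \<otimes>\<^bsub>?S\<^esub> (a x \<otimes>\<^bsub>?S\<^esub> a y)"
          using a_mult[OF x y] a'_mult[OF x y] by (simp add: E_def)
        also have "\<dots> = a' x \<otimes>\<^bsub>?S\<^esub> (a' y \<otimes>\<^bsub>?S\<^esub> T \<ominus>\<^bsub>?S\<^esub> T \<otimes>\<^bsub>?S\<^esub> a y)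
            \<oplus>\<^bsub>?S\<^esub> (a' x \<otimes>\<^bsub>?S\<^esub> T \<ominus>\<^bsub>?S\<^esub> T \<otimes>\<^bsub>?S\<^esub> a x) \<otimes>\<^bsub>?S\<^esub> a y"
          using c by algebra
        finally have "E (x \<otimes>\<^bsub>U\<^esub> y) n = cauchy V (a' x) (E y) n \<oplus>\<^bsub>V\<^esub> cauchy V (E x) (a y) n"
          by (simp add: E_def)
        moreover have "cauchy V (a' x) (E y) n = a' x 0 \<otimes>\<^bsub>V\<^esub> E y n"
          by (rule V.cauchy_low(2)[OF Ec[OF y] a'c[OF x] E0[OF y]])
        moreover have "cauchy V (E x) (a y) n = E x n \<otimes>\<^bsub>V\<^esub> a y 0"
          by (rule V.cauchy_low(1)[OF Ec[OF x] ac[OF y] E0[OF x]])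
        ultimately show ?thesis
          using DE x y xy a0[OF x] by simp
      qed
      obtain u where u: "u \<in> carrier V" "\<And>x. x \<in> carrier U \<Longrightarrow> D x = a x 0 \<otimes>\<^bsub>V\<^esub> u \<ominus>\<^bsub>V\<^esub> u \<otimes>\<^bsub>V\<^esub> a x 0"
        using inner[OF D D_mult] by blast
      \<comment> \<open>With z = a x 0, the new coefficient adds r z to one side of the relation and
        z r to the other in degree \<open>n\<close>. The defect is D x = z u - u z, which r = -u
        cancels.\<close>
      define r where "r = \<ominus>\<^bsub>V\<^esub> u"
      have r: "r \<in> carrier V" using u by (simp add: r_def)
      define R where "R i = (if i < n then \<zero>\<^bsub>V\<^esub> else r)" for i
      have R: "R \<in> UNIV \<rightarrow> carrier V" using r by (auto simp: R_def)
      have eq: "(\<lambda>i. if i < n then F i else r) = (\<lambda>i. T i \<oplus>\<^bsub>V\<^esub> R i)"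
        using Fc r by (auto simp: T_def R_def)
      have "cauchy V (\<lambda>i. if i < n then F i else r) (a x) n =
          cauchy V (a' x) (\<lambda>i. if i < n then F i else r) n" if x: "x \<in> carrier U" for x
      proof -
        let ?p = "cauchy V T (a x) n" and ?q = "cauchy V (a' x) T n" and ?z = "a x 0"
        have c: "?p \<in> carrier V" "?q \<in> carrier V" "?z \<in> carrier V"
          using V.cauchy_closed ac[OF x] a'c[OF x] T by auto
        have 1: "cauchy V (\<lambda>i. if i < n then F i else r) (a x) n = ?p \<oplus>\<^bsub>V\<^esub> r \<otimes>\<^bsub>V\<^esub> ?z"
          unfolding eq V.cauchy_add(1)[OF T R ac[OF x]]
          using V.cauchy_low(1)[OF R ac[OF x], of n] by (simp add: R_def)
        have 2: "cauchy V (a' x) (\<lambda>i. if i < n then F i else r) n = ?q \<oplus>\<^bsub>V\<^esub> ?z \<otimes>\<^bsub>V\<^esub> r"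
          unfolding eq V.cauchy_add(2)[OF T R a'c[OF x]]
          using V.cauchy_low(2)[OF R a'c[OF x], of n] a0[OF x] by (simp add: R_def)
        have q: "?q = ?p \<oplus>\<^bsub>V\<^esub> (?z \<otimes>\<^bsub>V\<^esub> u \<ominus>\<^bsub>V\<^esub> u \<otimes>\<^bsub>V\<^esub> ?z)"
          using u(2)[OF x] V.add_diff_cancel[OF c(1,2)] by (simp add: D_def)
        have "?p \<oplus>\<^bsub>V\<^esub> (\<ominus>\<^bsub>V\<^esub> u) \<otimes>\<^bsub>V\<^esub> ?z =
            ?p \<oplus>\<^bsub>V\<^esub> (?z \<otimes>\<^bsub>V\<^esub> u \<ominus>\<^bsub>V\<^esub> u \<otimes>\<^bsub>V\<^esub> ?z) \<oplus>\<^bsub>V\<^esub> ?z \<otimes>\<^bsub>V\<^esub> (\<ominus>\<^bsub>V\<^esub> u)"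
          using c u(1) by algebra
        then show ?thesis
          unfolding 1 2 q by (simp add: r_def)
      qed
      then show ?thesis using r False by (auto simp: P_def)
    qed
  qed
  then obtain F where F: "\<And>n. P F n (F n)" by blast
  have Fc: "F \<in> UNIV \<rightarrow> carrier V" using F by (auto simp: P_def)
  have "cauchy V F (a x) = cauchy V (a' x) F" if x: "x \<in> carrier U" for x
  proof
    fix n
    let ?H = "\<lambda>i. if i < n then F i else F n"
    have H: "?H \<in> UNIV \<rightarrow> carrier V" using Fc by (auto simp: Pi_iff)
    have "cauchy V F (a x) n = cauchy V ?H (a x) n" "cauchy V (a' x) F n = cauchy V (a' x) ?H n"
      by (intro V.cauchy_cong H ac a'c x; auto)+
    then show "cauchy V F (a x) n = cauchy V (a' x) F n"
      using F[of n] x by (simp add: P_def)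
  qed
  then show ?thesis using Fc F[of 0] by (auto simp: P_def)
qed

section \<open>The analytic enveloping algebras\<close>

text \<open>\<open>tate_tensor\<close>, \<open>H0\<close> and \<open>U\<close> all arise from a bare
  normed space by overwriting these two fields, so their linear structure and norm are
  inherited.\<close>

abbreviation with_mult :: "('k, 'v) nspace \<Rightarrow> ('v \<Rightarrow> 'v \<Rightarrow> 'v) \<Rightarrow> 'v \<Rightarrow> ('k, 'v) nspace" where
  "with_mult V m e \<equiv> V\<lparr>monoid.mult := m, one := e\<rparr>"

lemma bounded_lin_with_mult [simp]: "bounded_lin (with_mult V m e) W f \<longleftrightarrow> bounded_lin V W f"
  by (simp add: bounded_lin_def)

lemma normed_sp_with_mult:
  assumes "normed_sp V"
  shows "normed_sp (with_mult V m e)"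
proof -
  interpret V: normed_sp V by fact
  show ?thesis
  proof (rule normed_spI)
    show "abelian_group (with_mult V m e)"
      using V.M.abelian_group_axioms
      by (simp add: abelian_group_def abelian_monoid_def abelian_group_axioms_def)
  qed (auto simp: V.sm_add V.sm_r_add V.sm_assoc V.nrm_nonneg V.nrm_eq_0_iff V.nrm_smult V.nrm_add)
qed

text \<open>The product of \<open>H0\<close> is a sum over submultisets, and a sum over an infinite
  index set would be 0 by convention.\<close>

lemma finite_submsets: "finite {p. p \<subseteq># m}"
proof (induction m)
  case (add a m)
  have "{p. p \<subseteq># add_mset a m} \<subseteq> {p. p \<subseteq># m} \<union> add_mset a ` {p. p \<subseteq># m}"
  proof
    fix p assume p: "p \<in> {p. p \<subseteq># add_mset a m}"
    show "p \<in> {p. p \<subseteq># m} \<union> add_mset a ` {p. p \<subseteq># m}"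
    proof (cases "a \<in># p")
      case True
      then obtain q where "p = add_mset a q" by (metis multi_member_split)
      then show ?thesis using p by auto
    next
      case False
      have "p \<subseteq># m"
      proof (rule mset_subset_eqI)
        fix x show "count p x \<le> count m x"
          using mset_subset_eq_count[of p "add_mset a m" x] p False
          by (cases "x = a") (auto simp: not_in_iff)
      qed
      then show ?thesis by simp
    qed
  qed
  then show ?case using add finite_subset by blast
qed auto

lemma H0_normed: "normed_sp (H0 I :: ('k::complete_nonarch_field, 'i multiset \<Rightarrow> 'k) nspace)"
  unfolding H0_def by (intro normed_sp_with_mult c0_normed) simp

lemma H0_single: "set_mset m \<subseteq> I \<Longrightarrow> single m \<in> carrier (H0 I)"
  by (simp add: H0_def single_carrier)

lemma H0_one: "\<one>\<^bsub>H0 I\<^esub> = single {#}"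
  by (simp add: H0_def)

lemma H0_mult_single: "single {#i#} \<otimes>\<^bsub>H0 I\<^esub> single m = single (add_mset i m)"
proof
  fix q
  have "(single {#i#} \<otimes>\<^bsub>H0 I\<^esub> single m) q = (\<Sum>p\<in>{p. p \<subseteq># q}. if p = {#i#} then single m (q - {#i#}) else 0)"
    by (auto simp: H0_def single_def intro!: sum.cong)
  also have "\<dots> = (if i \<in># q then single m (q - {#i#}) else 0)"
    by (simp add: finite_submsets)
  also have "\<dots> = single (add_mset i m) q"
    by (auto simp: single_def)
  finally show "(single {#i#} \<otimes>\<^bsub>H0 I\<^esub> single m) q = single (add_mset i m) q" .
qed

section \<open>The Tate tensor algebra and its quotient by the Serre relations\<close>

locale tate =
  fixes I :: "'i set" and r :: real and T :: "('k::complete_nonarch_field, 'i list \<Rightarrow> 'k) nspace"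
  assumes r_pos: "0 < r" and T_def: "T = tate_tensor I r"
begin

lemma wt_pos: "w \<in> lists I \<Longrightarrow> 0 < r ^ length w"
  using r_pos by simp

lemma T_with_mult: "T = with_mult (c0 (lists I) (\<lambda>w. r ^ length w))
    (\<lambda>f g w. \<Sum>n\<le>length w. f (take n w) * g (drop n w)) (single [])"
  by (simp add: T_def tate_tensor_def)

lemma T_simps:
  "zero T = (\<lambda>_. 0)" "add T = (\<lambda>f g s. f s + g s)" "smult T = (\<lambda>c f s. c * f s)" "one T = single []"
  "monoid.mult T = (\<lambda>f g w. \<Sum>n\<le>length w. f (take n w) * g (drop n w))"
  "carrier T = carrier (c0 (lists I) (\<lambda>w. r ^ length w))" "nrm T = nrm (c0 (lists I) (\<lambda>w. r ^ length w))"
  by (simp_all add: T_with_mult)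

lemma T_normed: "normed_sp T"
  unfolding T_with_mult by (intro normed_sp_with_mult c0_normed wt_pos)

lemma single_T: "w \<in> lists I \<Longrightarrow> single w \<in> carrier T"
  unfolding T_simps by (rule single_carrier)

text \<open>By the ultrametric inequality a large coefficient at \<open>w\<close> forces a cut of
  \<open>w\<close> into \<open>u\<close> and \<open>v\<close> for which the product of
  \<open>f u\<close> and \<open>g v\<close> is large. Each of the two is then large because the
  other is bounded, and there are only finitely many such pairs.\<close>

lemma conv_closed:
  assumes f: "f \<in> carrier T" and g: "g \<in> carrier T"
  shows "f \<otimes>\<^bsub>T\<^esub> g \<in> carrier T"
proof -
  let ?c = "c0 (lists I) (\<lambda>w. r ^ length w) :: ('k, 'i list \<Rightarrow> 'k) nspace"
  have f': "f \<in> carrier ?c" and g': "g \<in> carrier ?c" using f g by (auto simp: T_simps)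
  \<comment> \<open>One is added to keep \<open>F\<close> and \<open>G\<close> positive, also for
    the zero family.\<close>
  define F where "F = nrm ?c f + 1"
  define G where "G = nrm ?c g + 1"
  have FG: "F > 0" "G > 0" using c0_nrm_nonneg[OF f'] c0_nrm_nonneg[OF g'] by (auto simp: F_def G_def)
  have fF: "absv (f w) * r ^ length w \<le> F" and gG: "absv (g w) * r ^ length w \<le> G" if "w \<in> lists I" for w
    using c0_le_nrm[OF f' that] c0_le_nrm[OF g' that] by (auto simp: F_def G_def)
  define h where "h w = (\<Sum>n\<le>length w. f (take n w) * g (drop n w))" for w
  have "h \<in> carrier ?c"
    unfolding c0_carrier
  proof (intro conjI allI impI)
    fix w :: "'i list" assume w: "w \<notin> lists I"
    have z: "f (take n w) * g (drop n w) = 0" for n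
    proof -
      have "take n w \<notin> lists I \<or> drop n w \<notin> lists I"
        using w by (metis append_in_lists_conv append_take_drop_id)
      then show ?thesis using f' g' by (auto simp: c0_carrier)
    qed
    show "h w = 0"
      unfolding h_def by (intro sum.neutral ballI z)
  next
    fix e :: real assume e: "e > 0"
    let ?A = "{u\<in>lists I. e / G \<le> absv (f u) * r ^ length u}"
    let ?B = "{v\<in>lists I. e / F \<le> absv (g v) * r ^ length v}"
    have fin: "finite ((\<lambda>(u, v). u @ v) ` (?A \<times> ?B))"
      using f' g' FG e by (intro finite_imageI finite_cartesian_product) (auto simp: c0_carrier)
    have "{w\<in>lists I. e \<le> absv (h w) * r ^ length w}
        \<subseteq> (\<lambda>(u, v). u @ v) ` (?A \<times> ?B)"
    proof
      fix w assume "w \<in> {w\<in>lists I. e \<le> absv (h w) * r ^ length w}"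
      then have w: "w \<in> lists I" and ew: "e \<le> absv (h w) * r ^ length w" by auto
      have "\<exists>n\<le>length w. absv (h w) \<le> absv (f (take n w) * g (drop n w))"
      proof -
        \<comment> \<open>An ultrametric sum is dominated by one of its terms.\<close>
        have "\<exists>n\<le>N. absv (\<Sum>n\<le>N. c n) \<le> absv (c n)" for c :: "nat \<Rightarrow> 'k" and N
        proof (induction N)
          case (Suc N)
          then obtain n where n: "n \<le> N" "absv (\<Sum>n\<le>N. c n) \<le> absv (c n)" by blast
          have "absv (\<Sum>n\<le>Suc N. c n) \<le> max (absv (\<Sum>n\<le>N. c n)) (absv (c (Suc N)))"
            using absv_ultrametric by simp
          then have "absv (\<Sum>n\<le>Suc N. c n) \<le> absv (c n) \<or> absv (\<Sum>n\<le>Suc N. c n) \<le> absv (c (Suc N))"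
            using n(2) by linarith
          then show ?case using n(1) le_SucI by blast
        qed auto
        then show ?thesis unfolding h_def .
      qed
      then obtain n where n: "n \<le> length w"
        "absv (h w) \<le> absv (f (take n w) * g (drop n w))" by blast
      define u v where "u = take n w" and "v = drop n w"
      have uv: "w = u @ v" "u \<in> lists I" "v \<in> lists I"
        using w by (auto simp: u_def v_def dest: in_set_takeD in_set_dropD)
      have "e \<le> absv (f u * g v) * r ^ length w"
        using ew n(2) r_pos by (smt (verit) mult_right_mono u_def v_def zero_le_power)
      also have "\<dots> = (absv (f u) * r ^ length u) * (absv (g v) * r ^ length v)"
        by (simp add: absv_mult uv(1) power_add)
      finally have p: "e \<le> (absv (f u) * r ^ length u) * (absv (g v) * r ^ length v)" .
      have nn: "0 \<le> absv (f u) * r ^ length u" "0 \<le> absv (g v) * r ^ length v"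
        using r_pos by (auto simp: absv_nonneg)
      have "e \<le> (absv (f u) * r ^ length u) * G"
        using p mult_left_mono[OF gG[OF uv(3)] nn(1)] by linarith
      moreover have "e \<le> F * (absv (g v) * r ^ length v)"
        using p mult_right_mono[OF fF[OF uv(2)] nn(2)] by linarith
      ultimately have "u \<in> ?A" "v \<in> ?B"
        using FG uv by (auto simp: field_simps)
      then show "w \<in> (\<lambda>(u, v). u @ v) ` (?A \<times> ?B)" using uv(1) by force
    qed
    then show "finite {w\<in>lists I. e \<le> absv (h w) * r ^ length w}"
      using fin finite_subset by blast
  qed
  then show ?thesis
    by (simp add: T_simps h_def[abs_def])
qed

text \<open>Both sides sum over the ways to cut \<open>w\<close> into three consecutive pieces;
  \<open>sum.triangle_reindex_eq\<close> passes from positions of the cuts to lengths of the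
  pieces.\<close>

lemma conv_assoc: "(f \<otimes>\<^bsub>T\<^esub> g) \<otimes>\<^bsub>T\<^esub> h = f \<otimes>\<^bsub>T\<^esub> (g \<otimes>\<^bsub>T\<^esub> h)"
proof
  fix w :: "'i list"
  let ?L = "length w"
  let ?b = "\<lambda>i j. f (take i w) * g (take j (drop i w)) * h (drop j (drop i w))"
  have "((f \<otimes>\<^bsub>T\<^esub> g) \<otimes>\<^bsub>T\<^esub> h) w = (\<Sum>n\<le>?L. \<Sum>m\<le>n. ?b m (n - m))"
    unfolding T_simps sum_distrib_right
    by (intro sum.cong refl) (auto simp: min_absorb1 min_absorb2 drop_take)
  also have "\<dots> = (\<Sum>(i, j)\<in>{(i, j). i + j \<le> ?L}. ?b i j)"
    by (rule sum.triangle_reindex_eq[symmetric])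
  also have "{(i, j). i + j \<le> ?L} = (SIGMA i:{..?L}. {..?L - i})"
    by auto
  also have "(\<Sum>(i, j)\<in>\<dots>. ?b i j) = (\<Sum>i\<le>?L. \<Sum>j\<le>?L - i. ?b i j)"
    by (rule sum.Sigma[symmetric]) auto
  also have "\<dots> = (f \<otimes>\<^bsub>T\<^esub> (g \<otimes>\<^bsub>T\<^esub> h)) w"
    unfolding T_simps sum_distrib_left by (intro sum.cong refl) (auto simp: mult.assoc)
  finally show "((f \<otimes>\<^bsub>T\<^esub> g) \<otimes>\<^bsub>T\<^esub> h) w = (f \<otimes>\<^bsub>T\<^esub> (g \<otimes>\<^bsub>T\<^esub> h)) w" .
qed

lemma conv_single: "single [i] \<otimes>\<^bsub>T\<^esub> single v = single (i # v)"
proof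
  fix w :: "'i list"
  show "(single [i] \<otimes>\<^bsub>T\<^esub> single v) w = single (i # v) w"
  proof (cases w)
    case (Cons j u)
    have "(single [i] \<otimes>\<^bsub>T\<^esub> single v) w = (\<Sum>n\<le>length w. if n = 1 then single [i] [j] * single v u else 0)"
      unfolding T_simps
    proof (intro sum.cong refl)
      fix n assume "n \<in> {..length w}"
      then show "single [i] (take n w) * single v (drop n w) = (if n = 1 then single [i] [j] * single v u else (0::'k))"
        using Cons by (cases n; cases "n - 1"; cases u) (auto simp: single_def)
    qed
    also have "\<dots> = single [i] [j] * single v u" by (subst sum.delta) (use Cons in auto)
    finally show ?thesis using Cons by (auto simp: single_def)
  qed (auto simp: T_simps single_def)
qed

lemma conv_one:
  "single [] \<otimes>\<^bsub>T\<^esub> f = f" "f \<otimes>\<^bsub>T\<^esub> single [] = f"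
proof -
  show "single [] \<otimes>\<^bsub>T\<^esub> f = f"
  proof
    fix w :: "'i list"
    have "(single [] \<otimes>\<^bsub>T\<^esub> f) w = (\<Sum>n\<le>length w. if n = 0 then f w else 0)"
      unfolding T_simps by (intro sum.cong refl) (auto simp: single_def)
    then show "(single [] \<otimes>\<^bsub>T\<^esub> f) w = f w" by simp
  qed
  show "f \<otimes>\<^bsub>T\<^esub> single [] = f"
  proof
    fix w :: "'i list"
    have "(f \<otimes>\<^bsub>T\<^esub> single []) w = (\<Sum>n\<le>length w. if n = length w then f w else 0)"
      unfolding T_simps by (intro sum.cong refl) (auto simp: single_def)
    then show "(f \<otimes>\<^bsub>T\<^esub> single []) w = f w" by simp
  qed
qed

lemma T_ring: "ring T"
proof (rule ringI)
  show "abelian_group T"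
    using T_normed normed_sp.axioms(1) module.axioms(2) by blast
  show "monoid T"
    by (rule monoidI) (auto simp: conv_closed conv_assoc T_simps(4) conv_one intro: single_T)
  fix f g h :: "'i list \<Rightarrow> 'k"
  show "(f \<oplus>\<^bsub>T\<^esub> g) \<otimes>\<^bsub>T\<^esub> h = f \<otimes>\<^bsub>T\<^esub> h \<oplus>\<^bsub>T\<^esub> g \<otimes>\<^bsub>T\<^esub> h"
    by (simp add: T_simps algebra_simps sum.distrib fun_eq_iff)
  show "h \<otimes>\<^bsub>T\<^esub> (f \<oplus>\<^bsub>T\<^esub> g) = h \<otimes>\<^bsub>T\<^esub> f \<oplus>\<^bsub>T\<^esub> h \<otimes>\<^bsub>T\<^esub> g"
    by (simp add: T_simps algebra_simps sum.distrib fun_eq_iff)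
qed

text \<open>Scalars act through multiples of the unit, so a two-sided ideal is automatically a
  subspace.\<close>

lemma T_smult: "c \<odot>\<^bsub>T\<^esub> f = (c \<odot>\<^bsub>T\<^esub> \<one>\<^bsub>T\<^esub>) \<otimes>\<^bsub>T\<^esub> f"
proof -
  have "(c \<odot>\<^bsub>T\<^esub> \<one>\<^bsub>T\<^esub>) \<otimes>\<^bsub>T\<^esub> f = c \<odot>\<^bsub>T\<^esub> (\<one>\<^bsub>T\<^esub> \<otimes>\<^bsub>T\<^esub> f)"
    by (simp add: T_simps sum_distrib_left mult.assoc)
  then show ?thesis by (simp add: T_simps(4) conv_one)
qed

lemma serre_T: "i \<in> I \<Longrightarrow> j \<in> I \<Longrightarrow> serre a i j \<in> carrier T"
proof -
  assume ij: "i \<in> I" "j \<in> I"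
  let ?N = "nat (1 - a i j)"
  show ?thesis
    unfolding T_simps
  proof (rule c0_finite_support)
    let ?W = "(\<lambda>m. replicate (?N - m) i @ [j] @ replicate m i) ` {..?N}"
    show "finite ?W" by simp
    show "?W \<subseteq> lists I" using ij by auto
    fix w assume "w \<notin> ?W"
    then show "serre a i j w = (0::'k)"
      by (auto simp: serre_def single_def Let_def intro!: sum.neutral)
  qed
qed

text \<open>Being at once an ideal and a closed subspace, \<open>N\<close> admits both the ring
  structure on cosets and the quotient norm.\<close>

lemma serre_ideal_props:
  assumes N: "N = serre_ideal I a r"
  shows "ideal N T" "closed_sub T N"
proof -
  interpret T: normed_sp T by (rule T_normed)
  interpret R: ring T by (rule T_ring)
  let ?F = "{J. ideal J T \<and> closed_set T J \<and> {serre a i j |i j. i \<in> I \<and> j \<in> I \<and> i \<noteq> j} \<subseteq> J}"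
  have NF: "N = \<Inter>?F" by (simp add: N serre_ideal_def closed_ideal_def T_def)
  have "carrier T \<in> ?F"
    using R.oneideal closed_set_carrier serre_T by blast
  then have ne: "?F \<noteq> {}" by blast
  show id: "ideal N T"
    unfolding NF by (rule R.i_Intersect[OF _ ne]) blast
  interpret ideal N T by (rule id)
  have sub: "submodule N (kban :: ('k, 'k) nspace) T"
  proof (rule T.submoduleI)
    fix c x assume x: "x \<in> N"
    show "c \<odot>\<^bsub>T\<^esub> x \<in> N"
      by (subst T_smult) (intro I_l_closed x T.sm_closed R.one_closed)
  qed (use a_subset in auto)
  have "closed_set T N"
    unfolding NF by (rule closed_set_Inter[OF ne]) blast
  then show "closed_sub T N"
    by (intro closed_sub.intro T_normed closed_sub_axioms.intro sub)
qed

end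

locale tate_quot = tate I r T
  for I :: "'i set" and r :: real and T :: "('k::complete_nonarch_field, 'i list \<Rightarrow> 'k) nspace" +
  fixes a :: "'i \<Rightarrow> 'i \<Rightarrow> int" and N :: "('i list \<Rightarrow> 'k::complete_nonarch_field) set"
  assumes N_def: "N = serre_ideal I a r"
begin

abbreviation (input) "cls f \<equiv> N +>\<^bsub>T\<^esub> f"

lemma U_half_quot: "U_half I a r = quot T N"
  by (simp add: U_half_def N_def T_def)

lemma N_sub: "closed_sub T N" and N_ideal: "ideal N T"
  using serre_ideal_props[OF N_def] by auto

lemma U_half_normed: "normed_sp (U_half I a r :: ('k, _) nspace)"
  unfolding U_half_quot by (rule closed_sub.quot_normed[OF N_sub])

lemma U_half_carrier: "carrier (U_half I a r) = (\<lambda>f. cls f) ` carrier T"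
  unfolding U_half_quot by (rule closed_sub.quot_simps(1)[OF N_sub])

lemma cls_bounded: "bounded_lin T (U_half I a r) (\<lambda>f. cls f)"
  unfolding U_half_quot by (rule closed_sub.quot_map[OF N_sub])

lemma U_half_one: "\<one>\<^bsub>U_half I a r\<^esub> = cls (single [])"
  by (simp add: U_half_quot quot_def T_simps)

lemma U_half_mult: "f \<in> carrier T \<Longrightarrow> g \<in> carrier T \<Longrightarrow> cls f \<otimes>\<^bsub>U_half I a r\<^esub> cls g = cls (f \<otimes>\<^bsub>T\<^esub> g)"
  using ideal.rcoset_mult_add[OF N_ideal] by (simp add: U_half_quot quot_def)

lemma U_gen_cls: "U_gen I a r i = cls (single [i])"
  by (simp add: U_gen_def N_def T_def)

lemma U_half_one_closed: "\<one>\<^bsub>U_half I a r :: ('k, _) nspace\<^esub> \<in> carrier (U_half I a r)"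
  unfolding U_half_one U_half_carrier by (intro imageI single_T) simp

text \<open>Every word arises from the unit by successive left multiplications with generators, and
  the classes of words span a dense subspace of the quotient.\<close>

lemma U_half_vanish:
  fixes Z :: "('k, 'z) nspace"
  assumes Z: "normed_sp Z" and Q: "bounded_lin (U_half I a r) Z Q"
    and one: "Q (\<one>\<^bsub>U_half I a r\<^esub>) = \<zero>\<^bsub>Z\<^esub>"
    and gen: "\<And>i y. i \<in> I \<Longrightarrow> y \<in> carrier (U_half I a r) \<Longrightarrow> Q y = \<zero>\<^bsub>Z\<^esub> \<Longrightarrow>
      Q (U_gen I a r i \<otimes>\<^bsub>U_half I a r\<^esub> y) = \<zero>\<^bsub>Z\<^esub>"
    and y: "y \<in> carrier (U_half I a r)"
  shows "Q y = \<zero>\<^bsub>Z\<^esub>"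
proof -
  have Qs: "Q (cls (single w)) = \<zero>\<^bsub>Z\<^esub>" if "w \<in> lists I" for w
    using that
  proof (induction w)
    case Nil
    then show ?case using one by (simp add: U_half_one)
  next
    case (Cons i w)
    then have "Q (U_gen I a r i \<otimes>\<^bsub>U_half I a r\<^esub> cls (single w)) = \<zero>\<^bsub>Z\<^esub>"
      by (intro gen) (auto simp: U_half_carrier intro!: imageI single_T)
    moreover have "single [i] \<in> carrier T" "single w \<in> carrier T"
      using Cons by (auto intro!: single_T)
    ultimately show ?case
      by (simp add: U_gen_cls U_half_mult conv_single)
  qed
  obtain f where f: "f \<in> carrier T" "y = cls f" using y by (auto simp: U_half_carrier)
  have B: "bounded_lin T Z (\<lambda>f. Q (cls f))"
    by (rule bounded_lin_comp[OF T_normed U_half_normed cls_bounded Q])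
  have "Q (cls f) = \<zero>\<^bsub>Z\<^esub>"
    by (rule c0_dense[where Q = "\<lambda>f. Q (cls f)", OF wt_pos Z _ Qs]) (use B f in \<open>simp_all add: T_with_mult\<close>)
  then show ?thesis using f by simp
qed

end

lemma tate_quotI: "0 < r \<Longrightarrow> tate_quot I r (tate_tensor I r) a (serre_ideal I a r)"
  by unfold_locales auto

text \<open>The commutative counterpart of \<open>U_half_vanish\<close>: monomials replace
  words.\<close>

lemma H0_vanish:
  fixes Z :: "('k::complete_nonarch_field, 'z) nspace"
  assumes Z: "normed_sp Z" and Q: "bounded_lin (H0 I) Z Q"
    and one: "Q (\<one>\<^bsub>H0 I\<^esub>) = \<zero>\<^bsub>Z\<^esub>"
    and gen: "\<And>i y. i \<in> I \<Longrightarrow> y \<in> carrier (H0 I) \<Longrightarrow> Q y = \<zero>\<^bsub>Z\<^esub> \<Longrightarrow>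
      Q (single {#i#} \<otimes>\<^bsub>H0 I\<^esub> y) = \<zero>\<^bsub>Z\<^esub>"
    and y: "y \<in> carrier (H0 I)"
  shows "Q y = \<zero>\<^bsub>Z\<^esub>"
proof -
  have Qs: "Q (single m) = \<zero>\<^bsub>Z\<^esub>" if "m \<in> {m. set_mset m \<subseteq> I}" for m
    using that
  proof (induction m)
    case empty
    then show ?case using one by (simp add: H0_one)
  next
    case (add i m)
    then have "Q (single {#i#} \<otimes>\<^bsub>H0 I\<^esub> single m) = \<zero>\<^bsub>Z\<^esub>"
      by (intro gen) (auto intro!: H0_single)
    then show ?case by (simp add: H0_mult_single)
  qed
  show ?thesis
    by (rule c0_dense[where Q = Q and S = "{m. set_mset m \<subseteq> I}" and wt = "\<lambda>_. 1", OF _ Z _ Qs]) (use Q y in \<open>simp_all add: H0_def\<close>)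
qed

text \<open>The kernel of a derivation along \<open>al\<close> contains the unit and is closed under
  products. Vanishing thus passes from the generators to each of the three factors, to the products
  y h x, and by density of elementary tensors to all of \<open>U\<close>.\<close>

lemma derivation_vanish:
  fixes U :: "('k::complete_nonarch_field, ('k, 'i) uan) nspace" and V :: "('k, 'v) nspace"
  assumes U: "is_U I a r s U" and rs: "0 < r" "0 < s"
    and V: "banach_alg V" and Q: "bounded_lin U V Q"
    and al: "\<And>x. x \<in> carrier U \<Longrightarrow> al x \<in> carrier V" and al1: "al \<one>\<^bsub>U\<^esub> = \<one>\<^bsub>V\<^esub>"
    and Qm: "\<And>x y. x \<in> carrier U \<Longrightarrow> y \<in> carrier U \<Longrightarrow>
      Q (x \<otimes>\<^bsub>U\<^esub> y) = al x \<otimes>\<^bsub>V\<^esub> Q y \<oplus>\<^bsub>V\<^esub> Q x \<otimes>\<^bsub>V\<^esub> al y"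
    and gens: "\<And>g. g \<in> genF I a r s ` I \<union> genH I a r s ` I \<union> genE I a r s ` I \<Longrightarrow> Q g = \<zero>\<^bsub>V\<^esub>"
    and X: "X \<in> carrier U"
  shows "Q X = \<zero>\<^bsub>V\<^esub>"
proof -
  interpret V: banach_alg V by fact
  interpret U: banach_alg U using U unfolding is_U_def banach_algebra_iff by blast
  interpret r: tate_quot I r "tate_tensor I r :: ('k, _) nspace" a "serre_ideal I a r" by (rule tate_quotI[OF rs(1)])
  interpret s: tate_quot I s "tate_tensor I s :: ('k, _) nspace" a "serre_ideal I a s" by (rule tate_quotI[OF rs(2)])
  let ?Y = "U_half I a r :: ('k, _) nspace" and ?H = "H0 I :: ('k, _) nspace" and ?X = "U_half I a s :: ('k, _) nspace"
  let ?t = "U_tens I a r s :: _ \<Rightarrow> _ \<Rightarrow> _ \<Rightarrow> ('k, 'i) uan"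
  interpret p1: normed_pair ?Y ?H by (intro normed_pair.intro r.U_half_normed H0_normed)
  interpret p2: normed_pair "tensor ?Y ?H" ?X by (intro normed_pair.intro p1.tensor_normed s.U_half_normed)
  note yhx = r.U_half_one_closed s.U_half_one_closed
  have h1: "\<one>\<^bsub>?H\<^esub> \<in> carrier ?H" unfolding H0_one by (rule H0_single) simp
  obtain m e where Ume: "U = with_mult (U_space I a r s) m e"
    using U unfolding is_U_def by blast
  have cU: "carrier U = carrier (tensor (tensor ?Y ?H) ?X)" by (simp add: Ume U_space_def)
  have Q': "bounded_lin (tensor (tensor ?Y ?H) ?X) V Q"
    using Q by (simp add: Ume U_space_def)
  have tc: "?t y h x \<in> carrier U" if "y \<in> carrier ?Y" "h \<in> carrier ?H" "x \<in> carrier ?X" for y h x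
    using that by (simp add: cU U_tens_def)
  have bw: "bounded_lin (tensor ?Y ?H) V (\<lambda>w. Q (tens (tensor ?Y ?H) ?X w x))" if "x \<in> carrier ?X" for x
    by (rule bounded_lin_comp[OF p1.tensor_normed p2.tensor_normed p2.tens_left_bounded[OF that] Q'])
  \<comment> \<open>Elementary tensors depend boundedly on each slot, so \<open>Q\<close> restricts
    to a bounded map on every factor, as the density lemmas require.\<close>
  have by': "bounded_lin ?Y V (\<lambda>y. Q (?t y \<one>\<^bsub>?H\<^esub> \<one>\<^bsub>?X\<^esub>))"
    unfolding U_tens_def
    by (rule bounded_lin_comp[OF p1.V.normed_sp_self p1.tensor_normed p1.tens_left_bounded[OF h1] bw[OF yhx(2)]])
  have bh': "bounded_lin ?H V (\<lambda>h. Q (?t \<one>\<^bsub>?Y\<^esub> h \<one>\<^bsub>?X\<^esub>))"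
    unfolding U_tens_def
    by (rule bounded_lin_comp[OF p1.W.normed_sp_self p1.tensor_normed p1.tens_right_bounded[OF yhx(1)] bw[OF yhx(2)]])
  have bx': "bounded_lin ?X V (\<lambda>x. Q (?t \<one>\<^bsub>?Y\<^esub> \<one>\<^bsub>?H\<^esub> x))"
    unfolding U_tens_def
    by (intro bounded_lin_comp[OF p2.W.normed_sp_self p2.tensor_normed p2.tens_right_bounded Q'] p1.tens_closed yhx h1)
  have homy: "(\<lambda>y. ?t y \<one>\<^bsub>?H\<^esub> \<one>\<^bsub>?X\<^esub>) \<in> ring_hom ?Y U"
    and homh: "(\<lambda>h. ?t \<one>\<^bsub>?Y\<^esub> h \<one>\<^bsub>?X\<^esub>) \<in> ring_hom ?H U"
    and homx: "(\<lambda>x. ?t \<one>\<^bsub>?Y\<^esub> \<one>\<^bsub>?H\<^esub> x) \<in> ring_hom ?X U"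
    and prod: "\<And>y h x. y \<in> carrier ?Y \<Longrightarrow> h \<in> carrier ?H \<Longrightarrow> x \<in> carrier ?X \<Longrightarrow>
      ?t y h x = ?t y \<one>\<^bsub>?H\<^esub> \<one>\<^bsub>?X\<^esub> \<otimes>\<^bsub>U\<^esub> ?t \<one>\<^bsub>?Y\<^esub> h \<one>\<^bsub>?X\<^esub> \<otimes>\<^bsub>U\<^esub> ?t \<one>\<^bsub>?Y\<^esub> \<one>\<^bsub>?H\<^esub> x"
    using U unfolding is_U_def by blast+
  have QV: "Q x \<in> carrier V" if "x \<in> carrier U" for x
    using bounded_lin_closed[OF Q that] .
  \<comment> \<open>The derivation law for the product of the unit with itself reads Q 1 = Q 1 + Q
    1.\<close>
  have Q1: "Q \<one>\<^bsub>U\<^esub> = \<zero>\<^bsub>V\<^esub>"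
  proof -
    have "Q \<one>\<^bsub>U\<^esub> = Q \<one>\<^bsub>U\<^esub> \<oplus>\<^bsub>V\<^esub> Q \<one>\<^bsub>U\<^esub>"
      using Qm[of "\<one>\<^bsub>U\<^esub>" "\<one>\<^bsub>U\<^esub>"] QV[of "\<one>\<^bsub>U\<^esub>"] al1 by simp
    then show ?thesis using QV[of "\<one>\<^bsub>U\<^esub>"] by (metis U.one_closed V.add.l_cancel_one')
  qed
  have Q0: "Q (x \<otimes>\<^bsub>U\<^esub> y) = \<zero>\<^bsub>V\<^esub>"
    if "x \<in> carrier U" "y \<in> carrier U" "Q x = \<zero>\<^bsub>V\<^esub>" "Q y = \<zero>\<^bsub>V\<^esub>" for x y
    using that al Qm by simp
  have gc: "U_gen I a r i \<in> carrier ?Y" "U_gen I a s i \<in> carrier ?X" if "i \<in> I" for i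
    using that by (auto simp: r.U_gen_cls s.U_gen_cls r.U_half_carrier s.U_half_carrier intro!: imageI r.single_T s.single_T)
  have Qy: "Q (?t y \<one>\<^bsub>?H\<^esub> \<one>\<^bsub>?X\<^esub>) = \<zero>\<^bsub>V\<^esub>" if "y \<in> carrier ?Y" for y
  proof (rule r.U_half_vanish[OF V.normed_sp_self by' _ _ that])
    show "Q (?t \<one>\<^bsub>?Y\<^esub> \<one>\<^bsub>?H\<^esub> \<one>\<^bsub>?X\<^esub>) = \<zero>\<^bsub>V\<^esub>"
      using ring_hom_one[OF homy] Q1 by simp
    fix i y assume i: "i \<in> I" and y: "y \<in> carrier ?Y" "Q (?t y \<one>\<^bsub>?H\<^esub> \<one>\<^bsub>?X\<^esub>) = \<zero>\<^bsub>V\<^esub>"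
    have "Q (?t (U_gen I a r i) \<one>\<^bsub>?H\<^esub> \<one>\<^bsub>?X\<^esub>) = \<zero>\<^bsub>V\<^esub>"
      using gens[of "genF I a r s i"] i by (simp add: genF_def)
    then show "Q (?t (U_gen I a r i \<otimes>\<^bsub>?Y\<^esub> y) \<one>\<^bsub>?H\<^esub> \<one>\<^bsub>?X\<^esub>) = \<zero>\<^bsub>V\<^esub>"
      using ring_hom_mult[OF homy gc(1)[OF i] y(1)] Q0[OF tc tc] gc i y h1 yhx by simp
  qed
  have Qh: "Q (?t \<one>\<^bsub>?Y\<^esub> h \<one>\<^bsub>?X\<^esub>) = \<zero>\<^bsub>V\<^esub>" if "h \<in> carrier ?H" for h
  proof (rule H0_vanish[OF V.normed_sp_self bh' _ _ that])
    show "Q (?t \<one>\<^bsub>?Y\<^esub> \<one>\<^bsub>?H\<^esub> \<one>\<^bsub>?X\<^esub>) = \<zero>\<^bsub>V\<^esub>"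
      using ring_hom_one[OF homy] Q1 by simp
    fix i h assume i: "i \<in> I" and h: "h \<in> carrier ?H" "Q (?t \<one>\<^bsub>?Y\<^esub> h \<one>\<^bsub>?X\<^esub>) = \<zero>\<^bsub>V\<^esub>"
    have g: "single {#i#} \<in> carrier ?H" using i by (intro H0_single) simp
    have "Q (?t \<one>\<^bsub>?Y\<^esub> (single {#i#}) \<one>\<^bsub>?X\<^esub>) = \<zero>\<^bsub>V\<^esub>"
      using gens[of "genH I a r s i"] i by (simp add: genH_def)
    then show "Q (?t \<one>\<^bsub>?Y\<^esub> (single {#i#} \<otimes>\<^bsub>?H\<^esub> h) \<one>\<^bsub>?X\<^esub>) = \<zero>\<^bsub>V\<^esub>"
      using ring_hom_mult[OF homh g h(1)] Q0[OF tc tc] g h yhx by simp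
  qed
  have Qx: "Q (?t \<one>\<^bsub>?Y\<^esub> \<one>\<^bsub>?H\<^esub> x) = \<zero>\<^bsub>V\<^esub>" if "x \<in> carrier ?X" for x
  proof (rule s.U_half_vanish[OF V.normed_sp_self bx' _ _ that])
    show "Q (?t \<one>\<^bsub>?Y\<^esub> \<one>\<^bsub>?H\<^esub> \<one>\<^bsub>?X\<^esub>) = \<zero>\<^bsub>V\<^esub>"
      using ring_hom_one[OF homy] Q1 by simp
    fix i x assume i: "i \<in> I" and x: "x \<in> carrier ?X" "Q (?t \<one>\<^bsub>?Y\<^esub> \<one>\<^bsub>?H\<^esub> x) = \<zero>\<^bsub>V\<^esub>"
    have "Q (?t \<one>\<^bsub>?Y\<^esub> \<one>\<^bsub>?H\<^esub> (U_gen I a s i)) = \<zero>\<^bsub>V\<^esub>"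
      using gens[of "genE I a r s i"] i by (simp add: genE_def)
    then show "Q (?t \<one>\<^bsub>?Y\<^esub> \<one>\<^bsub>?H\<^esub> (U_gen I a s i \<otimes>\<^bsub>?X\<^esub> x)) = \<zero>\<^bsub>V\<^esub>"
      using ring_hom_mult[OF homx gc(2)[OF i] x(1)] Q0[OF tc tc] gc i x h1 yhx by simp
  qed
  have Qt: "Q (?t y h x) = \<zero>\<^bsub>V\<^esub>" if "y \<in> carrier ?Y" "h \<in> carrier ?H" "x \<in> carrier ?X" for y h x
    using that prod[OF that] Q0 tc Qy Qh Qx h1 yhx by simp
  \<comment> \<open>The triple tensor product is bracketed to the left, so density is applied to the
    outer product first and then to the inner one.\<close>
  show ?thesis
  proof (rule p2.tensor_dense[OF V.normed_sp_self Q'])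
    fix w x assume w: "w \<in> carrier (tensor ?Y ?H)" and x: "x \<in> carrier ?X"
    show "Q (tens (tensor ?Y ?H) ?X w x) = \<zero>\<^bsub>V\<^esub>"
    proof (rule p1.tensor_dense[OF V.normed_sp_self _ _ w])
      show "bounded_lin (tensor ?Y ?H) V (\<lambda>w. Q (tens (tensor ?Y ?H) ?X w x))"
        by (rule bw[OF x])
      fix y h assume "y \<in> carrier ?Y" "h \<in> carrier ?H"
      then show "Q (tens (tensor ?Y ?H) ?X (tens ?Y ?H y h) x) = \<zero>\<^bsub>V\<^esub>"
        using Qt x unfolding U_tens_def by blast
    qed
  qed (use X cU in simp)
qed

lemma is_U_gens:
  fixes U :: "('k::complete_nonarch_field, ('k, 'i) uan) nspace"
  assumes U: "is_U I a r s U" and rs: "0 < r" "0 < s"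
  shows "genF I a r s ` I \<union> genH I a r s ` I \<union> genE I a r s ` I \<subseteq> carrier U"
proof -
  interpret r: tate_quot I r "tate_tensor I r :: ('k, _) nspace" a "serre_ideal I a r" by (rule tate_quotI[OF rs(1)])
  interpret s: tate_quot I s "tate_tensor I s :: ('k, _) nspace" a "serre_ideal I a s" by (rule tate_quotI[OF rs(2)])
  let ?Y = "U_half I a r :: ('k, _) nspace" and ?H = "H0 I :: ('k, _) nspace" and ?X = "U_half I a s :: ('k, _) nspace"
  interpret p1: normed_pair ?Y ?H by (intro normed_pair.intro r.U_half_normed H0_normed)
  interpret p2: normed_pair "tensor ?Y ?H" ?X by (intro normed_pair.intro p1.tensor_normed s.U_half_normed)
  have cU: "carrier U = carrier (tensor (tensor ?Y ?H) ?X)"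
    using U by (auto simp: is_U_def U_space_def)
  have tc: "U_tens I a r s y h x \<in> carrier U" if "y \<in> carrier ?Y" "h \<in> carrier ?H" "x \<in> carrier ?X" for y h x
    using that by (simp add: cU U_tens_def)
  have gc: "U_gen I a r i \<in> carrier ?Y" "U_gen I a s i \<in> carrier ?X" if "i \<in> I" for i
    using that by (auto simp: r.U_gen_cls s.U_gen_cls r.U_half_carrier s.U_half_carrier intro!: imageI r.single_T s.single_T)
  have h: "\<one>\<^bsub>?H\<^esub> \<in> carrier ?H" "i \<in> I \<Longrightarrow> single {#i#} \<in> carrier ?H" for i
    unfolding H0_one by (auto intro!: H0_single)
  show ?thesis
    unfolding genF_def genH_def genE_def
    by (auto intro!: tc gc h r.U_half_one_closed s.U_half_one_closed)
qed

section \<open>Derivations and the first cohomology group\<close>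

text \<open>\<open>g_an\<close> is \<open>U\<close> with its carrier replaced by an intersection.
  Closure properties are inherited from the members, and the carrier of \<open>U\<close> is one of
  them.\<close>

lemma g_an_props:
  fixes U :: "('k::complete_nonarch_field, ('k, 'i) uan) nspace"
  assumes "normed_sp U" "ring U"
    and gens: "genF I a r s ` I \<union> genH I a r s ` I \<union> genE I a r s ` I \<subseteq> carrier U"
  defines "L \<equiv> g_an I a r s U"
  shows "carrier L \<subseteq> carrier U" "genF I a r s ` I \<union> genH I a r s ` I \<union> genE I a r s ` I \<subseteq> carrier L"
    and "\<And>x y. x \<in> carrier L \<Longrightarrow> y \<in> carrier L \<Longrightarrow> x \<oplus>\<^bsub>U\<^esub> y \<in> carrier L"
    and "\<And>x c. x \<in> carrier L \<Longrightarrow> c \<odot>\<^bsub>U\<^esub> x \<in> carrier L"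
    and "\<And>x y. x \<in> carrier L \<Longrightarrow> y \<in> carrier L \<Longrightarrow> commutator U x y \<in> carrier L"
    and "add L = add U" "smult L = smult U" "nrm L = nrm U"
proof -
  interpret U: normed_sp U by fact
  interpret R: ring U by fact
  let ?G = "genF I a r s ` I \<union> genH I a r s ` I \<union> genE I a r s ` I :: ('k, 'i) uan set"
  let ?F = "{S. submodule S (kban :: ('k, 'k) nspace) U \<and> closed_set U S \<and> (\<forall>x\<in>S. \<forall>y\<in>S. commutator U x y \<in> S) \<and> ?G \<subseteq> S}"
  have L: "L = U\<lparr>carrier := \<Inter>?F\<rparr>"
    by (simp add: L_def g_an_def closed_lie_subalgebra_def)
  have cL: "carrier L = \<Inter>?F" by (simp add: L)
  have "carrier U \<in> ?F"
    using gens U.submodule_self closed_set_carrier by (auto simp: commutator_def)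
  then show "carrier L \<subseteq> carrier U" unfolding cL by blast
  show "?G \<subseteq> carrier L" unfolding cL by blast
  show "x \<oplus>\<^bsub>U\<^esub> y \<in> carrier L" if "x \<in> carrier L" "y \<in> carrier L" for x y
  proof -
    have "x \<oplus>\<^bsub>U\<^esub> y \<in> S" if S: "S \<in> ?F" for S
      using U.submoduleE(5)[of S x y] S \<open>x \<in> carrier L\<close> \<open>y \<in> carrier L\<close> unfolding cL by simp
    then show ?thesis unfolding cL by (rule InterI)
  qed
  show "c \<odot>\<^bsub>U\<^esub> x \<in> carrier L" if "x \<in> carrier L" for x c
  proof -
    have "c \<odot>\<^bsub>U\<^esub> x \<in> S" if S: "S \<in> ?F" for S
      using U.submoduleE(4)[of S c x] S \<open>x \<in> carrier L\<close> unfolding cL by simp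
    then show ?thesis unfolding cL by (rule InterI)
  qed
  show "commutator U x y \<in> carrier L" if "x \<in> carrier L" "y \<in> carrier L" for x y
  proof -
    have "commutator U x y \<in> S" if S: "S \<in> ?F" for S
      using S \<open>x \<in> carrier L\<close> \<open>y \<in> carrier L\<close> unfolding cL by simp
    then show ?thesis unfolding cL by (rule InterI)
  qed
  show "add L = add U" "smult L = smult U" "nrm L = nrm U" by (simp_all add: L)
qed

section \<open>Cochains and coboundaries in low degree\<close>

lemma args_0: "args L 0 = {[]}"
  by (auto simp: args_def)

lemma args_1: "xs \<in> args L (Suc 0) \<longleftrightarrow> (\<exists>x\<in>carrier L. xs = [x])"
  by (auto simp: args_def length_Suc_conv)

lemma args_2: "xs \<in> args L (Suc (Suc 0)) \<longleftrightarrow> (\<exists>x\<in>carrier L. \<exists>y\<in>carrier L. xs = [x, y])"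
  by (auto simp: args_def length_Suc_conv)

lemma cochain_0:
  assumes "normed_sp M"
  shows "u \<in> carrier M \<Longrightarrow> (\<lambda>xs\<in>args L 0. u) \<in> cochains L M 0"
  by (auto simp: cochains_def args_0)

text \<open>In degree 0 there are no pairs i < j, so the bracket sum is empty and only the action
  remains.\<close>

lemma coboundary_0:
  assumes "normed_sp M" "x \<in> carrier L" "ac x (g []) \<in> carrier M"
  shows "coboundary L br M ac 0 g [x] = ac x (g [])"
proof -
  interpret M: normed_sp M by fact
  have e: "{(i, j). i < j \<and> j = (0::nat)} = {}" by auto
  have "{..0::nat} = {0}" by auto
  then show ?thesis
    using assms(2,3) by (simp add: coboundary_def args_1 e drop_at_def)
qed

text \<open>Positions are counted from 0: the single bracket term has sign -1, and the two action
  terms have signs +1 and -1.\<close>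

lemma coboundary_1:
  assumes "normed_sp M" "x \<in> carrier L" "y \<in> carrier L" "f [br x y] \<in> carrier M"
    "ac x (f [y]) \<in> carrier M" "ac y (f [x]) \<in> carrier M"
  shows "coboundary L br M ac (Suc 0) f [x, y] =
    \<ominus>\<^bsub>M\<^esub> f [br x y] \<oplus>\<^bsub>M\<^esub> (ac x (f [y]) \<ominus>\<^bsub>M\<^esub> ac y (f [x]))"
proof -
  interpret M: normed_sp M by fact
  have e: "{(i, j). i < j \<and> j \<le> Suc 0} = {(0, Suc 0)}" by auto
  have e': "{..Suc 0} = {0, Suc 0}" by auto
  show ?thesis
    using assms(2-) M.sm_neg unfolding coboundary_def args_2 e e'
    by (simp add: args_2 drop_at_def a_minus_def M.M.a_comm)
qed

text \<open>The restriction of a derivation to the Lie algebra is a 1-cocycle, hence a coboundary; the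
  resulting inner derivation agrees with the given one on topological generators.\<close>

lemma inner_derivation:
  fixes U :: "('k::complete_nonarch_field, ('k, 'i) uan) nspace" and V :: "('k, 'v) nspace"
  assumes U: "is_U I a r s U" and rs: "0 < r" "0 < s" and V: "banach_alg V"
    and al: "bounded_lin U V al" and al1: "al \<one>\<^bsub>U\<^esub> = \<one>\<^bsub>V\<^esub>"
    and alm: "\<And>x y. x \<in> carrier U \<Longrightarrow> y \<in> carrier U \<Longrightarrow> al (x \<otimes>\<^bsub>U\<^esub> y) = al x \<otimes>\<^bsub>V\<^esub> al y"
    and H1: "Hb_zero (g_an I a r s U) (commutator U) V (\<lambda>x u. commutator V (al x) u) 1"
    and D: "bounded_lin U V D"
    and Dm: "\<And>x y. x \<in> carrier U \<Longrightarrow> y \<in> carrier U \<Longrightarrow>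
      D (x \<otimes>\<^bsub>U\<^esub> y) = al x \<otimes>\<^bsub>V\<^esub> D y \<oplus>\<^bsub>V\<^esub> D x \<otimes>\<^bsub>V\<^esub> al y"
  shows "\<exists>u\<in>carrier V. \<forall>x\<in>carrier U. D x = al x \<otimes>\<^bsub>V\<^esub> u \<ominus>\<^bsub>V\<^esub> u \<otimes>\<^bsub>V\<^esub> al x"
proof -
  interpret V: banach_alg V by fact
  interpret U: banach_alg U using U unfolding is_U_def banach_algebra_iff by blast
  let ?G = "genF I a r s ` I \<union> genH I a r s ` I \<union> genE I a r s ` I :: ('k, 'i) uan set"
  let ?L = "g_an I a r s U" and ?br = "commutator U" and ?ac = "\<lambda>x u. commutator V (al x) u"
  have gens: "?G \<subseteq> carrier U"
    by (rule is_U_gens[OF U rs])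
  note L = g_an_props[OF U.normed_sp_self U.ring_axioms gens]
  have LU: "x \<in> carrier U" if "x \<in> carrier ?L" for x using L(1) that by blast
  note Dc = bounded_lin_closed[OF D] and ac = bounded_lin_closed[OF al]
  have comc: "commutator V x y \<in> carrier V" if "x \<in> carrier V" "y \<in> carrier V" for x y
    using that by (simp add: commutator_def)
  define f where "f = (\<lambda>xs\<in>args ?L (Suc 0). D (xs ! 0))"
  have f1: "f [x] = D x" if "x \<in> carrier ?L" for x
    using that by (simp add: f_def args_1)
  obtain C where C: "0 \<le> C" "\<And>x. x \<in> carrier U \<Longrightarrow> nrm V (D x) \<le> C * nrm U x"
    using bounded_lin_bound[OF U.normed_sp_self D] by metis
  have f: "f \<in> cochains ?L V (Suc 0)"
    unfolding cochains_def mem_Collect_eq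
  proof (intro conjI ballI allI impI)
    show "f \<in> extensional (args ?L (Suc 0))" by (simp add: f_def)
    show "f \<in> args ?L (Suc 0) \<rightarrow> carrier V"
      using LU Dc by (auto simp: args_1 f1)
    fix xs x y and i :: nat
    assume "xs \<in> args ?L (Suc 0)" and i: "i < Suc 0" and x: "x \<in> carrier ?L" and y: "y \<in> carrier ?L"
    then obtain z where z: "z \<in> carrier ?L" "xs = [z]" by (auto simp: args_1)
    show "f (xs[i := x \<oplus>\<^bsub>?L\<^esub> y]) = f (xs[i := x]) \<oplus>\<^bsub>V\<^esub> f (xs[i := y])"
      using z i x y L LU by (simp add: f1 bounded_lin_add[OF D])
  next
    fix xs x c and i :: nat
    assume "xs \<in> args ?L (Suc 0)" and i: "i < Suc 0" and x: "x \<in> carrier ?L"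
    then obtain z where z: "z \<in> carrier ?L" "xs = [z]" by (auto simp: args_1)
    show "f (xs[i := c \<odot>\<^bsub>?L\<^esub> x]) = c \<odot>\<^bsub>V\<^esub> f (xs[i := x])"
      using z i x L LU by (simp add: f1 bounded_lin_smult[OF D])
  next
    show "\<exists>C. \<forall>xs\<in>args ?L (Suc 0). nrm V (f xs) \<le> C * (\<Prod>i<Suc 0. nrm ?L (xs ! i))"
      using C LU L(8) by (intro exI[of _ C]) (auto simp: args_1 f1)
  qed auto
  \<comment> \<open>Expanded by the derivation law, \<open>D\<close> of a commutator is the action
    of \<open>x\<close> on \<open>D y\<close> minus the action of \<open>y\<close> on
    \<open>D x\<close>; this is the cocycle condition.\<close>
  have "coboundary ?L ?br V ?ac (Suc 0) f = (\<lambda>xs\<in>args ?L (Suc (Suc 0)). \<zero>\<^bsub>V\<^esub>)"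
  proof (rule extensionalityI[of _ "args ?L (Suc (Suc 0))"])
    fix xs assume "xs \<in> args ?L (Suc (Suc 0))"
    then obtain x y where xs: "x \<in> carrier ?L" "y \<in> carrier ?L" "xs = [x, y]" by (auto simp: args_2)
    note xy = LU[OF xs(1)] LU[OF xs(2)]
    have "D (?br x y) = D (x \<otimes>\<^bsub>U\<^esub> y) \<ominus>\<^bsub>V\<^esub> D (y \<otimes>\<^bsub>U\<^esub> x)"
      unfolding commutator_def using xy
      by (intro bounded_lin_minus[OF U.normed_sp_self V.normed_sp_self D]) auto
    then have "f [?br x y] = (al x \<otimes>\<^bsub>V\<^esub> D y \<oplus>\<^bsub>V\<^esub> D x \<otimes>\<^bsub>V\<^esub> al y) \<ominus>\<^bsub>V\<^esub> (al y \<otimes>\<^bsub>V\<^esub> D x \<oplus>\<^bsub>V\<^esub> D y \<otimes>\<^bsub>V\<^esub> al x)"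
      using xs L(5) xy Dm by (simp add: f1)
    moreover have "coboundary ?L ?br V ?ac (Suc 0) f [x, y] =
        \<ominus>\<^bsub>V\<^esub> f [?br x y] \<oplus>\<^bsub>V\<^esub> (?ac x (f [y]) \<ominus>\<^bsub>V\<^esub> ?ac y (f [x]))"
      using xs xy L(5) LU by (intro coboundary_1 V.normed_sp_self) (auto simp: f1 Dc ac comc)
    moreover have "\<ominus>\<^bsub>V\<^esub> ((al x \<otimes>\<^bsub>V\<^esub> D y \<oplus>\<^bsub>V\<^esub> D x \<otimes>\<^bsub>V\<^esub> al y) \<ominus>\<^bsub>V\<^esub> (al y \<otimes>\<^bsub>V\<^esub> D x \<oplus>\<^bsub>V\<^esub> D y \<otimes>\<^bsub>V\<^esub> al x))
        \<oplus>\<^bsub>V\<^esub> ((al x \<otimes>\<^bsub>V\<^esub> D y \<ominus>\<^bsub>V\<^esub> D y \<otimes>\<^bsub>V\<^esub> al x) \<ominus>\<^bsub>V\<^esub> (al y \<otimes>\<^bsub>V\<^esub> D x \<ominus>\<^bsub>V\<^esub> D x \<otimes>\<^bsub>V\<^esub> al y)) = \<zero>\<^bsub>V\<^esub>"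
      using Dc[OF xy(1)] Dc[OF xy(2)] ac[OF xy(1)] ac[OF xy(2)] by algebra
    ultimately show "coboundary ?L ?br V ?ac (Suc 0) f xs = (\<lambda>xs\<in>args ?L (Suc (Suc 0)). \<zero>\<^bsub>V\<^esub>) xs"
      using xs by (simp add: f1 commutator_def args_2)
  qed (auto simp: coboundary_def)
  then have cyc: "f \<in> cocycles ?L ?br V ?ac (Suc 0)"
    using f by (simp add: cocycles_def)
  \<comment> \<open>Vanishing says that the coset of zero is the only coset; applied to the coset of
    \<open>f\<close>, it identifies that coset with the set of coboundaries.\<close>
  have "(\<lambda>b. \<lambda>xs\<in>args ?L (Suc 0). f xs \<oplus>\<^bsub>V\<^esub> b xs) ` coboundaries ?L ?br V ?ac (Suc 0)
      \<in> Hb ?L ?br V ?ac (Suc 0)"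
    unfolding Hb_def using cyc by blast
  then have coset: "(\<lambda>b. \<lambda>xs\<in>args ?L (Suc 0). f xs \<oplus>\<^bsub>V\<^esub> b xs) ` coboundaries ?L ?br V ?ac (Suc 0) =
      coboundaries ?L ?br V ?ac (Suc 0)"
    using H1 by (simp add: Hb_zero_def)
  \<comment> \<open>The zero 1-cochain, written as a coboundary: adding it to \<open>f\<close> shows
    that \<open>f\<close> itself belongs to its coset.\<close>
  define b0 where "b0 = coboundary ?L ?br V ?ac 0 (\<lambda>xs\<in>args ?L 0. \<zero>\<^bsub>V\<^esub>)"
  have b0: "b0 [x] = \<zero>\<^bsub>V\<^esub>" if "x \<in> carrier ?L" for x
    unfolding b0_def using that ac LU
    by (subst coboundary_0[OF V.normed_sp_self]) (auto simp: args_0 commutator_def a_minus_def)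
  have "b0 \<in> coboundaries ?L ?br V ?ac (Suc 0)"
    unfolding b0_def by (simp add: cochain_0[OF V.normed_sp_self])
  then have "(\<lambda>xs\<in>args ?L (Suc 0). f xs \<oplus>\<^bsub>V\<^esub> b0 xs) \<in> coboundaries ?L ?br V ?ac (Suc 0)"
    using coset by blast
  moreover have "(\<lambda>xs\<in>args ?L (Suc 0). f xs \<oplus>\<^bsub>V\<^esub> b0 xs) = f"
    by (rule extensionalityI[of _ "args ?L (Suc 0)"])
      (use LU Dc b0 in \<open>auto simp: args_1 f1 f_def\<close>)
  ultimately obtain g where g: "g \<in> cochains ?L V 0" "f = coboundary ?L ?br V ?ac 0 g"
    by auto
  define u where "u = g []"
  have u: "u \<in> carrier V" using g(1) by (auto simp: u_def cochains_def args_0)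
  have Du: "D x = commutator V (al x) u" if "x \<in> carrier ?L" for x
    using f1[OF that] g(2) coboundary_0[OF V.normed_sp_self that, of ?ac g ?br] u ac[OF LU[OF that]] comc
    by (simp add: u_def)
  \<comment> \<open>A difference of two derivations along \<open>al\<close> is again one, and this
    one vanishes on the Lie algebra, in particular on the generators.\<close>
  define Q where "Q x = D x \<ominus>\<^bsub>V\<^esub> (al x \<otimes>\<^bsub>V\<^esub> u \<ominus>\<^bsub>V\<^esub> u \<otimes>\<^bsub>V\<^esub> al x)" for x
  have Qb: "bounded_lin U V Q"
    unfolding Q_def
    by (intro V.bounded_lin_diff U.normed_sp_self D bounded_lin_comp[OF U.normed_sp_self V.normed_sp_self al]
        V.bounded_lin_mult_right V.bounded_lin_mult_left u)
  have "Q x = \<zero>\<^bsub>V\<^esub>" if "x \<in> carrier U" for x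
  proof (rule derivation_vanish[where Q = Q and al = al, OF U rs V Qb ac al1 _ _ that])
    fix x y assume xy: "x \<in> carrier U" "y \<in> carrier U"
    show "Q (x \<otimes>\<^bsub>U\<^esub> y) = al x \<otimes>\<^bsub>V\<^esub> Q y \<oplus>\<^bsub>V\<^esub> Q x \<otimes>\<^bsub>V\<^esub> al y"
      unfolding Q_def Dm[OF xy] alm[OF xy]
      using Dc[OF xy(1)] Dc[OF xy(2)] ac[OF xy(1)] ac[OF xy(2)] u by algebra
  next
    fix g assume "g \<in> ?G"
    then have "g \<in> carrier ?L" using L(2) by blast
    moreover from this have "al g \<otimes>\<^bsub>V\<^esub> u \<ominus>\<^bsub>V\<^esub> u \<otimes>\<^bsub>V\<^esub> al g \<in> carrier V"
      using ac LU u by simp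
    ultimately show "Q g = \<zero>\<^bsub>V\<^esub>"
      using Du V.diff_zero_iff by (simp add: Q_def commutator_def)
  qed
  then have "D x = al x \<otimes>\<^bsub>V\<^esub> u \<ominus>\<^bsub>V\<^esub> u \<otimes>\<^bsub>V\<^esub> al x" if "x \<in> carrier U" for x
    using that V.diff_zero_iff[of "D x" "al x \<otimes>\<^bsub>V\<^esub> u \<ominus>\<^bsub>V\<^esub> u \<otimes>\<^bsub>V\<^esub> al x"] Dc ac u
    by (simp add: Q_def)
  then show ?thesis using u by blast
qed

section \<open>Power series objects\<close>

abbreviation wp :: "('k, 'v) nspace \<Rightarrow> (nat \<Rightarrow> real) \<Rightarrow> ('k, nat \<Rightarrow> 'v) nspace" where
  "wp V \<equiv> weighted_prod (\<lambda>_. V)"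

abbreviation positive :: "(nat \<Rightarrow> real) \<Rightarrow> bool" where
  "positive \<phi> \<equiv> \<forall>n. 0 < \<phi> n"

text \<open>Radii adapted to one given sequence: all its weighted norms become less than 1. The
  summand 1 in the denominator keeps the radii meaningful where \<open>x n\<close> is zero.\<close>

definition rad :: "('k, 'v) nspace \<Rightarrow> (nat \<Rightarrow> 'v) \<Rightarrow> nat \<Rightarrow> real" where
  "rad V x n = 1 / (1 + nrm V (x n))"

text \<open>The function underlying \<open>pser_const\<close>, named because homomorphisms are
  compared on constant series.\<close>

definition cst :: "('k, 'v) nspace \<Rightarrow> 'v \<Rightarrow> nat \<Rightarrow> 'v" where
  "cst V x n = (if n = 0 then x else \<zero>\<^bsub>V\<^esub>)"

lemma pser_simps [simp]:
  "idx (pser V) = {\<phi>. positive \<phi>}" "ile (pser V) = (\<lambda>\<phi> \<psi>. \<forall>n. \<psi> n \<le> \<phi> n)"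
  "isp (pser V) = wp V" "itr (pser V) = (\<lambda>_ _ x. x)"
  by (simp_all add: pser_def ind_prod_def)

lemma ind_const_simps [simp]:
  "idx (ind_const V) = {()}" "ile (ind_const V) = (\<lambda>_ _. True)"
  "isp (ind_const V) = (\<lambda>_. V)" "itr (ind_const V) = (\<lambda>_ _ x. x)"
  by (simp_all add: ind_const_def)

lemma ind_tensor_simps [simp]:
  "idx (ind_tensor X Y) = idx X \<times> idx Y" "isp (ind_tensor X Y) (i, j) = tensor (isp X i) (isp Y j)"
  by (simp_all add: ind_tensor_def)

lemma wp_simps [simp]:
  "zero (wp V \<phi>) = (\<lambda>_. \<zero>\<^bsub>V\<^esub>)" "add (wp V \<phi>) = (\<lambda>x y n. x n \<oplus>\<^bsub>V\<^esub> y n)"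
  "smult (wp V \<phi>) = (\<lambda>c x n. c \<odot>\<^bsub>V\<^esub> x n)"
  by (simp_all add: weighted_prod_def)

lemma wp_carrier:
  "x \<in> carrier (wp V \<phi>) \<longleftrightarrow> x \<in> UNIV \<rightarrow> carrier V \<and> bdd_above (range (\<lambda>n. \<phi> n * nrm V (x n)))"
  by (auto simp: weighted_prod_def)

lemma wp_closed: "x \<in> carrier (wp V \<phi>) \<Longrightarrow> x n \<in> carrier V"
  by (auto simp: wp_carrier)

lemma wp_le_nrm: "x \<in> carrier (wp V \<phi>) \<Longrightarrow> \<phi> n * nrm V (x n) \<le> nrm (wp V \<phi>) x"
  using cSUP_upper[of n UNIV "\<lambda>n. \<phi> n * nrm V (x n)"] by (simp add: wp_carrier weighted_prod_def)

lemma wp_nrm_le: "(\<And>n. \<phi> n * nrm V (x n) \<le> B) \<Longrightarrow> nrm (wp V \<phi>) x \<le> B"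
  by (simp add: weighted_prod_def cSUP_least)

lemma wpI: "x \<in> UNIV \<rightarrow> carrier V \<Longrightarrow> (\<And>n. \<phi> n * nrm V (x n) \<le> B) \<Longrightarrow> x \<in> carrier (wp V \<phi>)"
  unfolding wp_carrier by (auto intro: bdd_aboveI2[where M = B])

lemma wp_mono:
  assumes "normed_sp V" "x \<in> carrier (wp V \<phi>)" "\<And>n. \<chi> n \<le> \<phi> n"
  shows "x \<in> carrier (wp V \<chi>)"
proof (rule wpI)
  fix n
  have "\<chi> n * nrm V (x n) \<le> \<phi> n * nrm V (x n)"
    using assms(3) normed_sp.nrm_nonneg[OF assms(1) wp_closed[OF assms(2)]] by (intro mult_right_mono)
  then show "\<chi> n * nrm V (x n) \<le> nrm (wp V \<phi>) x"
    using wp_le_nrm[OF assms(2), of n] by linarith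
qed (use assms(2) in \<open>simp add: wp_carrier\<close>)

context normed_sp
begin

lemma wp_normed:
  assumes \<phi>: "positive \<phi>"
  shows "normed_sp (wp V \<phi>)"
proof (rule normed_spI)
  let ?W = "wp V \<phi>"
  have sc: "\<phi> n * nrm V (c \<odot> x n) \<le> absv c * nrm ?W x" if x: "x \<in> carrier ?W" for x c n
  proof -
    have "absv c * (\<phi> n * nrm V (x n)) \<le> absv c * nrm ?W x"
      by (intro mult_left_mono wp_le_nrm x absv_nonneg)
    then show ?thesis
      using wp_closed[OF x] by (simp add: nrm_smult mult.left_commute)
  qed
  have scl: "(\<lambda>n. c \<odot> x n) \<in> carrier ?W" if x: "x \<in> carrier ?W" for x c
    by (rule wpI[OF _ sc[OF x]]) (use wp_closed[OF x] in auto)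
  have add: "\<phi> n * nrm V (x n \<oplus> y n) \<le> max (nrm ?W x) (nrm ?W y)"
    if x: "x \<in> carrier ?W" and y: "y \<in> carrier ?W" for x y n
  proof -
    have "\<phi> n * nrm V (x n \<oplus> y n) \<le> \<phi> n * max (nrm V (x n)) (nrm V (y n))"
      using \<phi> by (intro mult_left_mono nrm_add wp_closed[OF x] wp_closed[OF y]) (simp add: less_imp_le)
    then show ?thesis
      using wp_le_nrm[OF x, of n] wp_le_nrm[OF y, of n] by (auto simp: max_def split: if_splits)
  qed
  show "abelian_group ?W"
  proof (rule abelian_groupI)
    show "\<zero>\<^bsub>?W\<^esub> \<in> carrier ?W" by (rule wpI[where B = 0]) auto
    fix x assume x: "x \<in> carrier ?W"
    then show "\<exists>y\<in>carrier ?W. y \<oplus>\<^bsub>?W\<^esub> x = \<zero>\<^bsub>?W\<^esub>"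
      by (intro bexI[OF _ scl[of x "-1"]]) (auto simp: sm_neg wp_closed M.l_neg)
    show "\<zero>\<^bsub>?W\<^esub> \<oplus>\<^bsub>?W\<^esub> x = x" using wp_closed[OF x] by simp
    fix y assume y: "y \<in> carrier ?W"
    show "x \<oplus>\<^bsub>?W\<^esub> y \<in> carrier ?W"
      unfolding wp_simps by (rule wpI[OF _ add[OF x y]]) (use wp_closed[OF x] wp_closed[OF y] in auto)
    show "x \<oplus>\<^bsub>?W\<^esub> y = y \<oplus>\<^bsub>?W\<^esub> x"
      using wp_closed[OF x] wp_closed[OF y] by (simp add: M.a_comm)
    fix z assume z: "z \<in> carrier ?W"
    show "x \<oplus>\<^bsub>?W\<^esub> y \<oplus>\<^bsub>?W\<^esub> z = x \<oplus>\<^bsub>?W\<^esub> (y \<oplus>\<^bsub>?W\<^esub> z)"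
      using wp_closed[OF x] wp_closed[OF y] wp_closed[OF z] by (simp add: M.a_assoc)
  qed
  fix c x y assume x: "x \<in> carrier ?W"
  note xc = wp_closed[OF x]
  show "c \<odot>\<^bsub>?W\<^esub> x \<in> carrier ?W" using scl[OF x] by simp
  show "(a + b) \<odot>\<^bsub>?W\<^esub> x = a \<odot>\<^bsub>?W\<^esub> x \<oplus>\<^bsub>?W\<^esub> b \<odot>\<^bsub>?W\<^esub> x" for a b using xc by (simp add: sm_add)
  show "(a * b) \<odot>\<^bsub>?W\<^esub> x = a \<odot>\<^bsub>?W\<^esub> (b \<odot>\<^bsub>?W\<^esub> x)" for a b using xc by (simp add: sm_assoc)
  show "1 \<odot>\<^bsub>?W\<^esub> x = x" using xc by simp
  have pos: "0 \<le> \<phi> n * nrm V (x n)" for n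
    using \<phi> nrm_nonneg[OF xc] by (simp add: less_imp_le)
  show "0 \<le> nrm ?W x"
    using pos[of 0] wp_le_nrm[OF x, of 0] by linarith
  show "x = \<zero>\<^bsub>?W\<^esub>" if 0: "nrm ?W x = 0"
  proof -
    have "x n = \<zero>" for n
    proof -
      have "\<phi> n * nrm V (x n) = 0" using wp_le_nrm[OF x, of n] pos[of n] 0 by simp
      then show ?thesis using \<phi>[rule_format, of n] nrm_eq_0_iff[OF xc] by simp
    qed
    then show ?thesis by auto
  qed
  show "nrm ?W (c \<odot>\<^bsub>?W\<^esub> x) \<le> absv c * nrm ?W x"
    unfolding wp_simps by (intro wp_nrm_le sc x)
  assume y: "y \<in> carrier ?W"
  show "c \<odot>\<^bsub>?W\<^esub> (x \<oplus>\<^bsub>?W\<^esub> y) = c \<odot>\<^bsub>?W\<^esub> x \<oplus>\<^bsub>?W\<^esub> c \<odot>\<^bsub>?W\<^esub> y"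
    using xc wp_closed[OF y] by (simp add: sm_r_add)
  show "nrm ?W (x \<oplus>\<^bsub>?W\<^esub> y) \<le> max (nrm ?W x) (nrm ?W y)"
    unfolding wp_simps by (intro wp_nrm_le add x y)
qed

lemma rad_pos: "x \<in> UNIV \<rightarrow> carrier V \<Longrightarrow> positive (rad V x)"
  using nrm_nonneg by (auto simp: rad_def Pi_iff add_pos_nonneg)

lemma rad_wp: "x \<in> UNIV \<rightarrow> carrier V \<Longrightarrow> x \<in> carrier (wp V (rad V x))"
  by (rule wpI[where B = 1]) (use nrm_nonneg in \<open>auto simp: rad_def Pi_iff divide_simps add_pos_nonneg\<close>)

lemma cst_seq: "x \<in> carrier V \<Longrightarrow> cst V x \<in> UNIV \<rightarrow> carrier V"
  by (auto simp: cst_def)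

lemma cst_wp: "x \<in> carrier V \<Longrightarrow> cst V x \<in> carrier (wp V (\<lambda>_. 1))"
  by (rule wpI[where B = "nrm V x"]) (auto simp: cst_def nrm_nonneg)

lemma cst_bounded: "bounded_lin V (wp V (\<lambda>_. 1)) (cst V)"
  by (rule bounded_linI[where C = 1])
    (auto simp: cst_wp fun_eq_iff nrm_nonneg intro!: wp_nrm_le, auto simp: cst_def nrm_nonneg)

lemma proj_bounded:
  assumes "positive \<phi>"
  shows "bounded_lin (wp V \<phi>) V (\<lambda>x. x n)"
proof (rule bounded_linI[where C = "1 / \<phi> n"])
  fix x assume x: "x \<in> carrier (wp V \<phi>)"
  show "nrm V (x n) \<le> (1 / \<phi> n) * nrm (wp V \<phi>) x"
    using wp_le_nrm[OF x, of n] assms[rule_format, of n] by (simp add: field_simps)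
qed (auto simp: wp_closed)

lemma hshift_seq: "x \<in> UNIV \<rightarrow> carrier V \<Longrightarrow> hshift V x \<in> UNIV \<rightarrow> carrier V"
  by (auto simp: hshift_def Pi_iff split: nat.split)

text \<open>Here \<open>cst kban 1\<close>, shifted by one place, is the element \<open>\<hbar>\<close>.\<close>

lemma hbar_smult:
  assumes x: "x \<in> UNIV \<rightarrow> carrier V"
  shows "(\<Oplus>i\<in>{..n}. hshift kban (cst kban 1) i \<odot> x (n - i)) = hshift V x n"
proof -
  have "(\<Oplus>i\<in>{..n}. hshift kban (cst kban 1) i \<odot> x (n - i)) = (\<Oplus>i\<in>{..n}. if 1 = i then x (n - i) else \<zero>)"
    using x by (intro M.finsum_cong') (auto simp: hshift_def cst_def Pi_iff split: nat.split)
  also have "\<dots> = hshift V x n"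
  proof (cases n)
    case (Suc m)
    then show ?thesis using x by (subst M.finsum_singleton) (auto simp: Pi_iff)
  qed auto
  finally show ?thesis .
qed

end

section \<open>The product and the scalar action on power series objects\<close>

lemma cauchy_radii_le: "i \<le> n \<Longrightarrow> cauchy_radii \<phi> \<psi> n \<le> \<phi> i * \<psi> (n - i)"
  unfolding cauchy_radii_def by (intro Min_le) auto

lemma cauchy_radii_pos: "positive \<phi> \<Longrightarrow> positive \<psi> \<Longrightarrow> positive (cauchy_radii \<phi> \<psi>)"
  unfolding cauchy_radii_def by (subst Min_gr_iff) auto

text \<open>The minimum in \<open>cauchy_radii\<close> runs over all ways to split the degree, so
  every term of a coefficient obeys the bound by \<open>C\<close> times the two norms, and by the
  ultrametric inequality so does their sum. Completeness of the target, \<open>ZB\<close>, is what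
  \<open>tens_lift_exists\<close> asks for.\<close>

lemma pser_bilin_eval:
  assumes V: "normed_sp V" and W: "normed_sp W" and Z: "normed_sp Z"
    and \<phi>: "positive \<phi>" and \<psi>: "positive \<psi>" and ZB: "banach_sp (wp Z (cauchy_radii \<phi> \<psi>))"
    and b: "\<And>v w. v \<in> carrier V \<Longrightarrow> w \<in> carrier W \<Longrightarrow> b v w \<in> carrier Z"
    and b_add1: "\<And>v v' w. v \<in> carrier V \<Longrightarrow> v' \<in> carrier V \<Longrightarrow> w \<in> carrier W \<Longrightarrow>
      b (v \<oplus>\<^bsub>V\<^esub> v') w = b v w \<oplus>\<^bsub>Z\<^esub> b v' w"
    and b_add2: "\<And>v w w'. v \<in> carrier V \<Longrightarrow> w \<in> carrier W \<Longrightarrow> w' \<in> carrier W \<Longrightarrow>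
      b v (w \<oplus>\<^bsub>W\<^esub> w') = b v w \<oplus>\<^bsub>Z\<^esub> b v w'"
    and b_smult1: "\<And>c v w. v \<in> carrier V \<Longrightarrow> w \<in> carrier W \<Longrightarrow> b (c \<odot>\<^bsub>V\<^esub> v) w = c \<odot>\<^bsub>Z\<^esub> b v w"
    and b_smult2: "\<And>c v w. v \<in> carrier V \<Longrightarrow> w \<in> carrier W \<Longrightarrow> b v (c \<odot>\<^bsub>W\<^esub> w) = c \<odot>\<^bsub>Z\<^esub> b v w"
    and bound: "\<And>v w. v \<in> carrier V \<Longrightarrow> w \<in> carrier W \<Longrightarrow> nrm Z (b v w) \<le> C * (nrm V v * nrm W w)"
    and C: "0 \<le> C"
  shows "fst (pser_bilin V W Z b (\<phi>, \<psi>)) = cauchy_radii \<phi> \<psi>"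
    and "bounded_lin (tensor (wp V \<phi>) (wp W \<psi>)) (wp Z (cauchy_radii \<phi> \<psi>)) (snd (pser_bilin V W Z b (\<phi>, \<psi>)))"
    and "x \<in> carrier (wp V \<phi>) \<Longrightarrow> y \<in> carrier (wp W \<psi>) \<Longrightarrow>
      snd (pser_bilin V W Z b (\<phi>, \<psi>)) (tens (wp V \<phi>) (wp W \<psi>) x y) = (\<lambda>n. \<Oplus>\<^bsub>Z\<^esub>i\<in>{..n}. b (x i) (y (n - i)))"
proof -
  interpret V: normed_sp V by fact
  interpret W: normed_sp W by fact
  interpret Z: normed_sp Z by fact
  interpret P: normed_pair "wp V \<phi>" "wp W \<psi>"
    by (rule normed_pair.intro[OF V.wp_normed[OF \<phi>] W.wp_normed[OF \<psi>]])
  let ?c = "\<lambda>x y n. \<Oplus>\<^bsub>Z\<^esub>i\<in>{..n}. b (x i) (y (n - i))"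
  have cl: "b (x i) (y j) \<in> carrier Z" if "x \<in> carrier (wp V \<phi>)" "y \<in> carrier (wp W \<psi>)" for x y i j
    by (rule b[OF wp_closed[OF that(1)] wp_closed[OF that(2)]])
  have cc: "?c x y n \<in> carrier Z" if "x \<in> carrier (wp V \<phi>)" "y \<in> carrier (wp W \<psi>)" for x y n
    using cl[OF that] by (intro Z.M.finsum_closed) auto
  have bd: "cauchy_radii \<phi> \<psi> n * nrm Z (?c x y n) \<le> C * (nrm (wp V \<phi>) x * nrm (wp W \<psi>) y)"
    if x: "x \<in> carrier (wp V \<phi>)" and y: "y \<in> carrier (wp W \<psi>)" for x y n
  proof -
    let ?B = "C * (nrm (wp V \<phi>) x * nrm (wp W \<psi>) y)" and ?r = "cauchy_radii \<phi> \<psi> n"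
    have r: "0 < ?r" using cauchy_radii_pos[OF \<phi> \<psi>] by blast
    have B: "0 \<le> ?B" using C P.V.nrm_nonneg[OF x] P.W.nrm_nonneg[OF y] by simp
    have "nrm Z (?c x y n) \<le> ?B / ?r"
    proof (rule Z.nrm_finsum)
      fix i assume "i \<in> {..n}"
      then have i: "i \<le> n" by simp
      have nn: "0 \<le> nrm V (x i)" "0 \<le> nrm W (y (n - i))"
        using V.nrm_nonneg[OF wp_closed[OF x]] W.nrm_nonneg[OF wp_closed[OF y]] by auto
      have "?r * nrm Z (b (x i) (y (n - i))) \<le> ?r * (C * (nrm V (x i) * nrm W (y (n - i))))"
        using r by (intro mult_left_mono bound wp_closed[OF x] wp_closed[OF y]) auto
      also have "\<dots> \<le> (\<phi> i * \<psi> (n - i)) * (C * (nrm V (x i) * nrm W (y (n - i))))"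
        using cauchy_radii_le[OF i] C nn by (intro mult_right_mono) auto
      also have "\<dots> = C * ((\<phi> i * nrm V (x i)) * (\<psi> (n - i) * nrm W (y (n - i))))"
        by (simp add: mult_ac)
      also have "\<dots> \<le> ?B"
        using C nn \<phi> \<psi> P.V.nrm_nonneg[OF x] wp_le_nrm[OF x] wp_le_nrm[OF y]
        by (intro mult_left_mono mult_mono) (auto simp: less_imp_le)
      finally show "nrm Z (b (x i) (y (n - i))) \<le> ?B / ?r"
        using r by (simp add: field_simps)
    qed (use cl[OF x y] B r in auto)
    then show ?thesis using r by (simp add: field_simps)
  qed
  have *: "bounded_lin (tensor (wp V \<phi>) (wp W \<psi>)) (wp Z (cauchy_radii \<phi> \<psi>))
      (tens_lift (wp V \<phi>) (wp W \<psi>) (wp Z (cauchy_radii \<phi> \<psi>)) ?c) \<and>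
    (\<forall>x\<in>carrier (wp V \<phi>). \<forall>y\<in>carrier (wp W \<psi>).
      tens_lift (wp V \<phi>) (wp W \<psi>) (wp Z (cauchy_radii \<phi> \<psi>)) ?c (tens (wp V \<phi>) (wp W \<psi>) x y) = ?c x y)"
  proof (rule P.tens_lift_exists[OF ZB])
    fix x y assume x: "x \<in> carrier (wp V \<phi>)" and y: "y \<in> carrier (wp W \<psi>)"
    note xc = wp_closed[OF x] and yc = wp_closed[OF y]
    show "?c x y \<in> carrier (wp Z (cauchy_radii \<phi> \<psi>))"
      by (rule wpI[OF _ bd[OF x y]]) (use cc[OF x y] in auto)
    show "nrm (wp Z (cauchy_radii \<phi> \<psi>)) (?c x y) \<le> C * (nrm (wp V \<phi>) x * nrm (wp W \<psi>) y)"
      by (rule wp_nrm_le[OF bd[OF x y]])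
    show "?c (k \<odot>\<^bsub>wp V \<phi>\<^esub> x) y = k \<odot>\<^bsub>wp Z (cauchy_radii \<phi> \<psi>)\<^esub> ?c x y" for k
      using cl[OF x y] xc yc by (auto simp: Z.sm_finsum b_smult1 intro!: ext Z.M.finsum_cong')
    show "?c x (k \<odot>\<^bsub>wp W \<psi>\<^esub> y) = k \<odot>\<^bsub>wp Z (cauchy_radii \<phi> \<psi>)\<^esub> ?c x y" for k
      using cl[OF x y] xc yc by (auto simp: Z.sm_finsum b_smult2 intro!: ext Z.M.finsum_cong')
    fix x' assume x': "x' \<in> carrier (wp V \<phi>)"
    show "?c (x \<oplus>\<^bsub>wp V \<phi>\<^esub> x') y = ?c x y \<oplus>\<^bsub>wp Z (cauchy_radii \<phi> \<psi>)\<^esub> ?c x' y"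
    proof
      fix n
      have "?c (x \<oplus>\<^bsub>wp V \<phi>\<^esub> x') y n = (\<Oplus>\<^bsub>Z\<^esub>i\<in>{..n}. b (x i) (y (n - i)) \<oplus>\<^bsub>Z\<^esub> b (x' i) (y (n - i)))"
        using cl[OF x y] cl[OF x' y] b_add1[OF xc wp_closed[OF x'] yc] by (intro Z.M.finsum_cong') auto
      also have "\<dots> = ?c x y n \<oplus>\<^bsub>Z\<^esub> ?c x' y n"
        using cl[OF x y] cl[OF x' y] by (intro Z.M.finsum_addf) auto
      finally show "?c (x \<oplus>\<^bsub>wp V \<phi>\<^esub> x') y n = (?c x y \<oplus>\<^bsub>wp Z (cauchy_radii \<phi> \<psi>)\<^esub> ?c x' y) n" by simp
    qed
  next
    fix x y y' assume x: "x \<in> carrier (wp V \<phi>)" and y: "y \<in> carrier (wp W \<psi>)" and y': "y' \<in> carrier (wp W \<psi>)"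
    show "?c x (y \<oplus>\<^bsub>wp W \<psi>\<^esub> y') = ?c x y \<oplus>\<^bsub>wp Z (cauchy_radii \<phi> \<psi>)\<^esub> ?c x y'"
    proof
      fix n
      have "?c x (y \<oplus>\<^bsub>wp W \<psi>\<^esub> y') n = (\<Oplus>\<^bsub>Z\<^esub>i\<in>{..n}. b (x i) (y (n - i)) \<oplus>\<^bsub>Z\<^esub> b (x i) (y' (n - i)))"
        using cl[OF x y] cl[OF x y'] b_add2[OF wp_closed[OF x] wp_closed[OF y] wp_closed[OF y']]
        by (intro Z.M.finsum_cong') auto
      also have "\<dots> = ?c x y n \<oplus>\<^bsub>Z\<^esub> ?c x y' n"
        using cl[OF x y] cl[OF x y'] by (intro Z.M.finsum_addf) auto
      finally show "?c x (y \<oplus>\<^bsub>wp W \<psi>\<^esub> y') n = (?c x y \<oplus>\<^bsub>wp Z (cauchy_radii \<phi> \<psi>)\<^esub> ?c x y') n" by simp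
    qed
  qed
  show "fst (pser_bilin V W Z b (\<phi>, \<psi>)) = cauchy_radii \<phi> \<psi>"
    by (simp add: pser_bilin_def)
  show "bounded_lin (tensor (wp V \<phi>) (wp W \<psi>)) (wp Z (cauchy_radii \<phi> \<psi>)) (snd (pser_bilin V W Z b (\<phi>, \<psi>)))"
    using * by (simp add: pser_bilin_def)
  show "x \<in> carrier (wp V \<phi>) \<Longrightarrow> y \<in> carrier (wp W \<psi>) \<Longrightarrow>
      snd (pser_bilin V W Z b (\<phi>, \<psi>)) (tens (wp V \<phi>) (wp W \<psi>) x y) = ?c x y"
    using * by (simp add: pser_bilin_def)
qed

text \<open>Membership in \<open>ind_hom\<close> includes that source and target are ind-Banach
  objects, so the completeness of every weighted space is available as soon as a morphism is
  given.\<close>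

lemma ind_banach_wp: "ind_banach (pser V) \<Longrightarrow> positive \<phi> \<Longrightarrow> banach_sp (wp V \<phi>)"
  by (auto simp: ind_banach_def banach_space_iff)

lemma mlt_eval:
  assumes A: "banach_alg A" and I: "ind_banach (pser A)" and \<phi>: "positive \<phi>" and \<psi>: "positive \<psi>"
  shows "fst (mlt (pser_alg A) (\<phi>, \<psi>)) = cauchy_radii \<phi> \<psi>"
    and "bounded_lin (tensor (wp A \<phi>) (wp A \<psi>)) (wp A (cauchy_radii \<phi> \<psi>)) (snd (mlt (pser_alg A) (\<phi>, \<psi>)))"
    and "x \<in> carrier (wp A \<phi>) \<Longrightarrow> y \<in> carrier (wp A \<psi>) \<Longrightarrow>
      snd (mlt (pser_alg A) (\<phi>, \<psi>)) (tens (wp A \<phi>) (wp A \<psi>) x y) = cauchy A x y"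
proof -
  interpret A: banach_alg A by fact
  obtain C where C: "0 \<le> C" "\<And>x y. x \<in> carrier A \<Longrightarrow> y \<in> carrier A \<Longrightarrow> nrm A (x \<otimes>\<^bsub>A\<^esub> y) \<le> C * (nrm A x * nrm A y)"
    using A.mult_bound' by metis
  note E = pser_bilin_eval[OF A.normed_sp_self A.normed_sp_self A.normed_sp_self \<phi> \<psi>
      ind_banach_wp[OF I cauchy_radii_pos[OF \<phi> \<psi>]] A.m_closed A.l_distr A.r_distr A.mult_sm1 A.mult_sm2 C(2,1)]
  show "fst (mlt (pser_alg A) (\<phi>, \<psi>)) = cauchy_radii \<phi> \<psi>"
    "bounded_lin (tensor (wp A \<phi>) (wp A \<psi>)) (wp A (cauchy_radii \<phi> \<psi>)) (snd (mlt (pser_alg A) (\<phi>, \<psi>)))"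
    "x \<in> carrier (wp A \<phi>) \<Longrightarrow> y \<in> carrier (wp A \<psi>) \<Longrightarrow>
      snd (mlt (pser_alg A) (\<phi>, \<psi>)) (tens (wp A \<phi>) (wp A \<psi>) x y) = cauchy A x y"
    using E by (simp_all add: pser_alg_def cauchy_def[abs_def])
qed

lemma act_eval:
  assumes A: "banach_alg (A :: ('k::complete_nonarch_field, 'v) nspace)" and I: "ind_banach (pser A)"
    and \<phi>: "positive \<phi>" and \<psi>: "positive \<psi>"
    and x: "x \<in> carrier (wp (kban :: ('k, 'k) nspace) \<phi>)" and y: "y \<in> carrier (wp A \<psi>)"
  shows "fst (act (pser_alg A) (\<phi>, \<psi>)) = cauchy_radii \<phi> \<psi>"
    and "bounded_lin (tensor (wp (kban :: ('k, 'k) nspace) \<phi>) (wp A \<psi>)) (wp A (cauchy_radii \<phi> \<psi>)) (snd (act (pser_alg A) (\<phi>, \<psi>)))"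
    and "snd (act (pser_alg A) (\<phi>, \<psi>)) (tens (wp kban \<phi>) (wp A \<psi>) x y) = (\<lambda>n. \<Oplus>\<^bsub>A\<^esub>i\<in>{..n}. x i \<odot>\<^bsub>A\<^esub> y (n - i))"
proof -
  interpret A: banach_alg A by fact
  have K: "normed_sp (kban :: ('k, 'k) nspace)" by (rule banach_sp.axioms(1)[OF banach_sp_kban])
  have E: "fst (pser_bilin kban A A (smult A) (\<phi>, \<psi>)) = cauchy_radii \<phi> \<psi>"
    "bounded_lin (tensor (wp (kban :: ('k, 'k) nspace) \<phi>) (wp A \<psi>)) (wp A (cauchy_radii \<phi> \<psi>)) (snd (pser_bilin kban A A (smult A) (\<phi>, \<psi>)))"
    "snd (pser_bilin kban A A (smult A) (\<phi>, \<psi>)) (tens (wp kban \<phi>) (wp A \<psi>) x y) = (\<lambda>n. \<Oplus>\<^bsub>A\<^esub>i\<in>{..n}. x i \<odot>\<^bsub>A\<^esub> y (n - i))"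
    by (rule pser_bilin_eval[where C = 1, OF K A.normed_sp_self A.normed_sp_self \<phi> \<psi>
        ind_banach_wp[OF I cauchy_radii_pos[OF \<phi> \<psi>]]];
      use x y in \<open>simp add: A.sm_add A.sm_r_add A.nrm_smult A.sm_assoc[symmetric] mult.commute\<close>)+
  then show "fst (act (pser_alg A) (\<phi>, \<psi>)) = cauchy_radii \<phi> \<psi>"
    "bounded_lin (tensor (wp (kban :: ('k, 'k) nspace) \<phi>) (wp A \<psi>)) (wp A (cauchy_radii \<phi> \<psi>)) (snd (act (pser_alg A) (\<phi>, \<psi>)))"
    "snd (act (pser_alg A) (\<phi>, \<psi>)) (tens (wp kban \<phi>) (wp A \<psi>) x y) = (\<lambda>n. \<Oplus>\<^bsub>A\<^esub>i\<in>{..n}. x i \<odot>\<^bsub>A\<^esub> y (n - i))"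
    by (simp_all add: pser_alg_def)
qed

lemma unt_eval:
  "unt (pser_alg A) () = (\<lambda>_. 1, \<lambda>c. cst A (c \<odot>\<^bsub>A\<^esub> \<one>\<^bsub>A\<^esub>))"
  by (simp add: pser_alg_def ind_comp_def pser_const_def cst_def[abs_def] comp_def)

lemma ob_pser_alg [simp]: "ob (pser_alg A) = pser A"
  by (simp add: pser_alg_def)

text \<open>The transition maps of \<open>pser V\<close> are identities, so comparing two germs at a
  later index compares the functions themselves.\<close>

lemma germ_eq_pserD: "germ_eq (pser V) S p q \<Longrightarrow> x \<in> S \<Longrightarrow> snd p x = snd q x"
  by (auto simp: germ_eq_def)

text \<open>Indices grow as radii shrink, so the pointwise minimum of the two radii is a common
  upper bound.\<close>

lemma germ_eq_pserI:
  assumes "positive (fst p)" "positive (fst q)" "\<And>x. x \<in> S \<Longrightarrow> snd p x = snd q x"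
  shows "germ_eq (pser V) S p q"
  unfolding germ_eq_def using assms by (intro bexI[of _ "\<lambda>n. min (fst p n) (fst q n)"]) auto

section \<open>Homomorphisms of power series algebras\<close>

text \<open>A homomorphism acts on arbitrary sequences, whatever radii are used to bound them.\<close>

locale pser_hom =
  fixes U :: "('k::complete_nonarch_field, 'u) nspace" and V :: "('k, 'v) nspace"
    and f :: "(nat \<Rightarrow> real, nat \<Rightarrow> 'u, nat \<Rightarrow> real, nat \<Rightarrow> 'v) ind_mor"
  assumes U_alg: "banach_alg U" and V_alg: "banach_alg V"
    and hom: "f \<in> kh_alg_hom (pser_alg U) (pser_alg V)"
begin

sublocale U: banach_alg U by (rule U_alg)
sublocale V: banach_alg V by (rule V_alg)

text \<open>\<open>rad U x\<close> is one choice among all radii that bound \<open>x\<close>. By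
  \<open>f_ev\<close> every other choice gives the same value, so \<open>ev\<close> is a map on
  unrestricted sequences.\<close>

definition ev :: "(nat \<Rightarrow> 'u) \<Rightarrow> nat \<Rightarrow> 'v" where
  "ev x = snd (f (rad U x)) x"

lemma IU: "ind_banach (pser U)" and IV: "ind_banach (pser V)"
  using hom by (auto simp: kh_alg_hom_def ind_hom_def)

lemma f_pos: "positive \<phi> \<Longrightarrow> positive (fst (f \<phi>))"
  and f_bounded: "positive \<phi> \<Longrightarrow> bounded_lin (wp U \<phi>) (wp V (fst (f \<phi>))) (snd (f \<phi>))"
  using hom by (auto simp: kh_alg_hom_def ind_hom_def)

lemma f_compat:
  assumes "positive \<phi>" "positive \<psi>" "\<And>n. \<psi> n \<le> \<phi> n" "x \<in> carrier (wp U \<phi>)"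
  shows "snd (f \<phi>) x = snd (f \<psi>) x"
proof -
  have "germ_eq (pser V) (carrier (wp U \<phi>)) (f \<phi>) (fst (f \<psi>), snd (f \<psi>) \<circ> itr (pser U) \<phi> \<psi>)"
    using hom assms by (auto simp: kh_alg_hom_def ind_hom_def)
  then show ?thesis
    using germ_eq_pserD[OF _ assms(4)] by fastforce
qed

text \<open>The pointwise minimum of the two radii lies above both indices; compatibility with the
  transition maps compares either value with the one there.\<close>

lemma f_ev:
  assumes \<phi>: "positive \<phi>" and x: "x \<in> carrier (wp U \<phi>)"
  shows "snd (f \<phi>) x = ev x"
proof -
  have xs: "x \<in> UNIV \<rightarrow> carrier U" using x by (simp add: wp_carrier)
  let ?m = "\<lambda>n. min (\<phi> n) (rad U x n)"
  have m: "positive ?m" using \<phi> U.rad_pos[OF xs] by auto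
  have "snd (f \<phi>) x = snd (f ?m) x" by (rule f_compat[OF \<phi> m _ x]) simp
  also have "\<dots> = snd (f (rad U x)) x"
    by (rule f_compat[OF U.rad_pos[OF xs] m _ U.rad_wp[OF xs], symmetric]) simp
  finally show ?thesis by (simp add: ev_def)
qed

lemma f_closed: "positive \<phi> \<Longrightarrow> x \<in> carrier (wp U \<phi>) \<Longrightarrow> ev x \<in> carrier (wp V (fst (f \<phi>)))"
  using bounded_lin_closed[OF f_bounded] f_ev by metis

lemma ev_seq: "x \<in> UNIV \<rightarrow> carrier U \<Longrightarrow> ev x \<in> UNIV \<rightarrow> carrier V"
  using f_closed[OF U.rad_pos U.rad_wp, of x] by (simp add: wp_carrier)

lemma ev_add:
  assumes x: "x \<in> UNIV \<rightarrow> carrier U" and y: "y \<in> UNIV \<rightarrow> carrier U"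
  shows "ev (\<lambda>n. x n \<oplus>\<^bsub>U\<^esub> y n) = (\<lambda>n. ev x n \<oplus>\<^bsub>V\<^esub> ev y n)"
proof -
  let ?m = "\<lambda>n. min (rad U x n) (rad U y n)"
  have m: "positive ?m" using U.rad_pos[OF x] U.rad_pos[OF y] by auto
  interpret W: normed_sp "wp U ?m" by (rule U.wp_normed[OF m])
  have xm: "x \<in> carrier (wp U ?m)" by (rule wp_mono[OF U.normed_sp_self U.rad_wp[OF x]]) simp
  have ym: "y \<in> carrier (wp U ?m)" by (rule wp_mono[OF U.normed_sp_self U.rad_wp[OF y]]) simp
  show ?thesis
    using bounded_lin_add[OF f_bounded[OF m] xm ym] f_ev[OF m xm] f_ev[OF m ym]
      f_ev[OF m W.M.a_closed[OF xm ym]] by simp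
qed

text \<open>Evaluating the multiplicativity square at the elementary tensor of \<open>x\<close> and
  \<open>y\<close> turns an identity of morphisms into one of series.\<close>

lemma ev_mult:
  assumes x: "x \<in> UNIV \<rightarrow> carrier U" and y: "y \<in> UNIV \<rightarrow> carrier U"
  shows "ev (cauchy U x y) = cauchy V (ev x) (ev y)"
proof -
  let ?p = "rad U x" and ?q = "rad U y"
  let ?P = "wp U ?p" and ?Q = "wp U ?q"
  note p = U.rad_pos[OF x] and q = U.rad_pos[OF y] and xw = U.rad_wp[OF x] and yw = U.rad_wp[OF y]
  interpret T: normed_pair ?P ?Q by (rule normed_pair.intro[OF U.wp_normed[OF p] U.wp_normed[OF q]])
  note E = mlt_eval[OF U_alg IU p q] and E' = mlt_eval[OF V_alg IV f_pos[OF p] f_pos[OF q]]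
  have "ind_eq (ind_tensor (pser U) (pser U)) (pser V) (ind_comp f (mlt (pser_alg U)))
       (ind_comp (mlt (pser_alg V)) (ind_tensor_map (pser U) (pser U) (pser V) (pser V) f f))"
    using hom by (simp add: kh_alg_hom_def)
  then have "germ_eq (pser V) (carrier (tensor ?P ?Q)) (ind_comp f (mlt (pser_alg U)) (?p, ?q))
      (ind_comp (mlt (pser_alg V)) (ind_tensor_map (pser U) (pser U) (pser V) (pser V) f f) (?p, ?q))"
    using p q by (simp add: ind_eq_def)
  from germ_eq_pserD[OF this T.tens_closed[OF xw yw]]
  have "snd (f (cauchy_radii ?p ?q)) (cauchy U x y) =
      snd (mlt (pser_alg V) (fst (f ?p), fst (f ?q)))
        (tens_map ?P ?Q (wp V (fst (f ?p))) (wp V (fst (f ?q))) (snd (f ?p)) (snd (f ?q)) (tens ?P ?Q x y))"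
    by (simp add: ind_comp_def ind_tensor_map_def E(1) E(3)[OF xw yw])
  also have "tens_map ?P ?Q (wp V (fst (f ?p))) (wp V (fst (f ?q))) (snd (f ?p)) (snd (f ?q)) (tens ?P ?Q x y) =
      tens (wp V (fst (f ?p))) (wp V (fst (f ?q))) (ev x) (ev y)"
    using f_ev[OF p xw] f_ev[OF q yw]
    by (subst tens_map_lift(2)[OF U.wp_normed[OF p] U.wp_normed[OF q] V.wp_normed[OF f_pos[OF p]]
          V.wp_normed[OF f_pos[OF q]] f_bounded[OF p] f_bounded[OF q] xw yw]) simp
  also have "snd (mlt (pser_alg V) (fst (f ?p), fst (f ?q))) \<dots> = cauchy V (ev x) (ev y)"
    by (rule E'(3)[OF f_closed[OF p xw] f_closed[OF q yw]])
  also have "snd (f (cauchy_radii ?p ?q)) (cauchy U x y) = ev (cauchy U x y)"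
    using bounded_lin_closed[OF E(2) T.tens_closed[OF xw yw]] E(3)[OF xw yw]
    by (intro f_ev cauchy_radii_pos p q) simp
  finally show ?thesis .
qed

text \<open>The square for the action of the power series ring, evaluated at the elementary tensor
  of \<hbar> and \<open>x\<close>.\<close>

lemma ev_hshift:
  assumes x: "x \<in> UNIV \<rightarrow> carrier U"
  shows "ev (hshift U x) = hshift V (ev x)"
proof -
  let ?q = "rad U x" and ?o = "\<lambda>_::nat. 1::real" and ?h = "hshift kban (cst kban 1) :: nat \<Rightarrow> 'k"
  let ?P = "wp (kban :: ('k, 'k) nspace) ?o" and ?Q = "wp U ?q"
  note q = U.rad_pos[OF x] and xw = U.rad_wp[OF x]
  have o: "positive ?o" by simp
  interpret K: normed_sp "kban :: ('k, 'k) nspace" by (rule banach_sp.axioms(1)[OF banach_sp_kban])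
  have h: "?h \<in> carrier ?P"
    by (rule wpI[where B = 1]) (auto simp: hshift_def cst_def split: nat.split)
  interpret T: normed_pair ?P ?Q by (rule normed_pair.intro[OF K.wp_normed[OF o] U.wp_normed[OF q]])
  note E = act_eval[OF U_alg IU o q h xw] and E' = act_eval[OF V_alg IV o f_pos[OF q] h f_closed[OF q xw]]
  have idb: "bounded_lin ?P ?P (\<lambda>x. x)" by (rule bounded_linI[where C = 1]) auto
  have "ind_eq (ind_tensor (pser (kban :: ('k, 'k) nspace)) (pser U)) (pser V) (ind_comp f (act (pser_alg U)))
       (ind_comp (act (pser_alg V)) (ind_tensor_map (pser kban) (pser U) (pser kban) (pser V) ind_id f))"
    using hom by (simp add: kh_alg_hom_def)
  then have "germ_eq (pser V) (carrier (tensor ?P ?Q)) (ind_comp f (act (pser_alg U)) (?o, ?q))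
      (ind_comp (act (pser_alg V)) (ind_tensor_map (pser kban) (pser U) (pser kban) (pser V) ind_id f) (?o, ?q))"
    using o q by (simp add: ind_eq_def)
  from germ_eq_pserD[OF this T.tens_closed[OF h xw]]
  have "snd (f (cauchy_radii ?o ?q)) (hshift U x) =
      snd (act (pser_alg V) (?o, fst (f ?q)))
        (tens_map ?P ?Q ?P (wp V (fst (f ?q))) (\<lambda>x. x) (snd (f ?q)) (tens ?P ?Q ?h x))"
    by (simp add: ind_comp_def ind_tensor_map_def ind_id_def E(1,3) U.hbar_smult[OF x])
  also have "tens_map ?P ?Q ?P (wp V (fst (f ?q))) (\<lambda>x. x) (snd (f ?q)) (tens ?P ?Q ?h x) =
      tens ?P (wp V (fst (f ?q))) ?h (ev x)"
    using f_ev[OF q xw]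
    by (subst tens_map_lift(2)[OF K.wp_normed[OF o] U.wp_normed[OF q] K.wp_normed[OF o]
          V.wp_normed[OF f_pos[OF q]] idb f_bounded[OF q] h xw]) simp
  also have "snd (act (pser_alg V) (?o, fst (f ?q))) \<dots> = hshift V (ev x)"
    using E'(3) V.hbar_smult[OF ev_seq[OF x]] by simp
  also have "snd (f (cauchy_radii ?o ?q)) (hshift U x) = ev (hshift U x)"
    using bounded_lin_closed[OF E(2) T.tens_closed[OF h xw]] E(3)
    by (intro f_ev cauchy_radii_pos o q) (simp add: U.hbar_smult[OF x])
  finally show ?thesis .
qed

lemma ev_one: "ev (cst U \<one>\<^bsub>U\<^esub>) = cst V \<one>\<^bsub>V\<^esub>"
proof -
  have "ind_eq (ind_const kban) (pser V) (ind_comp f (unt (pser_alg U))) (unt (pser_alg V))"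
    using hom by (simp add: kh_alg_hom_def)
  then have "germ_eq (pser V) UNIV (ind_comp f (unt (pser_alg U)) ()) (unt (pser_alg V) ())"
    by (simp add: ind_eq_def)
  from germ_eq_pserD[OF this, of 1] show ?thesis
    using f_ev[OF _ U.cst_wp[OF U.one_closed]] by (simp add: ind_comp_def unt_eval)
qed

text \<open>A composite of bounded maps: constants at radii 1, then \<open>f\<close>, then the
  projection to degree \<open>n\<close>. The bound depends on \<open>n\<close> through the target
  radii.\<close>

lemma ev_cst_bounded: "bounded_lin U V (\<lambda>x. ev (cst U x) n)"
proof -
  have o: "positive (\<lambda>_::nat. 1::real)" by simp
  have "bounded_lin U V (\<lambda>x. snd (f (\<lambda>_. 1)) (cst U x) n)"
    by (rule bounded_lin_comp[OF U.normed_sp_self V.wp_normed[OF f_pos[OF o]]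
          bounded_lin_comp[OF U.normed_sp_self U.wp_normed[OF o] U.cst_bounded f_bounded[OF o]]
          V.proj_bounded[OF f_pos[OF o]]])
  then show ?thesis
    by (rule bounded_lin_cong[OF U.normed_sp_self, rotated]) (simp add: f_ev[OF o U.cst_wp])
qed

lemma ev_cst_mult:
  assumes "x \<in> carrier U" "y \<in> carrier U"
  shows "ev (cst U (x \<otimes>\<^bsub>U\<^esub> y)) = cauchy V (ev (cst U x)) (ev (cst U y))"
proof -
  have "cauchy U (cst U x) (cst U y) n = cst U (x \<otimes>\<^bsub>U\<^esub> y) n" for n
    using U.cauchy_low(2)[of "cst U y" "cst U x" n] assms
    by (cases n) (auto simp: cauchy_def cst_def intro!: U.M.add.finprod_one_eqI)
  then have "cauchy U (cst U x) (cst U y) = cst U (x \<otimes>\<^bsub>U\<^esub> y)" by auto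
  then show ?thesis
    using ev_mult[OF U.cst_seq[OF assms(1)] U.cst_seq[OF assms(2)]] by simp
qed

lemma reduction_ev: "x \<in> carrier U \<Longrightarrow> reduction U f x = ev (cst U x) 0"
  using f_ev[OF _ U.cst_wp, of x]
  by (simp add: reduction_def ind_comp_def mod_hbar_def pser_const_def cst_def[abs_def])

end

section \<open>Generalised elements and conjugation\<close>

lemma (in ring) cst_hshift_split:
  assumes "x \<in> UNIV \<rightarrow> carrier R"
  shows "x = (\<lambda>n. (if n = 0 then x 0 else \<zero>) \<oplus> hshift R (\<lambda>n. x (Suc n)) n)"
proof
  fix n show "x n = (if n = 0 then x 0 else \<zero>) \<oplus> hshift R (\<lambda>n. x (Suc n)) n"
    using assms by (cases n) (auto simp: Pi_iff)
qed

text \<open>In the splitting of \<open>x\<close> into its constant term and \<hbar> times a series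
  \<open>y\<close>, the first part is covered by \<open>eq\<close>, and the second contributes in
  degree \<open>n\<close> the coefficient of degree \<open>n - 1\<close> for \<open>y\<close>.
  Induction on the degree takes the place of a continuity argument in \<hbar>.\<close>

lemma conjugation_extends:
  assumes "pser_hom U V f" "pser_hom U V f'"
    and F: "F \<in> UNIV \<rightarrow> carrier V"
    and eq: "\<And>x. x \<in> carrier U \<Longrightarrow>
      cauchy V F (pser_hom.ev U f (cst U x)) = cauchy V (pser_hom.ev U f' (cst U x)) F"
    and x: "x \<in> UNIV \<rightarrow> carrier U"
  shows "cauchy V F (pser_hom.ev U f x) = cauchy V (pser_hom.ev U f' x) F"
proof
  interpret f: pser_hom U V f by fact
  interpret f': pser_hom U V f' by fact
  fix n show "cauchy V F (f.ev x) n = cauchy V (f'.ev x) F n"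
    using x
  proof (induction n arbitrary: x rule: less_induct)
    case (less n x)
    have x: "x \<in> UNIV \<rightarrow> carrier U" by fact
    define y where "y n = x (Suc n)" for n
    have y: "y \<in> UNIV \<rightarrow> carrier U" using x by (auto simp: y_def)
    have x0: "x 0 \<in> carrier U" using x by auto
    have xs: "x = (\<lambda>n. cst U (x 0) n \<oplus>\<^bsub>U\<^esub> hshift U y n)"
      using f.U.cst_hshift_split[OF x] by (simp add: cst_def y_def[abs_def])
    have e: "f.ev x = (\<lambda>n. f.ev (cst U (x 0)) n \<oplus>\<^bsub>V\<^esub> hshift V (f.ev y) n)"
      "f'.ev x = (\<lambda>n. f'.ev (cst U (x 0)) n \<oplus>\<^bsub>V\<^esub> hshift V (f'.ev y) n)"
      using f.ev_add[OF f.U.cst_seq[OF x0] f.U.hshift_seq[OF y]] f.ev_hshift[OF y]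
        f'.ev_add[OF f.U.cst_seq[OF x0] f.U.hshift_seq[OF y]] f'.ev_hshift[OF y]
      by (simp_all flip: xs)
    note c = f.ev_seq[OF f.U.cst_seq[OF x0]] f'.ev_seq[OF f.U.cst_seq[OF x0]]
      f.V.hshift_seq[OF f.ev_seq[OF y]] f.V.hshift_seq[OF f'.ev_seq[OF y]]
    show ?case
      unfolding e f.V.cauchy_add(2)[OF c(1,3) F] f.V.cauchy_add(1)[OF c(2,4) F] eq[OF x0]
      using f.V.cauchy_hshift(2)[OF F f.ev_seq[OF y]] f.V.cauchy_hshift(1)[OF f'.ev_seq[OF y] F]
        less.IH[OF _ y] by (cases n) simp_all
  qed
qed

text \<open>A morphism from the field is determined by its value at 1, here the sequence
  \<open>F\<close>; \<open>rad V F\<close> provides an index whose space contains it.\<close>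

definition gen_elt :: "('k::complete_nonarch_field, 'v) nspace \<Rightarrow> (nat \<Rightarrow> 'v) \<Rightarrow> (unit, 'k, nat \<Rightarrow> real, nat \<Rightarrow> 'v) ind_mor" where
  "gen_elt V F = (\<lambda>_. (rad V F, \<lambda>c n. c \<odot>\<^bsub>V\<^esub> F n))"

lemma (in normed_sp) gen_elt_bounded:
  assumes F: "F \<in> UNIV \<rightarrow> carrier V"
  shows "bounded_lin kban (wp V (rad V F)) (\<lambda>c n. c \<odot> F n)"
proof (rule bounded_linI[where C = "nrm (wp V (rad V F)) F"])
  interpret W: normed_sp "wp V (rad V F)" by (rule wp_normed[OF rad_pos[OF F]])
  note Fw = rad_wp[OF F]
  fix c d :: 'k
  have Fn: "F n \<in> carrier V" for n using F by auto
  show "(\<lambda>n. c \<odot> F n) \<in> carrier (wp V (rad V F))"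
    using W.sm_closed[OF Fw, of c] by simp
  show "(\<lambda>n. (c \<oplus>\<^bsub>kban\<^esub> d) \<odot> F n) = (\<lambda>n. c \<odot> F n) \<oplus>\<^bsub>wp V (rad V F)\<^esub> (\<lambda>n. d \<odot> F n)"
    using Fn by (simp add: sm_add)
  show "(\<lambda>n. (c \<odot>\<^bsub>kban\<^esub> d) \<odot> F n) = c \<odot>\<^bsub>wp V (rad V F)\<^esub> (\<lambda>n. d \<odot> F n)"
    using Fn by (simp add: sm_assoc)
  show "nrm (wp V (rad V F)) (\<lambda>n. c \<odot> F n) \<le> nrm (wp V (rad V F)) F * nrm kban c"
    using W.nrm_smult[OF Fw, of c] by (simp add: mult.commute)
qed

lemma ind_banach_kban: "ind_banach (ind_const (kban :: ('k::complete_nonarch_field, 'k) nspace))"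
  using banach_sp_kban
  by (auto simp: ind_banach_def banach_space_iff intro!: bounded_linI[where C = 1])

lemma gen_elt_hom:
  assumes V: "normed_sp V" and I: "ind_banach (pser V)" and F: "F \<in> UNIV \<rightarrow> carrier V"
  shows "gen_elt V F \<in> ind_hom (ind_const kban) (pser V)"
proof -
  interpret normed_sp V by fact
  show ?thesis
    using I ind_banach_kban rad_pos[OF F] gen_elt_bounded[OF F]
    by (auto simp: ind_hom_def gen_elt_def intro!: germ_eq_pserI)
qed

lemma (in banach_alg) cauchy_smult:
  assumes F: "F \<in> UNIV \<rightarrow> carrier A" and G: "G \<in> UNIV \<rightarrow> carrier A"
  shows "cauchy A (\<lambda>n. c \<odot> F n) G = (\<lambda>n. c \<odot> cauchy A F G n)"
proof
  fix n
  have m: "F i \<otimes> G j \<in> carrier A" for i j using F G by auto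
  have "cauchy A (\<lambda>n. c \<odot> F n) G n = (\<Oplus>i\<in>{..n}. c \<odot> (F i \<otimes> G (n - i)))"
    unfolding cauchy_def using F G m by (intro finsum_cong') (auto simp: mult_sm1 Pi_iff)
  also have "\<dots> = c \<odot> cauchy A F G n"
    unfolding cauchy_def using m by (intro sm_finsum[symmetric]) auto
  finally show "cauchy A (\<lambda>n. c \<odot> F n) G n = c \<odot> cauchy A F G n" .
qed

text \<open>At a scalar \<open>c\<close> the convolution is \<open>c\<close> times the Cauchy
  product of \<open>F\<close> and \<open>G\<close>, so an inverse relation between series becomes
  one between generalised elements.\<close>

lemma conv_gen_elt:
  assumes A: "banach_alg A" and I: "ind_banach (pser A)"
    and F: "F \<in> UNIV \<rightarrow> carrier A" and G: "G \<in> UNIV \<rightarrow> carrier A"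
    and FG: "cauchy A F G = (\<lambda>n. if n = 0 then \<one>\<^bsub>A\<^esub> else \<zero>\<^bsub>A\<^esub>)"
  shows "ind_eq (ind_const (kban :: ('k::complete_nonarch_field, 'k) nspace)) (pser A)
    (conv (pser_alg A) (gen_elt A F) (gen_elt A G)) (unt (pser_alg A))"
proof -
  interpret A: banach_alg A by fact
  let ?K = "kban :: ('k, 'k) nspace" and ?p = "rad A F" and ?q = "rad A G"
  interpret K: normed_sp ?K by (rule banach_sp.axioms(1)[OF banach_sp_kban])
  note p = A.rad_pos[OF F] and q = A.rad_pos[OF G]
  note E = mlt_eval[OF A I p q]
  have ev: "snd (conv (pser_alg A) (gen_elt A F) (gen_elt A G) ()) c = cst A (c \<odot>\<^bsub>A\<^esub> \<one>\<^bsub>A\<^esub>)" for c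
  proof -
    have c: "(\<lambda>n. c \<odot>\<^bsub>A\<^esub> F n) \<in> carrier (wp A ?p)" "(\<lambda>n. 1 \<odot>\<^bsub>A\<^esub> G n) \<in> carrier (wp A ?q)"
      using bounded_lin_closed[OF A.gen_elt_bounded[OF F], of c] bounded_lin_closed[OF A.gen_elt_bounded[OF G], of 1]
      by auto
    have G1: "(\<lambda>n. 1 \<odot>\<^bsub>A\<^esub> G n) = G" using G by (auto simp: Pi_iff)
    have "snd (conv (pser_alg A) (gen_elt A F) (gen_elt A G) ()) c =
        snd (mlt (pser_alg A) (?p, ?q)) (tens_map ?K ?K (wp A ?p) (wp A ?q)
          (\<lambda>c n. c \<odot>\<^bsub>A\<^esub> F n) (\<lambda>c n. c \<odot>\<^bsub>A\<^esub> G n) (tens ?K ?K c 1))"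
      by (simp add: conv_def ind_comp_def ind_tensor_map_def gen_elt_def)
    also have "tens_map ?K ?K (wp A ?p) (wp A ?q) (\<lambda>c n. c \<odot>\<^bsub>A\<^esub> F n) (\<lambda>c n. c \<odot>\<^bsub>A\<^esub> G n) (tens ?K ?K c 1) =
        tens (wp A ?p) (wp A ?q) (\<lambda>n. c \<odot>\<^bsub>A\<^esub> F n) (\<lambda>n. 1 \<odot>\<^bsub>A\<^esub> G n)"
      by (rule tens_map_lift(2)[OF K.normed_sp_self K.normed_sp_self A.wp_normed[OF p] A.wp_normed[OF q]
            A.gen_elt_bounded[OF F] A.gen_elt_bounded[OF G]]) auto
    also have "snd (mlt (pser_alg A) (?p, ?q)) \<dots> = cauchy A (\<lambda>n. c \<odot>\<^bsub>A\<^esub> F n) G"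
      using E(3)[OF c] G1 by simp
    also have "\<dots> = cst A (c \<odot>\<^bsub>A\<^esub> \<one>\<^bsub>A\<^esub>)"
      unfolding A.cauchy_smult[OF F G] FG by (auto simp: cst_def)
    finally show ?thesis .
  qed
  have "fst (conv (pser_alg A) (gen_elt A F) (gen_elt A G) ()) = cauchy_radii ?p ?q"
    by (simp add: conv_def ind_comp_def ind_tensor_map_def gen_elt_def E(1))
  then show ?thesis
    unfolding ind_eq_def using cauchy_radii_pos[OF p q] ev
    by (auto intro!: germ_eq_pserI simp: unt_eval)
qed

text \<open>The chain defining \<open>conv3\<close> is evaluated at the elementary tensor of 1, x
  and 1 by three uses of \<open>tens_map_lift\<close>. The radii change on the way:
  \<open>cauchy_radii ?p ?s\<close> after the first product, and these combined with
  \<open>?q\<close> after the second.\<close>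

lemma conv3_eval:
  fixes U :: "('k::complete_nonarch_field, 'u) nspace" and V :: "('k, 'v) nspace"
  assumes f: "pser_hom U V f"
    and F: "F \<in> UNIV \<rightarrow> carrier V" and G: "G \<in> UNIV \<rightarrow> carrier V"
    and \<phi>: "positive \<phi>"
  shows "positive (fst (conv3 (pser_alg V) (pser U) (gen_elt V F) f (gen_elt V G) \<phi>))"
    and "x \<in> carrier (wp U \<phi>) \<Longrightarrow> snd (conv3 (pser_alg V) (pser U) (gen_elt V F) f (gen_elt V G) \<phi>) x =
      cauchy V (cauchy V F (pser_hom.ev U f x)) G"
proof -
  interpret f: pser_hom U V f by fact
  interpret K: normed_sp "kban :: ('k, 'k) nspace" by (rule banach_sp.axioms(1)[OF banach_sp_kban])
  let ?K = "kban :: ('k, 'k) nspace"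
  let ?p = "rad V F" and ?q = "rad V G" and ?s = "fst (f \<phi>)"
  let ?F = "\<lambda>c n. c \<odot>\<^bsub>V\<^esub> F n" and ?G = "\<lambda>c n. c \<odot>\<^bsub>V\<^esub> G n"
  note p = f.V.rad_pos[OF F] and q = f.V.rad_pos[OF G] and s = f.f_pos[OF \<phi>]
  have r: "positive (cauchy_radii ?p ?s)" by (rule cauchy_radii_pos[OF p s])
  note E1 = mlt_eval[OF f.V_alg f.IV p s] and E2 = mlt_eval[OF f.V_alg f.IV r q]
  note nU = f.U.wp_normed[OF \<phi>] and np = f.V.wp_normed[OF p] and nq = f.V.wp_normed[OF q]
    and ns = f.V.wp_normed[OF s] and nr = f.V.wp_normed[OF r]
  interpret T1: normed_pair ?K "wp U \<phi>" by (rule normed_pair.intro[OF K.normed_sp_self nU])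
  interpret T2: normed_pair "wp V ?p" "wp V ?s" by (rule normed_pair.intro[OF np ns])
  note b1 = tens_map_lift[OF K.normed_sp_self nU np ns f.V.gen_elt_bounded[OF F] f.f_bounded[OF \<phi>]]
  note b2 = tens_map_lift[OF T1.tensor_normed K.normed_sp_self T2.tensor_normed nq b1(1) f.V.gen_elt_bounded[OF G]]
  have idb: "bounded_lin (wp V ?q) (wp V ?q) (\<lambda>x. x)" by (rule bounded_linI[where C = 1]) auto
  note b3 = tens_map_lift[OF T2.tensor_normed nq nr nq E1(2) idb]
  show "positive (fst (conv3 (pser_alg V) (pser U) (gen_elt V F) f (gen_elt V G) \<phi>))"
    using cauchy_radii_pos[OF r q]
    by (simp add: conv3_def ind_comp_def ind_tensor_map_def gen_elt_def ind_id_def E1(1) E2(1))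
  assume x: "x \<in> carrier (wp U \<phi>)"
  have one: "(\<lambda>n. 1 \<odot>\<^bsub>V\<^esub> F n) = F" "(\<lambda>n. 1 \<odot>\<^bsub>V\<^esub> G n) = G" using F G by (auto simp: Pi_iff)
  have u: "(1::'k) \<in> carrier ?K" by simp
  note t1 = T1.tens_closed[OF u x]
  note Fw = f.V.rad_wp[OF F] and Gw = f.V.rad_wp[OF G] and sw = f.f_closed[OF \<phi> x]
  note t2 = T2.tens_closed[OF Fw sw]
  have r1: "cauchy V F (f.ev x) \<in> carrier (wp V (cauchy_radii ?p ?s))"
    using bounded_lin_closed[OF E1(2) t2] E1(3)[OF Fw sw] by simp
  have "snd (conv3 (pser_alg V) (pser U) (gen_elt V F) f (gen_elt V G) \<phi>) x =
    snd (mlt (pser_alg V) (cauchy_radii ?p ?s, ?q))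
      (tens_map (tensor (wp V ?p) (wp V ?s)) (wp V ?q) (wp V (cauchy_radii ?p ?s)) (wp V ?q)
        (snd (mlt (pser_alg V) (?p, ?s))) (\<lambda>x. x)
        (tens_map (tensor ?K (wp U \<phi>)) ?K (tensor (wp V ?p) (wp V ?s)) (wp V ?q)
          (tens_map ?K (wp U \<phi>) (wp V ?p) (wp V ?s) ?F (snd (f \<phi>))) ?G
          (tens (tensor ?K (wp U \<phi>)) ?K (tens ?K (wp U \<phi>) 1 x) 1)))"
    by (simp add: conv3_def ind_comp_def ind_tensor_map_def gen_elt_def ind_id_def E1(1))
  also have "\<dots> = cauchy V (cauchy V F (f.ev x)) G"
    unfolding b2(2)[OF t1 u] b1(2)[OF u x] one f.f_ev[OF \<phi> x] b3(2)[OF t2 Gw] E1(3)[OF Fw sw]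
      E2(3)[OF r1 Gw] ..
  finally show "snd (conv3 (pser_alg V) (pser U) (gen_elt V F) f (gen_elt V G) \<phi>) x =
      cauchy V (cauchy V F (f.ev x)) G" .
qed

theorem theorem3p67:
  fixes I :: "'i set" and \<Psi> :: "'p::ab_group_add set" and root :: "'i \<Rightarrow> 'p"
    and form :: "'p \<Rightarrow> 'p \<Rightarrow> rat" and lam :: "'i \<Rightarrow> 'p \<Rightarrow> int"
    and I' :: "'j set" and \<Psi>' :: "'q::ab_group_add set" and root' :: "'j \<Rightarrow> 'q"
    and form' :: "'q \<Rightarrow> 'q \<Rightarrow> rat" and lam' :: "'j \<Rightarrow> 'q \<Rightarrow> int"
    and r s r' s' :: real
    and U :: "('k::complete_nonarch_field, ('k, 'i) uan) nspace"
    and U' :: "('k, ('k, 'j) uan) nspace"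
    and \<alpha> \<alpha>' :: "(nat \<Rightarrow> real, nat \<Rightarrow> ('k, 'i) uan, nat \<Rightarrow> real, nat \<Rightarrow> ('k, 'j) uan) ind_mor"
  assumes "root_datum I \<Psi> root form lam"
    and "root_datum I' \<Psi>' root' form' lam'"
    and "0 < r" "0 < s" "0 < r'" "0 < s'"
    and "1 \<le> r * s" "1 \<le> r' * s'"
    and "is_U I (\<lambda>i j. lam i (root j)) r s U"
    and "is_U I' (\<lambda>i j. lam' i (root' j)) r' s' U'"
    and "\<alpha> \<in> kh_alg_hom (pser_alg U) (pser_alg U')"
    and "\<alpha>' \<in> kh_alg_hom (pser_alg U) (pser_alg U')"
    and "cong_mod_hbar U U' \<alpha> \<alpha>'"
    and "Hb_zero (g_an I (\<lambda>i j. lam i (root j)) r s U) (commutator U) U'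
           (\<lambda>x u. commutator U' (reduction U \<alpha> x) u) 1"
  shows "\<exists>F G. conv_inverse (pser_alg U') F G \<and>
           ind_eq (pser U) (pser U') \<alpha>' (conv3 (pser_alg U') (pser U) F \<alpha> G)"
proof -
  note hU = assms(9) and hU' = assms(10) and hal = assms(11) and hal' = assms(12) and cong = assms(13) and H1 = assms(14)
  have algs: "banach_alg U" "banach_alg U'"
    using hU hU' unfolding is_U_def banach_algebra_iff by blast+
  interpret f: pser_hom U U' \<alpha> by (rule pser_hom.intro[OF algs hal])
  interpret f': pser_hom U U' \<alpha>' by (rule pser_hom.intro[OF algs hal'])
  let ?a = "\<lambda>x. f.ev (cst U x)" and ?a' = "\<lambda>x. f'.ev (cst U x)"
  have o: "positive (\<lambda>_::nat. 1::real)" by simp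
  \<comment> \<open>All constants lie in the space with radii 1, and germs into a constant object
    are equal only if the maps are, so the congruence can be read off at that index.\<close>
  have a0: "?a' x 0 = ?a x 0" if x: "x \<in> carrier U" for x
  proof -
    have "germ_eq (ind_const U') (carrier (wp U (\<lambda>_. 1))) (ind_comp mod_hbar \<alpha> (\<lambda>_. 1)) (ind_comp mod_hbar \<alpha>' (\<lambda>_. 1))"
      using cong by (simp add: cong_mod_hbar_def ind_eq_def)
    then have "snd (\<alpha> (\<lambda>_. 1)) (cst U x) 0 = snd (\<alpha>' (\<lambda>_. 1)) (cst U x) 0"
      using f.U.cst_wp[OF x] by (auto simp: germ_eq_def ind_comp_def mod_hbar_def)
    then show ?thesis
      using f.f_ev[OF o f.U.cst_wp[OF x]] f'.f_ev[OF o f.U.cst_wp[OF x]] by simp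
  qed
  have red: "bounded_lin U U' (reduction U \<alpha>)"
    by (rule bounded_lin_cong[OF f.U.normed_sp_self f.reduction_ev f.ev_cst_bounded])
  have red1: "reduction U \<alpha> \<one>\<^bsub>U\<^esub> = \<one>\<^bsub>U'\<^esub>"
    by (simp add: f.reduction_ev f.ev_one) (simp add: cst_def)
  have redm: "reduction U \<alpha> (x \<otimes>\<^bsub>U\<^esub> y) = reduction U \<alpha> x \<otimes>\<^bsub>U'\<^esub> reduction U \<alpha> y"
    if "x \<in> carrier U" "y \<in> carrier U" for x y
    using f.V.cauchy_low(1)[of "?a x" "?a y" 0] f.ev_seq[OF f.U.cst_seq] that
    by (simp add: f.reduction_ev f.ev_cst_mult)
  \<comment> \<open>The Lie algebra acts through \<open>reduction\<close>, while the recursion for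
    \<open>F\<close> works with the degree 0 coefficient \<open>?a x 0\<close>; both agree on
    \<open>U\<close>.\<close>
  have inner: "\<exists>u\<in>carrier U'. \<forall>x\<in>carrier U. D x = ?a x 0 \<otimes>\<^bsub>U'\<^esub> u \<ominus>\<^bsub>U'\<^esub> u \<otimes>\<^bsub>U'\<^esub> ?a x 0"
    if D: "bounded_lin U U' D"
      and Dm: "\<And>x y. x \<in> carrier U \<Longrightarrow> y \<in> carrier U \<Longrightarrow>
        D (x \<otimes>\<^bsub>U\<^esub> y) = ?a x 0 \<otimes>\<^bsub>U'\<^esub> D y \<oplus>\<^bsub>U'\<^esub> D x \<otimes>\<^bsub>U'\<^esub> ?a y 0" for D
  proof -
    have "\<exists>u\<in>carrier U'. \<forall>x\<in>carrier U. D x = reduction U \<alpha> x \<otimes>\<^bsub>U'\<^esub> u \<ominus>\<^bsub>U'\<^esub> u \<otimes>\<^bsub>U'\<^esub> reduction U \<alpha> x"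
      by (rule inner_derivation[OF hU assms(3,4) algs(2) red red1 redm H1 D])
        (simp_all add: Dm f.reduction_ev)
    then show ?thesis by (simp add: f.reduction_ev)
  qed
  obtain F where F: "F \<in> UNIV \<rightarrow> carrier U'" "F 0 = \<one>\<^bsub>U'\<^esub>"
    "\<And>x. x \<in> carrier U \<Longrightarrow> cauchy U' F (?a x) = cauchy U' (?a' x) F"
    using conjugating_series[where a = ?a and a' = ?a', OF algs f.ev_cst_bounded f'.ev_cst_bounded
        f.ev_cst_mult f'.ev_cst_mult a0 inner] by blast
  \<comment> \<open>\<open>F 0 = 1\<close> makes \<open>F\<close> invertible as a series. As every
    sequence defines a generalised element, so does its inverse.\<close>
  obtain G where G: "G \<in> UNIV \<rightarrow> carrier U'" "cauchy U' F G = (\<lambda>n. if n = 0 then \<one>\<^bsub>U'\<^esub> else \<zero>\<^bsub>U'\<^esub>)"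
    "cauchy U' G F = (\<lambda>n. if n = 0 then \<one>\<^bsub>U'\<^esub> else \<zero>\<^bsub>U'\<^esub>)"
    using f.V.fps_inverse[OF F(1,2)] by metis
  \<comment> \<open>The intertwining relation was solved on constants only; it is extended to all
    series and then multiplied by \<open>G\<close> on the right.\<close>
  have conj: "f'.ev x = cauchy U' (cauchy U' F (f.ev x)) G" if x: "x \<in> UNIV \<rightarrow> carrier U" for x
  proof -
    have "cauchy U' (cauchy U' F (f.ev x)) G = cauchy U' (cauchy U' (f'.ev x) F) G"
      using conjugation_extends[OF f.pser_hom_axioms f'.pser_hom_axioms F(1,3) x] by simp
    also have "\<dots> = f'.ev x"
      using f.V.cauchy_assoc[OF f'.ev_seq[OF x] F(1) G(1)] f.V.cauchy_one(2)[OF f'.ev_seq[OF x]] G(2) by simp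
    finally show ?thesis by simp
  qed
  \<comment> \<open>Since germs into power series objects are compared as functions, the identity on
    sequences suffices once both indices are known to be positive.\<close>
  have "ind_eq (pser U) (pser U') \<alpha>' (conv3 (pser_alg U') (pser U) (gen_elt U' F) \<alpha> (gen_elt U' G))"
    unfolding ind_eq_def
  proof
    fix \<phi> assume "\<phi> \<in> idx (pser U)"
    then have \<phi>: "positive \<phi>" by simp
    note E = conv3_eval[OF f.pser_hom_axioms F(1) G(1) \<phi>]
    show "germ_eq (pser U') (carrier (isp (pser U) \<phi>)) (\<alpha>' \<phi>)
        (conv3 (pser_alg U') (pser U) (gen_elt U' F) \<alpha> (gen_elt U' G) \<phi>)"
    proof (rule germ_eq_pserI[OF f'.f_pos[OF \<phi>] E(1)])
      fix x assume "x \<in> carrier (isp (pser U) \<phi>)"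
      then have x: "x \<in> carrier (wp U \<phi>)" by simp
      then have "x \<in> UNIV \<rightarrow> carrier U" by (simp add: wp_carrier)
      then show "snd (\<alpha>' \<phi>) x = snd (conv3 (pser_alg U') (pser U) (gen_elt U' F) \<alpha> (gen_elt U' G) \<phi>) x"
        using E(2)[OF x] f'.f_ev[OF \<phi> x] conj by simp
    qed
  qed
  moreover have "conv_inverse (pser_alg U') (gen_elt U' F) (gen_elt U' G)"
    unfolding conv_inverse_def ob_pser_alg
    using gen_elt_hom[OF f.V.normed_sp_self f.IV] conv_gen_elt[OF algs(2) f.IV] F(1) G by blast
  ultimately show ?thesis by blast
qed

end
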